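(* Let $X$ be a continuum and let $\{f_i : X_i \to X = X_i/G_i\}$ be the set of all covers of $X$ by continua (one representative for each equivalence class). Then: 1. The set of all covers $f_i$ is a directed set with respect to $\leq$. 2. For all $i,j$ with $f_i\leq f_j$ there are unique (mod $G_i$) regular covering maps $f_{ij}:X_j\to X_i$ with $f_j=f_i\circ f_{ij}$ that are the bonding maps for the inverse system $\{X_i,f_{ij}\}$, and compatible homomorphisms $\theta_{ij}:G_j\to G_i$, i.e. for all such $i,j$ and all $g\in G_j$, $\theta_{ij}(g)\circ f_{ij}=f_{ij}\circ g$. 3. The projection $\widehat{\phi}:\widehat{X}=\varprojlim X_i\to X=\widehat{X}/\pi_P(X)$ is a generalized regular covering map with profinite deck group $\pi_P(X)=\varprojlim G_i$, and $\widehat{X}$ is a continuum.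
   Context: A continuum is a compact, connected, metrizable space. A regular covering map $f:Y\to X=Y/G$ between topological spaces is a covering map in the usual sense that is also the quotient map of a free action of a group $G$ of homeomorphisms of $Y$. A cover of a continuum $X$ by a continuum is a regular covering map $f:Y\to X=Y/G$ with $Y$ a continuum. Two covers $f_1:Y_1\to X=Y_1/G_1$, $f_2:Y_2\to X=Y_2/G_2$ are equivalent if there are a homeomorphism $h:Y_1\to Y_2$ and an isomorphism $\theta:G_1\to G_2$ with $f_2\circ h=f_1$ and $h\circ g=\theta(g)\circ h$ for all $g\in G_1$; in the family $\{f_i\}$ distinct indices correspond to non-equivalent covers. For covers by continua $f_i,f_j$ one writes $f_i\leq f_j$ if there is a continuous surjection $f_{ij}:X_j\to X_i$ with $f_j=f_i\circ f_{ij}$. "Unique (mod $G_i$)" means that the set of all maps with the stated properties is $\{g\circ f_{ij}: g\in G_i\}$. Fixing basepoints $*$ in $X$ and in each $X_i$, the $f_i$ and the bonding maps are taken basepoint preserving. $\varprojlim G_i$ (with bonding maps $\theta_{ij}$, finite groups being discrete) acts on $\varprojlim X_i$ coordinatewise. Uniform spaces: a uniform space is a topological space with a compatible uniformity, whose entourages are taken to be symmetric; a compact space carries its unique compatible uniformity, whose entourages are all symmetric neighborhoods of the diagonal. For a map $g$ and $E\subset X\times X$, $g(E)$ means $(g\times g)(E)$. A group $G$ of bijections of a uniform space $Y$ acts isomorphically if $Y$ has a basis of entourages $E$ with $g(E)=E$ for all $g\in G$; $Y/G$ then has the quotient uniformity, consisting of the images of entourages. For an entourage $E$ let $U_E(G)=\{g\in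 G:(y,g(y))\in E\text{ for all }y\in Y\}$, $S_E(G)=\{g\in G:(y,g(y))\in E\text{ for some }y\in Y\}$, and let $N_E(G)$ be the subgroup generated by $S_E(G)$. $G$ acts prodiscretely if for every entourage $E$ there is an entourage $F$ with $N_F(G)\subset U_E(G)$. $G$ has the topology (and uniformity) of uniform convergence, for which the $U_E(G)$ form a basis at the identity. A generalized regular covering map with deck group $G$ is the quotient map $Y\to Y/G$ of an isomorphic and prodiscrete action of a complete group $G$ on a uniform space $Y$; writing $f:Y\to X=Y/G$ means that the uniform space $X$ is identified with $Y/G$ via $f$. *)

theory Defs
  imports "HOL-Analysis.Analysis" "HOL-Algebra.Bij" "HOL-Algebra.Generated_Groups"
    "HOL-Algebra.Product_Groups"
begin

section \<open>Continua and their covers\<close>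

definition continuum :: "'a topology \<Rightarrow> bool" where
  "continuum X \<longleftrightarrow>
     topspace X \<noteq> {} \<and> compact_space X \<and> connected_space X \<and> metrizable_space X"

text \<open>
  The analogue for abstract topologies of \<^const>\<open>covering_space\<close>.
\<close>

definition covering_map :: "'b topology \<Rightarrow> 'a topology \<Rightarrow> ('b \<Rightarrow> 'a) \<Rightarrow> bool" where
  "covering_map Y X f \<longleftrightarrow>
     continuous_map Y X f \<and> f ` topspace Y = topspace X \<and>
     (\<forall>x\<in>topspace X. \<exists>T. openin X T \<and> x \<in> T \<and>
        (\<exists>\<V>. \<Union>\<V> = {y \<in> topspace Y. f y \<in> T} \<and>
             (\<forall>V\<in>\<V>. openin Y V) \<and> pairwise disjnt \<V> \<and>
             (\<forall>V\<in>\<V>. homeomorphic_map (subtopology Y V) (subtopology X T) f)))"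

text \<open>
  A group of bijections of a set \<open>S\<close> is a subgroup of \<^term>\<open>BijGroup S\<close>; its elements are
  extensional functions, so that the group is determined by its action on \<open>S\<close>.
\<close>

definition bij_subgroup :: "'b set \<Rightarrow> ('b \<Rightarrow> 'b) set \<Rightarrow> ('b \<Rightarrow> 'b) monoid" where
  "bij_subgroup S G = (BijGroup S)\<lparr>carrier := G\<rparr>"

definition homeo_group :: "'b topology \<Rightarrow> ('b \<Rightarrow> 'b) set \<Rightarrow> bool" where
  "homeo_group Y G \<longleftrightarrow>
     subgroup G (BijGroup (topspace Y)) \<and> (\<forall>g\<in>G. homeomorphic_map Y Y g)"

definition free_action :: "'b set \<Rightarrow> ('b \<Rightarrow> 'b) set \<Rightarrow> bool" where
  "free_action S G \<longleftrightarrow> (\<forall>g\<in>G. \<forall>y\<in>S. g y = y \<longrightarrow> g = (\<lambda>x\<in>S. x))"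

definition fibres_are_orbits :: "'b set \<Rightarrow> ('b \<Rightarrow> 'b) set \<Rightarrow> ('b \<Rightarrow> 'a) \<Rightarrow> bool" where
  "fibres_are_orbits S G f \<longleftrightarrow> (\<forall>y\<in>S. \<forall>z\<in>S. f y = f z \<longleftrightarrow> (\<exists>g\<in>G. z = g y))"

definition regular_covering_map ::
  "'b topology \<Rightarrow> ('b \<Rightarrow> 'b) set \<Rightarrow> 'a topology \<Rightarrow> ('b \<Rightarrow> 'a) \<Rightarrow> bool" where
  "regular_covering_map Y G X f \<longleftrightarrow>
     covering_map Y X f \<and>
     homeo_group Y G \<and> free_action (topspace Y) G \<and>
     quotient_map Y X f \<and> fibres_are_orbits (topspace Y) G f"

definition continuum_cover ::
  "'a topology \<Rightarrow> 'b topology \<Rightarrow> ('b \<Rightarrow> 'b) set \<Rightarrow> ('b \<Rightarrow> 'a) \<Rightarrow> bool" where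
  "continuum_cover X Y G f \<longleftrightarrow> continuum Y \<and> regular_covering_map Y G X f"

definition equivalent_covers ::
  "'b topology \<Rightarrow> ('b \<Rightarrow> 'b) set \<Rightarrow> ('b \<Rightarrow> 'a) \<Rightarrow>
   'c topology \<Rightarrow> ('c \<Rightarrow> 'c) set \<Rightarrow> ('c \<Rightarrow> 'a) \<Rightarrow> bool" where
  "equivalent_covers Y1 G1 f1 Y2 G2 f2 \<longleftrightarrow>
     (\<exists>h \<theta>. homeomorphic_map Y1 Y2 h \<and>
        \<theta> \<in> iso (bij_subgroup (topspace Y1) G1) (bij_subgroup (topspace Y2) G2) \<and>
        (\<forall>y\<in>topspace Y1. f2 (h y) = f1 y) \<and>
        (\<forall>g\<in>G1. \<forall>y\<in>topspace Y1. h (g y) = \<theta> g (h y)))"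

definition cover_le :: "('i \<Rightarrow> 'b topology) \<Rightarrow> ('i \<Rightarrow> 'b \<Rightarrow> 'a) \<Rightarrow> 'i \<Rightarrow> 'i \<Rightarrow> bool" where
  "cover_le Xs fs i j \<longleftrightarrow>
     (\<exists>h. continuous_map (Xs j) (Xs i) h \<and> h ` topspace (Xs j) = topspace (Xs i) \<and>
          (\<forall>x\<in>topspace (Xs j). fs j x = fs i (h x)))"

text \<open>
  Maps are taken extensional, so that the set contains no duplicates differing only
  outside the domain.
\<close>

definition regular_covering_factors ::
  "'b topology \<Rightarrow> ('b \<Rightarrow> 'a) \<Rightarrow> 'c topology \<Rightarrow> ('c \<Rightarrow> 'a) \<Rightarrow> ('c \<Rightarrow> 'b) set" where
  "regular_covering_factors Y1 f1 Y2 f2 =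
     {h \<in> extensional (topspace Y2).
        (\<exists>H. regular_covering_map Y2 H Y1 h) \<and> (\<forall>x\<in>topspace Y2. f2 x = f1 (h x))}"


section \<open>Inverse systems and their limits\<close>

definition directed_on :: "'i set \<Rightarrow> ('i \<Rightarrow> 'i \<Rightarrow> bool) \<Rightarrow> bool" where
  "directed_on I rel \<longleftrightarrow>
     I \<noteq> {} \<and> reflp_on I rel \<and> transp_on I rel \<and>
     (\<forall>i\<in>I. \<forall>j\<in>I. \<exists>k\<in>I. rel i k \<and> rel j k)"

definition functorial_on ::
  "'i set \<Rightarrow> ('i \<Rightarrow> 'i \<Rightarrow> bool) \<Rightarrow> ('i \<Rightarrow> 'b set) \<Rightarrow> ('i \<Rightarrow> 'i \<Rightarrow> 'b \<Rightarrow> 'b) \<Rightarrow> bool" where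
  "functorial_on I rel A f \<longleftrightarrow>
     (\<forall>i\<in>I. \<forall>x\<in>A i. f i i x = x) \<and>
     (\<forall>i\<in>I. \<forall>j\<in>I. \<forall>k\<in>I. rel i j \<longrightarrow> rel j k \<longrightarrow> (\<forall>x\<in>A k. f i j (f j k x) = f i k x))"

definition inverse_system ::
  "'i set \<Rightarrow> ('i \<Rightarrow> 'i \<Rightarrow> bool) \<Rightarrow> ('i \<Rightarrow> 'b topology) \<Rightarrow> ('i \<Rightarrow> 'i \<Rightarrow> 'b \<Rightarrow> 'b) \<Rightarrow> bool" where
  "inverse_system I rel Xs f \<longleftrightarrow>
     (\<forall>i\<in>I. \<forall>j\<in>I. rel i j \<longrightarrow> continuous_map (Xs j) (Xs i) (f i j)) \<and>
     functorial_on I rel (\<lambda>i. topspace (Xs i)) f"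

definition group_inverse_system ::
  "'i set \<Rightarrow> ('i \<Rightarrow> 'i \<Rightarrow> bool) \<Rightarrow> ('i \<Rightarrow> 'g monoid) \<Rightarrow> ('i \<Rightarrow> 'i \<Rightarrow> 'g \<Rightarrow> 'g) \<Rightarrow> bool" where
  "group_inverse_system I rel Gm \<theta> \<longleftrightarrow>
     (\<forall>i\<in>I. group (Gm i)) \<and>
     (\<forall>i\<in>I. \<forall>j\<in>I. rel i j \<longrightarrow> \<theta> i j \<in> hom (Gm j) (Gm i)) \<and>
     functorial_on I rel (\<lambda>i. carrier (Gm i)) \<theta>"

definition inverse_limit_set ::
  "'i set \<Rightarrow> ('i \<Rightarrow> 'i \<Rightarrow> bool) \<Rightarrow> ('i \<Rightarrow> 'b set) \<Rightarrow> ('i \<Rightarrow> 'i \<Rightarrow> 'b \<Rightarrow> 'b) \<Rightarrow> ('i \<Rightarrow> 'b) set" where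
  "inverse_limit_set I rel A f =
     {x \<in> \<Pi>\<^sub>E i\<in>I. A i. \<forall>i\<in>I. \<forall>j\<in>I. rel i j \<longrightarrow> f i j (x j) = x i}"

definition inverse_limit ::
  "'i set \<Rightarrow> ('i \<Rightarrow> 'i \<Rightarrow> bool) \<Rightarrow> ('i \<Rightarrow> 'b topology) \<Rightarrow> ('i \<Rightarrow> 'i \<Rightarrow> 'b \<Rightarrow> 'b) \<Rightarrow>
   ('i \<Rightarrow> 'b) topology" where
  "inverse_limit I rel Xs f =
     subtopology (product_topology Xs I) (inverse_limit_set I rel (\<lambda>i. topspace (Xs i)) f)"

definition inverse_limit_group ::
  "'i set \<Rightarrow> ('i \<Rightarrow> 'i \<Rightarrow> bool) \<Rightarrow> ('i \<Rightarrow> 'g monoid) \<Rightarrow> ('i \<Rightarrow> 'i \<Rightarrow> 'g \<Rightarrow> 'g) \<Rightarrow>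
   ('i \<Rightarrow> 'g) monoid" where
  "inverse_limit_group I rel Gm \<theta> =
     (product_group I Gm)\<lparr>carrier := inverse_limit_set I rel (\<lambda>i. carrier (Gm i)) \<theta>\<rparr>"

definition profinite_group :: "'g monoid \<Rightarrow> 'g topology \<Rightarrow> bool" where
  "profinite_group P T \<longleftrightarrow>
     group P \<and> topspace T = carrier P \<and>
     continuous_map (prod_topology T T) T (\<lambda>(x, y). x \<otimes>\<^bsub>P\<^esub> y) \<and>
     continuous_map T T (\<lambda>x. inv\<^bsub>P\<^esub> x) \<and>
     compact_space T \<and> Hausdorff_space T \<and>
     (\<forall>x\<in>topspace T. connected_component_of_set T x = {x})"

definition coordinatewise :: "'i set \<Rightarrow> ('i \<Rightarrow> 'b) set \<Rightarrow> ('i \<Rightarrow> 'b \<Rightarrow> 'b) \<Rightarrow> ('i \<Rightarrow> 'b) \<Rightarrow> ('i \<Rightarrow> 'b)" where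
  "coordinatewise I S g = (\<lambda>x\<in>S. \<lambda>i\<in>I. g i (x i))"


section \<open>Uniform spaces\<close>

text \<open>
  A uniformity on the set \<open>S\<close>, given by its symmetric entourages.
\<close>

definition uniformity_on :: "'a set \<Rightarrow> ('a \<times> 'a) set set \<Rightarrow> bool" where
  "uniformity_on S \<E> \<longleftrightarrow>
     \<E> \<noteq> {} \<and>
     (\<forall>E\<in>\<E>. Id_on S \<subseteq> E \<and> E \<subseteq> S \<times> S \<and> sym E) \<and>
     (\<forall>E\<in>\<E>. \<forall>F. E \<subseteq> F \<and> F \<subseteq> S \<times> S \<and> sym F \<longrightarrow> F \<in> \<E>) \<and>
     (\<forall>E\<in>\<E>. \<forall>F\<in>\<E>. E \<inter> F \<in> \<E>) \<and>
     (\<forall>E\<in>\<E>. \<exists>F\<in>\<E>. F O F \<subseteq> E)"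

definition uniformly_open :: "'a set \<Rightarrow> ('a \<times> 'a) set set \<Rightarrow> 'a set \<Rightarrow> bool" where
  "uniformly_open S \<E> U \<longleftrightarrow> U \<subseteq> S \<and> (\<forall>x\<in>U. \<exists>E\<in>\<E>. E `` {x} \<subseteq> U)"

definition uniform_topology :: "'a set \<Rightarrow> ('a \<times> 'a) set set \<Rightarrow> 'a topology" where
  "uniform_topology S \<E> = topology (uniformly_open S \<E>)"

lemma istopology_uniformly_open:
  assumes "uniformity_on S \<E>"
  shows "istopology (uniformly_open S \<E>)"
proof -
  have inter: "uniformly_open S \<E> (U \<inter> V)"
    if U: "uniformly_open S \<E> U" and V: "uniformly_open S \<E> V" for U V
    unfolding uniformly_open_def
  proof (intro conjI ballI)
    show "U \<inter> V \<subseteq> S"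
      using U by (auto simp: uniformly_open_def)
  next
    fix x assume "x \<in> U \<inter> V"
    then obtain E F where "E \<in> \<E>" "F \<in> \<E>" "E `` {x} \<subseteq> U" "F `` {x} \<subseteq> V"
      using U V unfolding uniformly_open_def by blast
    moreover from this have "E \<inter> F \<in> \<E>"
      using assms unfolding uniformity_on_def by blast
    ultimately show "\<exists>E\<in>\<E>. E `` {x} \<subseteq> U \<inter> V"
      by (intro bexI[of _ "E \<inter> F"]) auto
  qed
  have "uniformly_open S \<E> (\<Union>\<K>)" if \<K>: "\<forall>K\<in>\<K>. uniformly_open S \<E> K" for \<K>
    unfolding uniformly_open_def
  proof (intro conjI ballI)
    show "\<Union>\<K> \<subseteq> S"
      using \<K> by (auto simp: uniformly_open_def)
  next
    fix x assume "x \<in> \<Union>\<K>"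
    then obtain K where "K \<in> \<K>" "x \<in> K" by blast
    then show "\<exists>E\<in>\<E>. E `` {x} \<subseteq> \<Union>\<K>"
      using \<K> unfolding uniformly_open_def by (meson Union_upper subset_trans)
  qed
  with inter show ?thesis
    unfolding istopology_def by blast
qed

lemma openin_uniform_topology:
  assumes "uniformity_on S \<E>"
  shows "openin (uniform_topology S \<E>) U \<longleftrightarrow> uniformly_open S \<E> U"
  using istopology_uniformly_open[OF assms] by (simp add: uniform_topology_def)

definition uniform_space_on :: "'a topology \<Rightarrow> ('a \<times> 'a) set set \<Rightarrow> bool" where
  "uniform_space_on X \<E> \<longleftrightarrow>
     uniformity_on (topspace X) \<E> \<and> uniform_topology (topspace X) \<E> = X"

text \<open>
  For compact Hausdorff \<open>X\<close> this is the unique compatible uniformity.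
\<close>

definition compact_entourages :: "'a topology \<Rightarrow> ('a \<times> 'a) set set" where
  "compact_entourages X =
     {E. E \<subseteq> topspace X \<times> topspace X \<and> sym E \<and>
         (\<exists>W. openin (prod_topology X X) W \<and> Id_on (topspace X) \<subseteq> W \<and> W \<subseteq> E)}"

definition complete_uniformity :: "'a set \<Rightarrow> ('a \<times> 'a) set set \<Rightarrow> bool" where
  "complete_uniformity S \<E> \<longleftrightarrow>
     (\<forall>F. F \<noteq> bot \<longrightarrow> (\<forall>\<^sub>F x in F. x \<in> S) \<longrightarrow>
          (\<forall>E\<in>\<E>. \<exists>A. (\<forall>\<^sub>F x in F. x \<in> A) \<and> A \<times> A \<subseteq> E) \<longrightarrow>
          (\<exists>l\<in>S. \<forall>E\<in>\<E>. \<forall>\<^sub>F x in F. (l, x) \<in> E))"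


section \<open>Generalized regular covering maps\<close>

definition acts_isomorphically :: "('a \<times> 'a) set set \<Rightarrow> ('a \<Rightarrow> 'a) set \<Rightarrow> bool" where
  "acts_isomorphically \<E> G \<longleftrightarrow>
     (\<forall>E\<in>\<E>. \<exists>F\<in>\<E>. F \<subseteq> E \<and> (\<forall>g\<in>G. map_prod g g ` F = F))"

definition U_ent :: "'a set \<Rightarrow> ('a \<Rightarrow> 'a) set \<Rightarrow> ('a \<times> 'a) set \<Rightarrow> ('a \<Rightarrow> 'a) set" where
  "U_ent S G E = {g \<in> G. \<forall>y\<in>S. (y, g y) \<in> E}"

definition S_ent :: "'a set \<Rightarrow> ('a \<Rightarrow> 'a) set \<Rightarrow> ('a \<times> 'a) set \<Rightarrow> ('a \<Rightarrow> 'a) set" where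
  "S_ent S G E = {g \<in> G. \<exists>y\<in>S. (y, g y) \<in> E}"

definition N_ent :: "'a set \<Rightarrow> ('a \<Rightarrow> 'a) set \<Rightarrow> ('a \<times> 'a) set \<Rightarrow> ('a \<Rightarrow> 'a) set" where
  "N_ent S G E = generate (BijGroup S) (S_ent S G E)"

definition acts_prodiscretely ::
  "'a set \<Rightarrow> ('a \<times> 'a) set set \<Rightarrow> ('a \<Rightarrow> 'a) set \<Rightarrow> bool" where
  "acts_prodiscretely S \<E> G \<longleftrightarrow> (\<forall>E\<in>\<E>. \<exists>F\<in>\<E>. N_ent S G F \<subseteq> U_ent S G E)"

definition uniform_convergence ::
  "'a set \<Rightarrow> ('a \<times> 'a) set set \<Rightarrow> ('a \<Rightarrow> 'a) set \<Rightarrow> (('a \<Rightarrow> 'a) \<times> ('a \<Rightarrow> 'a)) set set" where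
  "uniform_convergence S \<E> G =
     {V. V \<subseteq> G \<times> G \<and> sym V \<and>
         (\<exists>E\<in>\<E>. {(g, h). g \<in> G \<and> h \<in> G \<and> (\<forall>y\<in>S. (g y, h y) \<in> E)} \<subseteq> V)}"

text \<open>
  \<open>generalized_regular_covering_map Y \<E> G X \<F> f\<close>: the uniform space \<open>(X, \<F>)\<close> is identified
  with the quotient by \<open>G\<close> of the uniform space \<open>(Y, \<E>)\<close> by means of \<open>f\<close>.
\<close>

definition generalized_regular_covering_map ::
  "'b topology \<Rightarrow> ('b \<times> 'b) set set \<Rightarrow> ('b \<Rightarrow> 'b) set \<Rightarrow>
   'a topology \<Rightarrow> ('a \<times> 'a) set set \<Rightarrow> ('b \<Rightarrow> 'a) \<Rightarrow> bool" where
  "generalized_regular_covering_map Y \<E> G X \<F> f \<longleftrightarrow>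
     uniform_space_on Y \<E> \<and> uniform_space_on X \<F> \<and>
     subgroup G (BijGroup (topspace Y)) \<and>
     acts_isomorphically \<E> G \<and> acts_prodiscretely (topspace Y) \<E> G \<and>
     complete_uniformity G (uniform_convergence (topspace Y) \<E> G) \<and>
     quotient_map Y X f \<and> fibres_are_orbits (topspace Y) G f \<and>
     \<F> = (\<lambda>E. map_prod f f ` E) ` \<E>"

end

theory Submission
  imports Defs
begin

text \<open>
  No local connectedness is available, so neither path lifting nor fundamental groups can be used.
  Everything rests instead on finiteness. A cover of a continuum by a continuum has finite fibres
  and hence a finite group, and conversely the quotient of a compact Hausdorff space by a finite
  group that acts freely is automatically a covering
  (\<open>continuum_cover_imp_finite_regular_cover\<close>, \<open>regular_covering\<close>). Covers can therefore be
  handled as free actions of finite groups on connected compact spaces.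

  The main tool is unique lifting (\<open>unique_lift\<close>): two lifts of a map of a connected space to a
  cover differ by one deck transformation, because the sets on which they differ by a given one are
  finitely many, closed, disjoint and cover the space. It shows that the given group is the full
  deck group, that a map between two covers is unique up to the group of the lower one and is itself
  a regular covering, that deck transformations of the upper cover descend to the lower one, and
  that the base points make the bonding maps functorial.

  Two covers have a common refinement (\<open>common_refinement\<close>): every nonempty clopen subset of their
  fibre product meets every fibre, so there is a minimal clopen neighbourhood of any point. It is
  connected, and its deck group is free by unique lifting and transitive on fibres. This makes the
  family of covers directed.

  The limit of the covers is compact and connected as an inverse limit of continua. Its
  metrizability depends on the fact that there are only countably many covers
  (\<open>countable_covers\<close>): a sufficiently fine finite net in \<open>X\<close>, together with the finite relation of
  closeness between the points that lie over it, determines a cover up to equivalence.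

  For the action of the limit group, the decisive fact is that an entourage of the limit always
  contains the relation of having the same coordinate at some stage \<open>i\<close>
  (\<open>stage_of_entourage\<close>), whereas a stage has an entourage that separates the points of each fibre
  (\<open>separating_entourage\<close>). Hence uniform closeness of deck transformations is agreement at a stage,
  which identifies the topology of uniform convergence with that of the inverse limit and gives
  completeness; and a transformation that moves a single point by a small amount is trivial at a
  stage, which gives prodiscreteness. Transitivity on the fibres of the limit needs no choice of
  compatible elements: at every stage exactly one deck transformation moves one coordinate to the
  other, and by uniqueness these form a thread.
\<close>

section \<open>Groups of bijections\<close>

lemma compose_eq_idD: "compose S g h = (\<lambda>x\<in>S. x) \<Longrightarrow> x \<in> S \<Longrightarrow> g (h x) = x"
  by (metis compose_eq restrict_apply')

text \<open>
  A criterion in terms of pointwise inverses, which avoids the extensional functions that serve as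
  inverses in the group of bijections.
\<close>

lemma subgroup_BijGroup_iff:
  "subgroup G (BijGroup S) \<longleftrightarrow>
     G \<subseteq> Bij S \<and> (\<lambda>x\<in>S. x) \<in> G \<and> (\<forall>g\<in>G. \<forall>h\<in>G. compose S g h \<in> G) \<and>
     (\<forall>g\<in>G. \<exists>h\<in>G. \<forall>x\<in>S. h (g x) = x \<and> g (h x) = x)"
proof
  assume G: "subgroup G (BijGroup S)"
  then have sub: "G \<subseteq> Bij S"
    using subgroup.subset by (fastforce simp: BijGroup_def)
  have "\<exists>h\<in>G. \<forall>x\<in>S. h (g x) = x \<and> g (h x) = x" if "g \<in> G" for g
  proof (intro bexI ballI)
    have inv: "inv\<^bsub>BijGroup S\<^esub> g \<in> G"
      using G that by (simp add: subgroup.m_inv_closed)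
    then have "inv\<^bsub>BijGroup S\<^esub> g \<in> Bij S" "g \<in> Bij S"
      using sub that by auto
    moreover have "g \<in> carrier (BijGroup S)"
      using \<open>g \<in> Bij S\<close> by (simp add: BijGroup_def)
    then have "inv\<^bsub>BijGroup S\<^esub> g \<otimes>\<^bsub>BijGroup S\<^esub> g = \<one>\<^bsub>BijGroup S\<^esub>"
      "g \<otimes>\<^bsub>BijGroup S\<^esub> inv\<^bsub>BijGroup S\<^esub> g = \<one>\<^bsub>BijGroup S\<^esub>"
      using group.l_inv[OF group_BijGroup] group.r_inv[OF group_BijGroup] by blast+
    moreover have "h \<otimes>\<^bsub>BijGroup S\<^esub> g = compose S h g \<and> g \<otimes>\<^bsub>BijGroup S\<^esub> h = compose S g h"
      "\<one>\<^bsub>BijGroup S\<^esub> = (\<lambda>x\<in>S. x)" if "h \<in> Bij S" for h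
      using that \<open>g \<in> Bij S\<close> by (auto simp: BijGroup_def)
    ultimately have "compose S (inv\<^bsub>BijGroup S\<^esub> g) g = (\<lambda>x\<in>S. x)"
      "compose S g (inv\<^bsub>BijGroup S\<^esub> g) = (\<lambda>x\<in>S. x)"
      by metis+
    then show "(inv\<^bsub>BijGroup S\<^esub> g) (g x) = x \<and> g ((inv\<^bsub>BijGroup S\<^esub> g) x) = x" if "x \<in> S" for x
      using that by (simp add: compose_eq_idD)
    show "inv\<^bsub>BijGroup S\<^esub> g \<in> G" by fact
  qed
  moreover have "(\<lambda>x\<in>S. x) \<in> G"
    using subgroup.one_closed[OF G] by (simp add: BijGroup_def)
  moreover have "compose S g h \<in> G" if "g \<in> G" "h \<in> G" for g h
  proof -
    have "g \<in> Bij S" "h \<in> Bij S" using that sub by auto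
    then show ?thesis
      using subgroup.m_closed[OF G that] by (simp add: BijGroup_def)
  qed
  ultimately show "G \<subseteq> Bij S \<and> (\<lambda>x\<in>S. x) \<in> G \<and> (\<forall>g\<in>G. \<forall>h\<in>G. compose S g h \<in> G) \<and>
     (\<forall>g\<in>G. \<exists>h\<in>G. \<forall>x\<in>S. h (g x) = x \<and> g (h x) = x)"
    using sub by blast
next
  assume G: "G \<subseteq> Bij S \<and> (\<lambda>x\<in>S. x) \<in> G \<and> (\<forall>g\<in>G. \<forall>h\<in>G. compose S g h \<in> G) \<and>
     (\<forall>g\<in>G. \<exists>h\<in>G. \<forall>x\<in>S. h (g x) = x \<and> g (h x) = x)"
  show "subgroup G (BijGroup S)"
  proof (rule group.subgroupI[OF group_BijGroup])
    show "G \<subseteq> carrier (BijGroup S)" "G \<noteq> {}"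
      using G by (auto simp: BijGroup_def)
    show "g \<otimes>\<^bsub>BijGroup S\<^esub> h \<in> G" if "g \<in> G" "h \<in> G" for g h
      using that G by (auto simp: BijGroup_def subset_iff)
    show "inv\<^bsub>BijGroup S\<^esub> g \<in> G" if g: "g \<in> G" for g
    proof -
      obtain h where h: "h \<in> G" "\<forall>x\<in>S. h (g x) = x"
        using G g by meson
      have "g \<in> Bij S" "h \<in> Bij S"
        using g h(1) G by blast+
      moreover have "compose S h g = (\<lambda>x\<in>S. x)"
        using h by (auto simp: compose_def)
      ultimately have "h \<otimes>\<^bsub>BijGroup S\<^esub> g = \<one>\<^bsub>BijGroup S\<^esub>"
        "g \<in> carrier (BijGroup S)" "h \<in> carrier (BijGroup S)"
        by (simp_all add: BijGroup_def)
      then have "inv\<^bsub>BijGroup S\<^esub> g = h"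
        by (rule group.inv_equality[OF group_BijGroup])
      then show ?thesis using h by simp
    qed
  qed
qed

lemma group_bij_subgroup: "subgroup G (BijGroup S) \<Longrightarrow> group (bij_subgroup S G)"
  unfolding bij_subgroup_def by (rule subgroup.subgroup_is_group[OF _ group_BijGroup])

lemma carrier_bij_subgroup [simp]: "carrier (bij_subgroup S G) = G"
  by (simp add: bij_subgroup_def)

lemma one_bij_subgroup [simp]: "\<one>\<^bsub>bij_subgroup S G\<^esub> = (\<lambda>x\<in>S. x)"
  by (simp add: bij_subgroup_def BijGroup_def)

lemma mult_bij_subgroup:
  assumes "G \<subseteq> Bij S" "g \<in> G" "h \<in> G"
  shows "g \<otimes>\<^bsub>bij_subgroup S G\<^esub> h = compose S g h"
  using assms by (auto simp: bij_subgroup_def BijGroup_def)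

text \<open>
  An element is determined by its value at a single point, since the quotient of two elements with
  the same value has a fixed point.
\<close>

lemma free_action_eq:
  assumes G: "subgroup G (BijGroup S)" "free_action S G"
    and gh: "g \<in> G" "h \<in> G" and y: "y \<in> S" "g y = h y"
  shows "g = h"
proof -
  have B: "g \<in> Bij S" "h \<in> Bij S"
    using G(1) gh by (auto simp: subgroup_BijGroup_iff)
  have "\<exists>k\<in>G. \<forall>x\<in>S. k (h x) = x \<and> h (k x) = x"
    using G(1) gh(2) unfolding subgroup_BijGroup_iff by blast
  then obtain k where k: "k \<in> G" "\<And>x. x \<in> S \<Longrightarrow> k (h x) = x" "\<And>x. x \<in> S \<Longrightarrow> h (k x) = x"
    by blast
  have "compose S k g \<in> G" using G(1) k(1) gh(1) by (simp add: subgroup_BijGroup_iff)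
  moreover have "compose S k g y = y" using k(2) y by (simp add: compose_eq)
  ultimately have "compose S k g = (\<lambda>y\<in>S. y)"
    using G(2) y(1) unfolding free_action_def by blast
  then have "g z = h z" if z: "z \<in> S" for z
    using compose_eq_idD[OF _ z] k(3) Bij_imp_funcset[OF B(1)] z by (metis funcset_mem)
  then show ?thesis using B by (meson Bij_imp_extensional extensionalityI)
qed

section \<open>Regular covers with finite deck group\<close>

text \<open>
  Evenly covered neighbourhoods do not appear among the hypotheses: for a finite group that acts
  freely they exist automatically.
\<close>

locale finite_regular_cover =
  fixes X :: "'a topology" and Y :: "'b topology" and G :: "('b \<Rightarrow> 'b) set" and f :: "'b \<Rightarrow> 'a"
  assumes Hausdorff_base: "Hausdorff_space X"
    and compact: "compact_space Y" and Hausdorff: "Hausdorff_space Y"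
    and connected: "connected_space Y" and nonempty: "topspace Y \<noteq> {}"
    and homeo: "homeo_group Y G" and finite_group: "finite G"
    and free: "free_action (topspace Y) G" and orbits: "fibres_are_orbits (topspace Y) G f"
    and cont: "continuous_map Y X f" and surj: "f ` topspace Y = topspace X"
begin

lemma subgroup: "subgroup G (BijGroup (topspace Y))"
  using homeo by (simp add: homeo_group_def)

lemma sub_Bij: "G \<subseteq> Bij (topspace Y)"
  using subgroup by (simp add: subgroup_BijGroup_iff)

lemma extensional: "g \<in> G \<Longrightarrow> g \<in> extensional (topspace Y)"
  using sub_Bij by (auto simp: Bij_def)

lemma id_mem: "(\<lambda>y\<in>topspace Y. y) \<in> G"
  using subgroup by (simp add: subgroup_BijGroup_iff)

lemma compose_mem: "g \<in> G \<Longrightarrow> h \<in> G \<Longrightarrow> compose (topspace Y) g h \<in> G"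
  using subgroup by (simp add: subgroup_BijGroup_iff)

lemma inverse_mem:
  assumes "g \<in> G"
  obtains h where "h \<in> G" "\<And>y. y \<in> topspace Y \<Longrightarrow> h (g y) = y" "\<And>y. y \<in> topspace Y \<Longrightarrow> g (h y) = y"
proof -
  have "\<exists>h\<in>G. \<forall>y\<in>topspace Y. h (g y) = y \<and> g (h y) = y"
    using subgroup assms unfolding subgroup_BijGroup_iff by blast
  then show thesis
    using that by blast
qed

lemma homeomorphic_act: "g \<in> G \<Longrightarrow> homeomorphic_map Y Y g"
  using homeo by (simp add: homeo_group_def)

lemma continuous_act: "g \<in> G \<Longrightarrow> continuous_map Y Y g"
  using homeomorphic_act homeomorphic_imp_continuous_map by blast

lemma act_closed: "g \<in> G \<Longrightarrow> y \<in> topspace Y \<Longrightarrow> g y \<in> topspace Y"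
  using continuous_act continuous_map_image_subset_topspace by fastforce

lemma cover_closed: "y \<in> topspace Y \<Longrightarrow> f y \<in> topspace X"
  using surj by blast

lemma cover_act: "g \<in> G \<Longrightarrow> y \<in> topspace Y \<Longrightarrow> f (g y) = f y"
  using orbits act_closed unfolding fibres_are_orbits_def by metis

lemma same_fibre:
  assumes "y \<in> topspace Y" "z \<in> topspace Y" "f y = f z"
  obtains g where "g \<in> G" "z = g y"
  using orbits assms unfolding fibres_are_orbits_def by blast

lemma act_eq: "g \<in> G \<Longrightarrow> h \<in> G \<Longrightarrow> y \<in> topspace Y \<Longrightarrow> g y = h y \<Longrightarrow> g = h"
  using free_action_eq[OF subgroup free] .

lemma fixed_point: "g \<in> G \<Longrightarrow> y \<in> topspace Y \<Longrightarrow> g y = y \<Longrightarrow> g = (\<lambda>y\<in>topspace Y. y)"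
  using act_eq[OF _ id_mem] by simp

lemma quotient: "quotient_map Y X f"
  using continuous_imp_quotient_map cont compact Hausdorff_base surj by blast

lemma preimage_image:
  assumes "U \<subseteq> topspace Y"
  shows "{y \<in> topspace Y. f y \<in> f ` U} = (\<Union>g\<in>G. g ` U)"
proof -
  have "y \<in> (\<Union>g\<in>G. g ` U)" if y: "y \<in> topspace Y" "u \<in> U" "f y = f u" for y u
    using same_fibre[of u y] y assms by (metis UN_iff imageI subsetD)
  then show ?thesis
    using assms act_closed cover_act by (fastforce simp: subset_iff)
qed

text \<open>
  The saturation of an open set is the union of its translates.
\<close>

lemma open_map: "open_map Y X f"
  unfolding open_map_def
proof (intro allI impI)
  fix U assume U: "openin Y U"
  have "openin Y (\<Union>g\<in>G. g ` U)"
    using U homeomorphic_act homeomorphic_imp_open_map unfolding open_map_def by (intro openin_Union) blast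
  then have "openin Y {y \<in> topspace Y. f y \<in> f ` U}"
    using preimage_image openin_subset[OF U] by simp
  then show "openin X (f ` U)"
    using quotient openin_subset[OF U] surj unfolding quotient_map_def by (metis (no_types) image_mono)
qed

text \<open>
  The finitely many sets on which two lifts differ by a given \<open>g\<close> are closed and pairwise disjoint
  and cover the space, so connectedness leaves only one of them.
\<close>

lemma unique_lift:
  assumes C: "connected_space C" and h: "continuous_map C Y h" and k: "continuous_map C Y k"
    and eq: "\<And>c. c \<in> topspace C \<Longrightarrow> f (h c) = f (k c)"
  shows "\<exists>g\<in>G. \<forall>c\<in>topspace C. k c = g (h c)"
proof (cases "topspace C = {}")
  case True
  then show ?thesis using id_mem by auto
next
  case False
  then obtain c where c: "c \<in> topspace C" by blast
  have hk: "h x \<in> topspace Y" "k x \<in> topspace Y" if "x \<in> topspace C" for x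
    using continuous_map_image_subset_topspace[OF h] continuous_map_image_subset_topspace[OF k] that by auto
  obtain g where g: "g \<in> G" "k c = g (h c)"
    using same_fibre[of "h c" "k c"] hk[OF c] eq[OF c] by blast
  define A where "A = (\<lambda>g. {c \<in> topspace C. k c = g (h c)})"
  have closed: "closedin C (A g)" if "g \<in> G" for g
    unfolding A_def
    using closedin_continuous_maps_eq[OF Hausdorff k continuous_map_compose[OF h continuous_act[OF that]]]
    by (simp add: o_def)
  have "x \<in> (\<Union>g'\<in>G - {g}. A g')" if x: "x \<in> topspace C - A g" for x
  proof -
    obtain g' where "g' \<in> G" "k x = g' (h x)"
      using same_fibre[of "h x" "k x"] hk eq x by blast
    then show ?thesis
      using x unfolding A_def by blast
  qed
  moreover have "A g' \<inter> A g = {}" if "g' \<in> G - {g}" for g'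
    using that g act_eq hk unfolding A_def by force
  ultimately have "topspace C - A g = (\<Union>g'\<in>G - {g}. A g')"
    unfolding A_def by blast
  moreover have "closedin C (\<Union>g'\<in>G - {g}. A g')"
    using closed finite_group by (intro closedin_Union) auto
  ultimately have "openin C (A g)"
    using closed[OF g(1)] by (metis closedin_subset openin_closedin)
  then have "A g = topspace C"
    using C closed[OF g(1)] c g(2) unfolding connected_space_clopen_in A_def by blast
  then show ?thesis
    using g unfolding A_def by blast
qed

lemma lift_eq:
  assumes C: "connected_space C" and h: "continuous_map C Y h" and k: "continuous_map C Y k"
    and eq: "\<And>c. c \<in> topspace C \<Longrightarrow> f (h c) = f (k c)" and c: "c \<in> topspace C" "h c = k c"
    and d: "d \<in> topspace C"
  shows "h d = k d"
proof -
  obtain g where g: "g \<in> G" "\<And>c. c \<in> topspace C \<Longrightarrow> k c = g (h c)"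
    using unique_lift[OF C h k eq] by blast
  have hY: "h c \<in> topspace Y" "h d \<in> topspace Y"
    using h c d continuous_map_image_subset_topspace by fastforce+
  then have "g = (\<lambda>y\<in>topspace Y. y)"
    using fixed_point g c by metis
  then show ?thesis using g(2)[OF d] hY by simp
qed

text \<open>
  Distinct points of a fibre are related by one of finitely many nontrivial deck transformations,
  whose graphs are closed and miss the diagonal.
\<close>

lemma openin_off_fibres:
  "openin (prod_topology Y Y) {(u, v) \<in> topspace Y \<times> topspace Y. f u = f v \<longrightarrow> u = v}"
proof -
  let ?YY = "prod_topology Y Y" and ?e = "\<lambda>y\<in>topspace Y. y"
  let ?A = "\<lambda>g. {w \<in> topspace ?YY. g (fst w) = snd w}"
  have "closedin ?YY (?A g)" if "g \<in> G" for g
    using Hausdorff continuous_map_compose[OF continuous_map_fst continuous_act[OF that]]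
    by (intro closedin_continuous_maps_eq) (auto simp: o_def continuous_map_snd)
  then have cl: "closedin ?YY (\<Union>g\<in>G - {?e}. ?A g)"
    using finite_group by (intro closedin_Union) auto
  have "{(u, v) \<in> topspace Y \<times> topspace Y. f u = f v \<longrightarrow> u = v} = topspace ?YY - (\<Union>g\<in>G - {?e}. ?A g)"
  proof -
    have "(f u = f v \<longrightarrow> u = v) \<longleftrightarrow> \<not> (\<exists>g\<in>G - {?e}. g u = v)" if "u \<in> topspace Y" "v \<in> topspace Y" for u v
    proof
      assume uv: "f u = f v \<longrightarrow> u = v"
      show "\<not> (\<exists>g\<in>G - {?e}. g u = v)"
        using uv cover_act[of _ u] fixed_point[of _ u] that by force
    next
      assume g: "\<not> (\<exists>g\<in>G - {?e}. g u = v)"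
      show "f u = f v \<longrightarrow> u = v"
      proof
        assume "f u = f v"
        then obtain g where "g \<in> G" "v = g u" using same_fibre[OF \<open>u \<in> topspace Y\<close> \<open>v \<in> topspace Y\<close>] by blast
        then show "u = v" using g that by (cases "g = ?e") auto
      qed
    qed
    then have "(u, v) \<in> {(u, v) \<in> topspace Y \<times> topspace Y. f u = f v \<longrightarrow> u = v} \<longleftrightarrow>
        (u, v) \<in> topspace ?YY - (\<Union>g\<in>G - {?e}. ?A g)" for u v
      by (cases "u \<in> topspace Y \<and> v \<in> topspace Y") (simp_all, blast)
    then show ?thesis by (auto simp only: set_eq_iff split_paired_All)
  qed
  then show ?thesis by (simp only: openin_diff[OF openin_topspace cl])
qed

text \<open>
  By the previous lemma every point has a neighbourhood on which \<open>f\<close> is injective. The image of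
  this neighbourhood is evenly covered by the translates.
\<close>

lemma regular_covering: "regular_covering_map Y G X f"
proof -
  have "\<exists>T. openin X T \<and> x \<in> T \<and>
        (\<exists>\<V>. \<Union>\<V> = {y \<in> topspace Y. f y \<in> T} \<and>
             (\<forall>V\<in>\<V>. openin Y V) \<and> pairwise disjnt \<V> \<and>
             (\<forall>V\<in>\<V>. homeomorphic_map (subtopology Y V) (subtopology X T) f))"
    if x: "x \<in> topspace X" for x
  proof -
    obtain y where y: "y \<in> topspace Y" "x = f y"
      using x surj by (metis imageE)
    then have "(y, y) \<in> {(u, v) \<in> topspace Y \<times> topspace Y. f u = f v \<longrightarrow> u = v}" by simp
    then obtain A B where AB: "openin Y A" "openin Y B" "y \<in> A" "y \<in> B"
      "A \<times> B \<subseteq> {(u, v) \<in> topspace Y \<times> topspace Y. f u = f v \<longrightarrow> u = v}"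
      using openin_off_fibres unfolding openin_prod_topology_alt by meson
    define U where "U = A \<inter> B"
    have U: "openin Y U" "y \<in> U" using AB by (auto simp: U_def)
    have UY: "U \<subseteq> topspace Y" using U(1) openin_subset by blast
    have inj: "u = v" if "u \<in> U" "v \<in> U" "f u = f v" for u v
      using AB(5) that unfolding U_def by blast
    define \<V> where "\<V> = (\<lambda>g. g ` U) ` G"
    have V_open: "openin Y V" if "V \<in> \<V>" for V
      using that U(1) homeomorphic_act homeomorphic_imp_open_map unfolding \<V>_def open_map_def by blast
    have T_open: "openin X (f ` U)"
      using open_map U(1) by (simp add: open_map_def)
    have "homeomorphic_map (subtopology Y V) (subtopology X (f ` U)) f" if V: "V \<in> \<V>" for V
    proof -
      obtain g where g: "g \<in> G" "V = g ` U" using V by (auto simp: \<V>_def)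
      have VY: "V \<subseteq> topspace Y" using V_open[OF V] openin_subset by blast
      have fg: "f (g u) = f u" if "u \<in> U" for u
        using g(1) cover_act UY that by blast
      have fV: "f ` V = f ` U"
        unfolding g(2) image_image using fg by (intro image_cong) auto
      have "inj_on f V"
        unfolding g(2) using fg inj by (auto simp: inj_on_def)
      moreover have "open_map (subtopology Y V) (subtopology X (f ` V)) f"
        using open_map V_open[OF V] T_open
        by (auto simp: open_map_def fV openin_open_subtopology) (metis fV image_eqI subsetD)
      moreover have "continuous_map (subtopology Y V) (subtopology X (f ` V)) f"
        using cont by (simp add: continuous_map_in_subtopology continuous_map_from_subtopology VY image_mono inf.absorb2)
      moreover have "f ` V \<subseteq> topspace X" using VY surj by blast
      ultimately show ?thesis
        using fV VY by (intro bijective_open_imp_homeomorphic_map)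
          (auto simp: topspace_subtopology_subset inf.absorb2)
    qed
    moreover have "g = h" if gh: "g \<in> G" "h \<in> G" and uv: "u \<in> U" "v \<in> U" "g u = h v" for g h u v
    proof -
      have "u = v" using inj[OF uv(1,2)] cover_act gh uv UY by (metis subsetD)
      then show ?thesis using act_eq[OF gh, of u] uv UY by blast
    qed
    then have "pairwise disjnt \<V>"
      unfolding pairwise_def disjnt_def \<V>_def by blast
    moreover have "\<Union>\<V> = {y \<in> topspace Y. f y \<in> f ` U}"
      using preimage_image[OF UY] unfolding \<V>_def by simp
    ultimately show ?thesis
      using T_open V_open U(2) y by blast
  qed
  then show ?thesis
    unfolding regular_covering_map_def covering_map_def
    by (intro conjI ballI cont surj homeo free quotient orbits)
qed

end

text \<open>
  A fibre is closed in a compact space and discrete, hence finite, and the group acts freely on it.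
\<close>

lemma continuum_cover_imp_finite_regular_cover:
  assumes X: "continuum X" and cov: "continuum_cover X Y G f"
  shows "finite_regular_cover X Y G f"
proof -
  have Y: "compact_space Y" "Hausdorff_space Y" "connected_space Y" "topspace Y \<noteq> {}"
    using cov by (auto simp: continuum_cover_def continuum_def metrizable_imp_Hausdorff_space)
  have HX: "Hausdorff_space X"
    using X by (simp add: continuum_def metrizable_imp_Hausdorff_space)
  have c: "covering_map Y X f" and hg: "homeo_group Y G" and fr: "free_action (topspace Y) G"
    and orb: "fibres_are_orbits (topspace Y) G f"
    using cov by (auto simp: continuum_cover_def regular_covering_map_def)
  have cont: "continuous_map Y X f" and surj: "f ` topspace Y = topspace X"
    using c by (auto simp: covering_map_def)
  obtain y where y: "y \<in> topspace Y" using Y by blast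
  \<comment> \<open>The fibre of \<open>y\<close> is compact, and the sheets over a neighbourhood of \<open>f y\<close> show that it is
    discrete.\<close>
  define F where "F = {z \<in> topspace Y. f z = f y}"
  have fy: "f y \<in> topspace X" using y surj by blast
  obtain T \<V> where T: "openin X T" "f y \<in> T" "\<Union>\<V> = {y \<in> topspace Y. f y \<in> T}"
    "\<forall>V\<in>\<V>. openin Y V" "\<forall>V\<in>\<V>. homeomorphic_map (subtopology Y V) (subtopology X T) f"
    using c fy unfolding covering_map_def by meson
  have "closedin Y F"
    using closedin_continuous_map_preimage[OF cont, of "{f y}"] HX fy
    by (simp add: F_def closedin_Hausdorff_singleton)
  then have "compactin Y F" using Y closedin_compact_space by blast
  moreover have "F \<subseteq> \<Union>\<V>" using T by (auto simp: F_def)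
  ultimately obtain \<F> where \<F>: "finite \<F>" "\<F> \<subseteq> \<V>" "F \<subseteq> \<Union>\<F>"
    using T(4) unfolding compactin_def by meson
  have "inj_on f V" if "V \<in> \<V>" for V
  proof -
    have "topspace Y \<inter> V = V" using that T by blast
    then show ?thesis
      using T(5) that by (metis homeomorphic_map_def topspace_subtopology)
  qed
  then have "finite (F \<inter> V)" if "V \<in> \<V>" for V
  proof -
    have "inj_on f (F \<inter> V)" using \<open>\<And>V. V \<in> \<V> \<Longrightarrow> inj_on f V\<close> that by (meson inf_le2 inj_on_subset)
    moreover have "f ` (F \<inter> V) \<subseteq> {f y}" by (auto simp: F_def)
    ultimately show ?thesis by (meson finite.emptyI finite.insertI finite_subset finite_imageD)
  qed
  then have "finite (\<Union>V\<in>\<F>. F \<inter> V)" using \<F> by blast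
  then have finF: "finite F" using \<F> by (metis Int_Union inf.absorb1)
  have sub: "subgroup G (BijGroup (topspace Y))" using hg by (simp add: homeo_group_def)
  have "inj_on (\<lambda>g. g y) G"
    using free_action_eq[OF sub fr _ _ y] by (auto intro: inj_onI)
  moreover have "(\<lambda>g. g y) ` G \<subseteq> F"
  proof clarify
    fix g assume g: "g \<in> G"
    then have "g y \<in> topspace Y"
      using sub y Bij_imp_funcset unfolding subgroup_BijGroup_iff by blast
    moreover from this have "f y = f (g y)"
      using orb y g unfolding fibres_are_orbits_def by blast
    ultimately show "g y \<in> F" by (simp add: F_def)
  qed
  ultimately have "finite G" using finF by (meson finite_imageD finite_subset)
  then show ?thesis
    using Y HX hg fr orb cont surj by unfold_locales
qed

section \<open>Deck groups\<close>

definition deck_group :: "'b topology \<Rightarrow> ('b \<Rightarrow> 'a) \<Rightarrow> ('b \<Rightarrow> 'b) set" where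
  "deck_group Y f =
     {g \<in> Bij (topspace Y). homeomorphic_map Y Y g \<and> (\<forall>y\<in>topspace Y. f (g y) = f y)}"

lemma homeomorphic_map_imp_Bij:
  "homeomorphic_map Y Y g \<Longrightarrow> g \<in> extensional (topspace Y) \<Longrightarrow> g \<in> Bij (topspace Y)"
  by (simp add: Bij_def bij_betw_def homeomorphic_imp_injective_map homeomorphic_imp_surjective_map)

lemma homeo_group_deck_group: "homeo_group Y (deck_group Y f)"
proof -
  have id: "(\<lambda>y\<in>topspace Y. y) \<in> deck_group Y f"
  proof -
    have "homeomorphic_map Y Y (\<lambda>y\<in>topspace Y. y)"
      by (rule homeomorphic_map_eq[of Y Y id]) auto
    then show ?thesis
      by (simp add: deck_group_def id_Bij)
  qed
  have comp: "compose (topspace Y) g h \<in> deck_group Y f"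
    if g: "g \<in> deck_group Y f" and h: "h \<in> deck_group Y f" for g h
  proof -
    have "homeomorphic_map Y Y (g \<circ> h)"
      using g h homeomorphic_map_compose unfolding deck_group_def by blast
    then have "homeomorphic_map Y Y (compose (topspace Y) g h)"
      by (rule homeomorphic_map_eq) (simp add: compose_def)
    moreover have "h y \<in> topspace Y" if "y \<in> topspace Y" for y
      using h that Bij_imp_funcset unfolding deck_group_def by blast
    ultimately show ?thesis
      using g h by (simp add: deck_group_def compose_Bij compose_eq)
  qed
  have inv: "\<exists>h\<in>deck_group Y f. \<forall>x\<in>topspace Y. h (g x) = x \<and> g (h x) = x"
    if g: "g \<in> deck_group Y f" for g
  proof -
    let ?S = "topspace Y"
    have gB: "g \<in> Bij ?S" and gh: "homeomorphic_map Y Y g" and gf: "\<And>y. y \<in> ?S \<Longrightarrow> f (g y) = f y"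
      using g by (auto simp: deck_group_def)
    obtain k where k: "homeomorphic_maps Y Y g k"
      using gh homeomorphic_map_maps by blast
    have kS: "k y \<in> ?S" if "y \<in> ?S" for y
      using k that continuous_map_image_subset_topspace unfolding homeomorphic_maps_def by blast
    have gk: "g (k y) = y" "k (g y) = y" if "y \<in> ?S" for y
      using k that unfolding homeomorphic_maps_def by blast+
    let ?h = "restrict k ?S"
    have "homeomorphic_map Y Y k"
      using k homeomorphic_maps_map by blast
    then have hk: "homeomorphic_map Y Y ?h"
      by (rule homeomorphic_map_eq) simp
    then have "?h \<in> Bij ?S"
      by (intro homeomorphic_map_imp_Bij) auto
    moreover have "f (?h y) = f y" if "y \<in> ?S" for y
      using gf[OF kS[OF that]] gk(1)[OF that] that by simp
    ultimately have "?h \<in> deck_group Y f"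
      using hk by (simp add: deck_group_def)
    moreover have "g x \<in> ?S" if "x \<in> ?S" for x
      using gB that Bij_imp_funcset by blast
    ultimately show ?thesis
      using gk by (intro bexI[of _ ?h]) auto
  qed
  show ?thesis
    unfolding homeo_group_def subgroup_BijGroup_iff using id comp inv by (auto simp: deck_group_def)
qed

lemma deck_group_lift:
  assumes "g \<in> deck_group Y f"
  shows "continuous_map Y Y g" "y \<in> topspace Y \<Longrightarrow> f (g y) = f y"
    "y \<in> topspace Y \<Longrightarrow> g y \<in> topspace Y" "g \<in> extensional (topspace Y)"
  using assms Bij_imp_funcset
  by (auto simp: deck_group_def homeomorphic_imp_continuous_map Bij_def)

text \<open>
  A deck transformation and the identity are two lifts of the same map, so they differ by an element
  of the group.
\<close>

lemma (in finite_regular_cover) deck_group: "deck_group Y f = G"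
proof
  show "G \<subseteq> deck_group Y f"
    using sub_Bij homeomorphic_act cover_act by (auto simp: deck_group_def)
  show "deck_group Y f \<subseteq> G"
  proof
    fix g assume g: "g \<in> deck_group Y f"
    obtain g' where g': "g' \<in> G" "\<forall>y\<in>topspace Y. g y = g' y"
      using unique_lift[OF connected continuous_map_id deck_group_lift(1)[OF g]] deck_group_lift(2)[OF g]
      by (auto simp: id_def)
    then have "g = g'"
      using extensional[OF g'(1)] deck_group_lift(4)[OF g] by (meson extensionalityI)
    then show "g \<in> G" using g' by simp
  qed
qed

text \<open>
  Covers are constructed by means of this criterion: the group need not be guessed, only freeness and
  transitivity of the deck group have to be checked.
\<close>

lemma finite_regular_cover_deck_group:
  assumes X: "Hausdorff_space X"
    and Y: "compact_space Y" "Hausdorff_space Y" "connected_space Y" "topspace Y \<noteq> {}"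
    and f: "continuous_map Y X f" "f ` topspace Y = topspace X"
    and fin: "\<And>y. y \<in> topspace Y \<Longrightarrow> finite {z \<in> topspace Y. f z = f y}"
    and free: "\<And>g y. g \<in> deck_group Y f \<Longrightarrow> y \<in> topspace Y \<Longrightarrow> g y = y \<Longrightarrow> (\<forall>z\<in>topspace Y. g z = z)"
    and trans: "\<And>y z. y \<in> topspace Y \<Longrightarrow> z \<in> topspace Y \<Longrightarrow> f y = f z \<Longrightarrow> \<exists>g\<in>deck_group Y f. g y = z"
  shows "finite_regular_cover X Y (deck_group Y f) f"
proof -
  let ?S = "topspace Y" and ?D = "deck_group Y f"
  have D: "subgroup ?D (BijGroup ?S)"
    using homeo_group_deck_group[of Y f] by (simp add: homeo_group_def)
  obtain y where y: "y \<in> ?S" using Y by blast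
  have free: "free_action ?S ?D"
    unfolding free_action_def
  proof (intro ballI impI)
    fix g z assume "g \<in> ?D" "z \<in> ?S" "g z = z"
    then show "g = (\<lambda>x\<in>?S. x)"
      using free[of g z] deck_group_lift(4)[of g Y f] by (auto simp: extensional_def)
  qed
  have "inj_on (\<lambda>g. g y) ?D"
    using free_action_eq[OF D free _ _ y] by (auto intro: inj_onI)
  moreover have "(\<lambda>g. g y) ` ?D \<subseteq> {z \<in> ?S. f z = f y}"
    using deck_group_lift(2,3)[OF _ y, of _ f] by auto
  ultimately have fin: "finite ?D"
    using fin[OF y] by (meson finite_imageD finite_subset)
  have "fibres_are_orbits ?S ?D f"
    using trans deck_group_lift(2) unfolding fibres_are_orbits_def by metis
  then show ?thesis
    using X Y f fin free homeo_group_deck_group by unfold_locales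
qed

lemma (in finite_regular_cover) finite_fibre:
  assumes "y \<in> topspace Y"
  shows "finite {z \<in> topspace Y. f z = f y}"
proof -
  have "z \<in> (\<lambda>g. g y) ` G" if "z \<in> topspace Y" "f z = f y" for z
    using same_fibre[OF assms that(1)] that(2) by (metis imageI)
  then have "{z \<in> topspace Y. f z = f y} \<subseteq> (\<lambda>g. g y) ` G"
    by blast
  then show ?thesis
    using finite_group by (meson finite_imageI finite_subset)
qed

lemma deck_group_cong:
  assumes "\<And>y. y \<in> topspace Y \<Longrightarrow> f y = k y"
  shows "deck_group Y f = deck_group Y k"
  unfolding deck_group_def using assms Bij_imp_funcset[of _ "topspace Y"]
  by (intro Collect_cong) (auto simp: Pi_iff)

lemma conjugate_deck_transformation:
  assumes h: "homeomorphic_maps Y Z h j" and g: "g \<in> deck_group Y f"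
  shows "(\<lambda>z\<in>topspace Z. h (g (j z))) \<in> deck_group Z (f \<circ> j)"
proof -
  have hh: "homeomorphic_map Y Z h" "homeomorphic_map Z Y j"
    using h homeomorphic_maps_map by blast+
  have jY: "j z \<in> topspace Y" if "z \<in> topspace Z" for z
    using homeomorphic_imp_surjective_map[OF hh(2)] that by blast
  have "homeomorphic_map Y Y g" using g by (simp add: deck_group_def)
  then have "homeomorphic_map Z Z (h \<circ> (g \<circ> j))"
    using hh by (meson homeomorphic_map_compose)
  then have hom: "homeomorphic_map Z Z (\<lambda>z\<in>topspace Z. h (g (j z)))"
    by (rule homeomorphic_map_eq) simp
  then have "(\<lambda>z\<in>topspace Z. h (g (j z))) \<in> Bij (topspace Z)"
    by (intro homeomorphic_map_imp_Bij) auto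
  moreover have "f (j (h (g (j z)))) = f (j z)" if "z \<in> topspace Z" for z
    using h deck_group_lift(2,3)[OF g jY[OF that]] by (simp add: homeomorphic_maps_def)
  ultimately show ?thesis
    using hom by (simp add: deck_group_def)
qed

lemma (in finite_regular_cover) homeomorphic_copy:
  assumes k: "homeomorphic_map Z Y k"
  shows "finite_regular_cover X Z (deck_group Z (f \<circ> k)) (f \<circ> k)"
proof (rule finite_regular_cover_deck_group[OF Hausdorff_base])
  have hs: "Z homeomorphic_space Y"
    using k homeomorphic_map_imp_homeomorphic_space by blast
  show "compact_space Z" "Hausdorff_space Z" "connected_space Z"
    using compact Hausdorff connected
      homeomorphic_compact_space[OF hs] homeomorphic_Hausdorff_space[OF hs] homeomorphic_connected_space[OF hs]
    by auto
  have kim: "k ` topspace Z = topspace Y" and inj: "inj_on k (topspace Z)"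
    using k homeomorphic_imp_surjective_map homeomorphic_imp_injective_map by blast+
  have kc: "continuous_map Z Y k"
    using k homeomorphic_imp_continuous_map by blast
  show "topspace Z \<noteq> {}" using kim nonempty by (metis image_empty)
  show "continuous_map Z X (f \<circ> k)" using kc cont continuous_map_compose by blast
  show "(f \<circ> k) ` topspace Z = topspace X" using kim surj by (metis image_comp)
  have kY: "k z \<in> topspace Y" if "z \<in> topspace Z" for z using kim that by blast
  show "finite {z \<in> topspace Z. (f \<circ> k) z = (f \<circ> k) y}" if y: "y \<in> topspace Z" for y
  proof -
    have "k ` {z \<in> topspace Z. (f \<circ> k) z = (f \<circ> k) y} \<subseteq> {z \<in> topspace Y. f z = f (k y)}"
      using kY by auto
    moreover have "inj_on k {z \<in> topspace Z. (f \<circ> k) z = (f \<circ> k) y}"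
      using inj by (rule inj_on_subset) auto
    ultimately show ?thesis
      using finite_fibre[OF kY[OF y]] by (meson finite_imageD finite_subset)
  qed
  show "\<forall>z\<in>topspace Z. g z = z"
    if g: "g \<in> deck_group Z (f \<circ> k)" and y: "y \<in> topspace Z" "g y = y" for g y
  proof -
    have "k (g z) = k z" if "z \<in> topspace Z" for z
      using lift_eq[of Z "k \<circ> g" k y z] \<open>connected_space Z\<close> continuous_map_compose[OF deck_group_lift(1)[OF g] kc]
        kc deck_group_lift(2)[OF g] y that by simp
    then show ?thesis
      using inj deck_group_lift(3)[OF g] by (auto simp: inj_on_def)
  qed
  obtain j where j: "homeomorphic_maps Z Y k j"
    using k homeomorphic_map_maps by blast
  have jk: "\<And>z. z \<in> topspace Z \<Longrightarrow> j (k z) = z"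
    using j by (auto simp: homeomorphic_maps_def)
  show "\<exists>g\<in>deck_group Z (f \<circ> k). g y = z"
    if y: "y \<in> topspace Z" and z: "z \<in> topspace Z" and eq: "(f \<circ> k) y = (f \<circ> k) z" for y z
  proof -
    obtain g where g: "g \<in> G" "k z = g (k y)"
      using same_fibre[OF kY[OF y] kY[OF z]] eq by auto
    let ?h = "\<lambda>z\<in>topspace Z. j (g (k z))"
    have "?h \<in> deck_group Z (f \<circ> k)"
      using conjugate_deck_transformation[OF homeomorphic_maps_sym[THEN iffD1, OF j], of g f] g(1) deck_group by simp
    moreover have "?h y = z"
      using y z jk by (simp flip: g(2))
    ultimately show ?thesis by blast
  qed
qed

text \<open>
  This moves a cover to any type that is large enough.
\<close>

lemma homeomorphic_copy_along_injection:
  assumes "inj_on j (topspace Y)"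
  obtains Z where "homeomorphic_map Y Z j"
proof -
  define op where "op = (\<lambda>U. U \<subseteq> j ` topspace Y \<and> openin Y {y \<in> topspace Y. j y \<in> U})"
  have "istopology op"
    unfolding istopology_def
  proof (intro conjI allI impI)
    fix U V assume "op U" "op V"
    moreover have "{y \<in> topspace Y. j y \<in> U \<inter> V} = {y \<in> topspace Y. j y \<in> U} \<inter> {y \<in> topspace Y. j y \<in> V}"
      by blast
    ultimately show "op (U \<inter> V)"
      unfolding op_def by (simp add: openin_Int le_infI1)
  next
    fix \<K> assume \<K>: "\<forall>K\<in>\<K>. op K"
    have "{y \<in> topspace Y. j y \<in> \<Union>\<K>} = (\<Union>K\<in>\<K>. {y \<in> topspace Y. j y \<in> K})"
      by blast
    moreover have "openin Y (\<Union>K\<in>\<K>. {y \<in> topspace Y. j y \<in> K})"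
      using \<K> unfolding op_def by (intro openin_Union) blast
    ultimately show "op (\<Union>\<K>)"
      using \<K> unfolding op_def by auto
  qed
  then have op: "openin (topology op) U \<longleftrightarrow> op U" for U
    by (simp add: topology_inverse')
  have "op (j ` topspace Y)"
  proof -
    have "{y \<in> topspace Y. j y \<in> j ` topspace Y} = topspace Y" by blast
    then show ?thesis by (simp add: op_def)
  qed
  then have "topspace (topology op) = j ` topspace Y"
    unfolding topspace_def[of "topology op"] op unfolding op_def by blast
  then have "homeomorphic_map Y (topology op) j"
    using assms by (auto simp: homeomorphic_map_def quotient_map_def op) (auto simp: op_def)
  then show ?thesis by (rule that)
qed

text \<open>
  Conjugation by a homeomorphism over the base carries one deck group to the other, so the
  isomorphism of groups comes for free.
\<close>

lemma equivalent_covers_homeomorphic: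
  assumes Y: "finite_regular_cover X Y G f" and Z: "finite_regular_cover X Z H k"
    and h: "homeomorphic_map Y Z h" and eq: "\<And>y. y \<in> topspace Y \<Longrightarrow> k (h y) = f y"
  shows "equivalent_covers Y G f Z H k"
proof -
  interpret Y: finite_regular_cover X Y G f by fact
  interpret Z: finite_regular_cover X Z H k by fact
  obtain j where j: "homeomorphic_maps Y Z h j"
    using h homeomorphic_map_maps by blast
  have hj: "\<And>y. y \<in> topspace Y \<Longrightarrow> j (h y) = y" "\<And>z. z \<in> topspace Z \<Longrightarrow> h (j z) = z"
    and hZ: "\<And>y. y \<in> topspace Y \<Longrightarrow> h y \<in> topspace Z" and jY: "\<And>z. z \<in> topspace Z \<Longrightarrow> j z \<in> topspace Y"
    using j continuous_map_image_subset_topspace unfolding homeomorphic_maps_def by blast+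
  define \<theta> where "\<theta> = (\<lambda>g. \<lambda>z\<in>topspace Z. h (g (j z)))"
  define \<eta> where "\<eta> = (\<lambda>g. \<lambda>y\<in>topspace Y. j (g (h y)))"
  have "deck_group Z (f \<circ> j) = H"
    unfolding Z.deck_group[symmetric] using hj(2) jY eq by (intro deck_group_cong) (metis comp_apply)
  then have \<theta>H: "\<theta> g \<in> H" if "g \<in> G" for g
    unfolding \<theta>_def using conjugate_deck_transformation[OF j, of g f] that Y.deck_group by simp
  have "deck_group Y (k \<circ> h) = G"
    unfolding Y.deck_group[symmetric] using eq by (intro deck_group_cong) simp
  then have \<eta>G: "\<eta> g \<in> G" if "g \<in> H" for g
    unfolding \<eta>_def
    using conjugate_deck_transformation[OF homeomorphic_maps_sym[THEN iffD1, OF j], of g k] that Z.deck_group by simp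
  have \<theta>\<eta>: "\<theta> (\<eta> g) = g" if "g \<in> H" for g
  proof (rule extensionalityI[of _ "topspace Z"])
    show "\<theta> (\<eta> g) z = g z" if "z \<in> topspace Z" for z
      using that \<open>g \<in> H\<close> jY hj Z.act_closed by (simp add: \<theta>_def \<eta>_def)
  qed (use that Z.extensional in \<open>auto simp: \<theta>_def\<close>)
  have \<eta>\<theta>: "\<eta> (\<theta> g) = g" if "g \<in> G" for g
  proof (rule extensionalityI[of _ "topspace Y"])
    show "\<eta> (\<theta> g) z = g z" if "z \<in> topspace Y" for z
      using that \<open>g \<in> G\<close> hZ hj Y.act_closed by (simp add: \<theta>_def \<eta>_def)
  qed (use that Y.extensional in \<open>auto simp: \<eta>_def\<close>)
  have "bij_betw \<theta> G H"
    using \<theta>H \<eta>G \<theta>\<eta> \<eta>\<theta> by (intro bij_betw_byWitness[where f' = \<eta>]) auto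
  moreover have "\<theta> (compose (topspace Y) g g') = compose (topspace Z) (\<theta> g) (\<theta> g')"
    if "g \<in> G" "g' \<in> G" for g g'
    using that jY hj hZ Y.act_closed by (auto simp: \<theta>_def compose_def)
  ultimately have "\<theta> \<in> iso (bij_subgroup (topspace Y) G) (bij_subgroup (topspace Z) H)"
    using \<theta>H by (auto simp: iso_def hom_def mult_bij_subgroup[OF Y.sub_Bij] mult_bij_subgroup[OF Z.sub_Bij])
  moreover have "h (g y) = \<theta> g (h y)" if "g \<in> G" "y \<in> topspace Y" for g y
    using that hj hZ by (simp add: \<theta>_def)
  ultimately show ?thesis
    unfolding equivalent_covers_def using h eq by blast
qed

section \<open>Maps between covers\<close>

locale cover_morphism =
  lower: finite_regular_cover X Y G f + upper: finite_regular_cover X Z H k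
  for X :: "'a topology" and Y :: "'b topology" and G f and Z :: "'c topology" and H k +
  fixes h :: "'c \<Rightarrow> 'b"
  assumes h_cont: "continuous_map Z Y h" and h_surj: "h ` topspace Z = topspace Y"
    and h_lift: "\<And>z. z \<in> topspace Z \<Longrightarrow> f (h z) = k z"
begin

lemma h_closed: "z \<in> topspace Z \<Longrightarrow> h z \<in> topspace Y"
  using h_surj by blast

text \<open>
  Composing \<open>h\<close> with a deck transformation of the upper cover gives another lift.
\<close>

lemma equivariant:
  assumes g: "g \<in> H"
  shows "\<exists>!g'. g' \<in> G \<and> (\<forall>z\<in>topspace Z. g' (h z) = h (g z))"
proof -
  obtain g' where "g' \<in> G" "\<forall>z\<in>topspace Z. h (g z) = g' (h z)"
    using lower.unique_lift[OF upper.connected h_cont continuous_map_compose[OF upper.continuous_act[OF g] h_cont]]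
      h_lift upper.act_closed[OF g] upper.cover_act[OF g] by auto
  moreover obtain z where "z \<in> topspace Z" using upper.nonempty by blast
  ultimately show ?thesis
    by (metis h_closed lower.act_eq)
qed

text \<open>
  The fibres of \<open>h\<close> are the orbits of the deck transformations of the upper cover that fix \<open>h\<close>:
  if \<open>h z = h (g z)\<close> holds at one point then \<open>h \<circ> g\<close> and \<open>h\<close> are lifts of the same map that
  agree somewhere.
\<close>

lemma regular_cover:
  "finite_regular_cover Y Z {g \<in> H. \<forall>z\<in>topspace Z. h (g z) = h z} h"
proof -
  define K where "K = {g \<in> H. \<forall>z\<in>topspace Z. h (g z) = h z}"
  have "homeo_group Z K"
    unfolding homeo_group_def subgroup_BijGroup_iff
  proof (intro conjI ballI)
    show "K \<subseteq> Bij (topspace Z)" using upper.sub_Bij by (auto simp: K_def)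
    show "(\<lambda>z\<in>topspace Z. z) \<in> K" using upper.id_mem by (simp add: K_def)
    show "compose (topspace Z) g g' \<in> K" if "g \<in> K" "g' \<in> K" for g g'
      using that upper.compose_mem upper.act_closed by (simp add: K_def compose_eq)
    show "\<exists>g'\<in>K. \<forall>x\<in>topspace Z. g' (g x) = x \<and> g (g' x) = x" if g: "g \<in> K" for g
    proof -
      obtain g' where g': "g' \<in> H" "\<And>y. y \<in> topspace Z \<Longrightarrow> g' (g y) = y" "\<And>y. y \<in> topspace Z \<Longrightarrow> g (g' y) = y"
        using upper.inverse_mem[of g] g unfolding K_def by blast
      have "h (g' z) = h z" if "z \<in> topspace Z" for z
        using g upper.act_closed[OF g'(1) that] g'(3)[OF that] unfolding K_def by force
      then show ?thesis using g' by (auto simp: K_def)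
    qed
    show "homeomorphic_map Z Z g" if "g \<in> K" for g
      using that upper.homeomorphic_act by (simp add: K_def)
  qed
  moreover have "fibres_are_orbits (topspace Z) K h"
    unfolding fibres_are_orbits_def
  proof (intro ballI iffI)
    fix y z assume yz: "y \<in> topspace Z" "z \<in> topspace Z" "h y = h z"
    then obtain g where g: "g \<in> H" "z = g y"
      using upper.same_fibre h_lift by metis
    have "h (g x) = h x" if "x \<in> topspace Z" for x
      using lower.lift_eq[OF upper.connected continuous_map_compose[OF upper.continuous_act[OF g(1)] h_cont] h_cont _ yz(1) _ that]
        h_lift upper.act_closed[OF g(1)] upper.cover_act[OF g(1)] yz g by simp
    then show "\<exists>g\<in>K. z = g y" using g by (auto simp: K_def)
  qed (auto simp: K_def)
  moreover have "free_action (topspace Z) K"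
    using upper.free by (simp add: free_action_def K_def)
  moreover have "finite K" using upper.finite_group by (simp add: K_def)
  ultimately show ?thesis
    unfolding K_def[symmetric]
    using lower.Hausdorff upper.compact upper.Hausdorff upper.connected upper.nonempty h_cont h_surj
    by unfold_locales
qed

end

lemma cover_morphism_act:
  assumes h: "cover_morphism X Y G f Z H k h" and g: "g \<in> G"
  shows "cover_morphism X Y G f Z H k (compose (topspace Z) g h)"
proof -
  interpret cover_morphism X Y G f Z H k h by fact
  have gs: "g ` topspace Y = topspace Y"
    using lower.sub_Bij g by (auto simp: Bij_def bij_betw_def)
  show ?thesis
  proof
    show "continuous_map Z Y (compose (topspace Z) g h)"
      using continuous_map_compose[OF h_cont lower.continuous_act[OF g]]
      by (rule continuous_map_eq) (simp add: compose_def)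
    show "compose (topspace Z) g h ` topspace Z = topspace Y"
      using gs h_surj by (simp add: compose_def image_image[symmetric])
    show "f (compose (topspace Z) g h z) = k z" if "z \<in> topspace Z" for z
      using that h_closed h_lift lower.cover_act[OF g] by (simp add: compose_eq)
  qed
qed

lemma (in cover_morphism) regular_covering_factors_eq:
  "regular_covering_factors Y f Z k = (\<lambda>g. compose (topspace Z) g h) ` G"
proof
  show "(\<lambda>g. compose (topspace Z) g h) ` G \<subseteq> regular_covering_factors Y f Z k"
  proof clarify
    fix g assume g: "g \<in> G"
    interpret g: cover_morphism X Y G f Z H k "compose (topspace Z) g h"
      using cover_morphism_act[OF cover_morphism_axioms g] .
    show "compose (topspace Z) g h \<in> regular_covering_factors Y f Z k"
      using finite_regular_cover.regular_covering[OF g.regular_cover] g.h_lift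
      unfolding regular_covering_factors_def by (auto simp: compose_extensional)
  qed
  show "regular_covering_factors Y f Z k \<subseteq> (\<lambda>g. compose (topspace Z) g h) ` G"
  proof
    fix u assume "u \<in> regular_covering_factors Y f Z k"
    then have u: "u \<in> extensional (topspace Z)" "continuous_map Z Y u" "\<And>z. z \<in> topspace Z \<Longrightarrow> k z = f (u z)"
      by (auto simp: regular_covering_factors_def regular_covering_map_def covering_map_def)
    obtain g where g: "g \<in> G" "\<forall>z\<in>topspace Z. u z = g (h z)"
      using lower.unique_lift[OF upper.connected h_cont u(2)] u(3) h_lift by auto
    have "u = compose (topspace Z) g h"
      using u(1) g(2) by (intro extensionalityI[of _ "topspace Z"]) (auto simp: compose_def)
    then show "u \<in> (\<lambda>g. compose (topspace Z) g h) ` G" using g by blast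
  qed
qed

section \<open>Common refinements of two covers\<close>

text \<open>
  The saturation of a clopen set is a finite union of translates, so its image is clopen too.
\<close>

lemma clopen_image_of_finite_group_quotient:
  assumes P: "compact_space P" and X: "connected_space X" "Hausdorff_space X"
    and f: "continuous_map P X f" "f ` topspace P = topspace X"
    and K: "finite K" "\<And>g. g \<in> K \<Longrightarrow> homeomorphic_map P P g"
      "\<And>g y. g \<in> K \<Longrightarrow> y \<in> topspace P \<Longrightarrow> f (g y) = f y"
      "\<And>y z. y \<in> topspace P \<Longrightarrow> z \<in> topspace P \<Longrightarrow> f y = f z \<Longrightarrow> \<exists>g\<in>K. z = g y"
    and A: "openin P A" "closedin P A" "A \<noteq> {}"
  shows "f ` A = topspace X"
proof -
  have AP: "A \<subseteq> topspace P" using A(1) openin_subset by blast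
  have "{y \<in> topspace P. f y \<in> f ` A} = (\<Union>g\<in>K. g ` A)"
  proof
    show "{y \<in> topspace P. f y \<in> f ` A} \<subseteq> (\<Union>g\<in>K. g ` A)"
    proof
      fix y assume "y \<in> {y \<in> topspace P. f y \<in> f ` A}"
      then obtain a where a: "y \<in> topspace P" "a \<in> A" "f a = f y" by auto
      then obtain g where "g \<in> K" "y = g a" using K(4)[of a y] AP by blast
      then show "y \<in> (\<Union>g\<in>K. g ` A)" using a by blast
    qed
    have "g a \<in> topspace P" if "g \<in> K" "a \<in> A" for g a
      using that AP homeomorphic_imp_surjective_map[OF K(2)[OF that(1)]] by blast
    then show "(\<Union>g\<in>K. g ` A) \<subseteq> {y \<in> topspace P. f y \<in> f ` A}"
      using K(3) AP by (auto simp: subset_iff)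
  qed
  moreover have "openin P (g ` A)" if "g \<in> K" for g
    using A(1) homeomorphic_imp_open_map[OF K(2)[OF that]] by (simp add: open_map_def)
  ultimately have "openin P {y \<in> topspace P. f y \<in> f ` A}"
    by auto
  moreover have "quotient_map P X f"
    using continuous_imp_quotient_map f P X by blast
  moreover have fA: "f ` A \<subseteq> topspace X" using AP f by blast
  ultimately have "openin X (f ` A)"
    unfolding quotient_map_def by blast
  moreover have "closedin X (f ` A)"
    using image_compactin[OF closedin_compact_space[OF P A(2)] f(1)] X(2) compactin_imp_closedin by blast
  ultimately show ?thesis
    using X(1) A(3) unfolding connected_space_clopen_in by blast
qed

text \<open>
  Every nonempty clopen set meets every fibre, so a clopen neighbourhood of \<open>p\<close> that meets one fixed
  (finite) fibre in as few points as possible cannot be separated. This makes up for the lack of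
  local connectedness, which would provide open components.
\<close>

lemma clopen_connected_piece:
  assumes P: "compact_space P" and X: "connected_space X" "Hausdorff_space X"
    and f: "continuous_map P X f" "f ` topspace P = topspace X"
    and K: "finite K" "\<And>g. g \<in> K \<Longrightarrow> homeomorphic_map P P g"
      "\<And>g y. g \<in> K \<Longrightarrow> y \<in> topspace P \<Longrightarrow> f (g y) = f y"
      "\<And>y z. y \<in> topspace P \<Longrightarrow> z \<in> topspace P \<Longrightarrow> f y = f z \<Longrightarrow> \<exists>g\<in>K. z = g y"
    and p: "p \<in> topspace P"
  obtains C where "openin P C" "closedin P C" "p \<in> C" "connectedin P C"
proof -
  define F where "F = {z \<in> topspace P. f z = f p}"
  have "F \<subseteq> (\<lambda>g. g p) ` K"
  proof
    fix z assume "z \<in> F"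
    then obtain g where "g \<in> K" "z = g p" using K(4)[OF p, of z] unfolding F_def by auto
    then show "z \<in> (\<lambda>g. g p) ` K" by blast
  qed
  then have F: "finite F" using K(1) finite_subset by blast
  have meets: "A \<inter> F \<noteq> {}" if "openin P A" "closedin P A" "A \<noteq> {}" for A
  proof -
    have "f ` A = topspace X"
      by (rule clopen_image_of_finite_group_quotient[of P X f K]) (use P X f K that in auto)
    moreover have "f p \<in> topspace X" using f p by blast
    ultimately obtain a where "a \<in> A" "f a = f p" by (metis imageE)
    moreover have "A \<subseteq> topspace P" using that(1) openin_subset by blast
    ultimately show ?thesis unfolding F_def by blast
  qed
  define Q where "Q = (\<lambda>C. openin P C \<and> closedin P C \<and> p \<in> C)"
  have "Q (topspace P)" using p by (simp add: Q_def)
  then obtain C where C: "Q C" "\<And>D. Q D \<Longrightarrow> card (C \<inter> F) \<le> card (D \<inter> F)"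
    using ex_has_least_nat[of Q "topspace P" "\<lambda>C. card (C \<inter> F)"] by blast
  have CP: "C \<subseteq> topspace P" and oC: "openin P C" and cC: "closedin P C" and pC: "p \<in> C"
    using C(1) openin_subset unfolding Q_def by blast+
  have "connected_space (subtopology P C)"
    unfolding connected_space_clopen_in
  proof (intro allI impI)
    fix T assume T: "openin (subtopology P C) T \<and> closedin (subtopology P C) T"
    then have T': "openin P T" "closedin P T" "T \<subseteq> C"
      using oC cC openin_trans_full closedin_trans_full openin_subset by fastforce+
    define D where "D = (if p \<in> T then T else C - T)"
    have "Q D" "D \<subseteq> C"
      using T' oC cC pC by (auto simp: Q_def D_def openin_diff closedin_diff)
    then have "card (C \<inter> F) \<le> card (D \<inter> F)" using C(2) by blast
    moreover have "D \<inter> F \<subseteq> C \<inter> F" using \<open>D \<subseteq> C\<close> by blast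
    ultimately have eq: "D \<inter> F = C \<inter> F"
      using F by (meson card_seteq finite_Int)
    have "(C - D) \<inter> F = {}" using eq by blast
    moreover have "openin P (C - D)" "closedin P (C - D)"
      using \<open>Q D\<close> oC cC by (auto simp: Q_def openin_diff closedin_diff)
    ultimately have "C - D = {}" using meets by blast
    then show "T = {} \<or> T = topspace (subtopology P C)"
      using \<open>D \<subseteq> C\<close> T'(3) CP unfolding D_def topspace_subtopology
      by (cases "p \<in> T") auto
  qed
  then have "connectedin P C"
    using CP by (simp add: connectedin_def)
  then show ?thesis
    using that oC cC pC by blast
qed

lemma homeomorphic_map_prod:
  assumes "homeomorphic_map X X' f" "homeomorphic_map Y Y' g"
  shows "homeomorphic_map (prod_topology X Y) (prod_topology X' Y') (\<lambda>(x, y). (f x, g y))"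
proof -
  obtain f' g' where "homeomorphic_maps X X' f f'" "homeomorphic_maps Y Y' g g'"
    using assms unfolding homeomorphic_map_maps by blast
  then have "homeomorphic_maps (prod_topology X Y) (prod_topology X' Y')
      (\<lambda>(x, y). (f x, g y)) (\<lambda>(x, y). (f' x, g' y))"
    by (simp add: homeomorphic_maps_prod)
  then show ?thesis
    unfolding homeomorphic_map_maps by blast
qed

locale two_covers =
  first: finite_regular_cover X Y G f + second: finite_regular_cover X Z H k
  for X :: "'a topology" and Y :: "'b topology" and G f and Z :: "'c topology" and H k
begin

abbreviation "YZ \<equiv> prod_topology Y Z"

definition fibre_product :: "('b \<times> 'c) set" where
  "fibre_product = {c \<in> topspace YZ. (f \<circ> fst) c = (k \<circ> snd) c}"

lemma mem_fibre_product:
  "c \<in> fibre_product \<longleftrightarrow> fst c \<in> topspace Y \<and> snd c \<in> topspace Z \<and> f (fst c) = k (snd c)"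
  by (cases c) (auto simp: fibre_product_def)

lemma fibre_product_subset: "fibre_product \<subseteq> topspace YZ"
  by (auto simp: fibre_product_def)

lemma compact_YZ: "compact_space YZ" and Hausdorff_YZ: "Hausdorff_space YZ"
  by (auto simp: compact_space_prod_topology Hausdorff_space_prod_topology
      first.compact second.compact first.Hausdorff second.Hausdorff)

lemma closedin_fibre_product: "closedin YZ fibre_product"
  unfolding fibre_product_def
  using first.Hausdorff_base continuous_map_compose[OF continuous_map_fst first.cont]
    continuous_map_compose[OF continuous_map_snd second.cont]
  by (intro closedin_continuous_maps_eq)

text \<open>
  The refinement is a clopen connected piece of the fibre product. A deck transformation of the
  piece with a fixed point is the identity, since its coordinates are lifts to the given covers that
  agree with the projections at this point. A product of two deck transformations that moves one
  point of the piece to another one preserves the piece, by connectedness, so the deck group is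
  transitive on fibres.
\<close>

proposition common_refinement:
  obtains C where
    "finite_regular_cover X (subtopology (prod_topology Y Z) C)
       (deck_group (subtopology (prod_topology Y Z) C) (f \<circ> fst)) (f \<circ> fst)"
    "C \<subseteq> topspace Y \<times> topspace Z" "fst ` C = topspace Y" "snd ` C = topspace Z"
    "\<And>c. c \<in> C \<Longrightarrow> f (fst c) = k (snd c)"
proof -
  define P where "P = subtopology YZ fibre_product"
  have topP: "topspace P = fibre_product" using fibre_product_subset by (auto simp: P_def)
  have P_compact: "compact_space P"
    using compact_YZ closedin_fibre_product closedin_compact_space compact_space_subtopology unfolding P_def by blast
  define \<kappa> where "\<kappa> = (\<lambda>(g, h) (y::'b, z::'c). (g y :: 'b, h z :: 'c))"
  have \<kappa>_YZ: "homeomorphic_map YZ YZ (\<kappa> gh)" if "gh \<in> G \<times> H" for gh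
    using that first.homeomorphic_act second.homeomorphic_act
    unfolding \<kappa>_def by (auto intro!: homeomorphic_map_prod)
  have \<kappa>_simps: "fst (\<kappa> gh c) = fst gh (fst c)" "snd (\<kappa> gh c) = snd gh (snd c)" for gh c
    by (auto simp: \<kappa>_def split: prod.splits)
  have \<kappa>_FP: "\<kappa> gh ` fibre_product = fibre_product" if gh: "gh \<in> G \<times> H" for gh
  proof -
    have "\<kappa> gh ` fibre_product \<subseteq> fibre_product"
      using gh by (auto simp: mem_fibre_product \<kappa>_simps first.act_closed second.act_closed first.cover_act second.cover_act)
    moreover have "c \<in> \<kappa> gh ` fibre_product" if c: "c \<in> fibre_product" for c
    proof -
      obtain d where d: "d \<in> topspace YZ" "\<kappa> gh d = c"
        using homeomorphic_imp_surjective_map[OF \<kappa>_YZ[OF gh]] c fibre_product_subset by (metis imageE subsetD)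
      then have "d \<in> fibre_product"
        using c gh by (auto simp: mem_fibre_product \<kappa>_simps first.cover_act second.cover_act simp flip: d(2))
      then show ?thesis using d by blast
    qed
    ultimately show ?thesis by blast
  qed
  have \<kappa>_P: "homeomorphic_map P P (\<kappa> gh)" if "gh \<in> G \<times> H" for gh
    unfolding P_def using \<kappa>_YZ[OF that] \<kappa>_FP[OF that] fibre_product_subset
    by (intro homeomorphic_map_subtopologies) (auto simp: inf.absorb2)
  have fst_P: "continuous_map P Y fst" and snd_P: "continuous_map P Z snd"
    using continuous_map_fst continuous_map_snd continuous_map_from_subtopology unfolding P_def by blast+
  have fst_FP: "fst ` fibre_product = topspace Y"
  proof -
    have "y \<in> fst ` fibre_product" if y: "y \<in> topspace Y" for y
    proof -
      obtain z where "z \<in> topspace Z" "k z = f y"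
        using first.cover_closed[OF y] second.surj by (metis imageE)
      then have "(y, z) \<in> fibre_product" using y by (simp add: mem_fibre_product)
      then show ?thesis by force
    qed
    then show ?thesis by (auto simp: mem_fibre_product)
  qed
  have snd_FP: "snd ` fibre_product = topspace Z"
  proof -
    have "z \<in> snd ` fibre_product" if z: "z \<in> topspace Z" for z
    proof -
      obtain y where "y \<in> topspace Y" "k z = f y"
        using second.cover_closed[OF z] first.surj by (metis imageE)
      then have "(y, z) \<in> fibre_product" using z by (simp add: mem_fibre_product)
      then show ?thesis by force
    qed
    then show ?thesis by (auto simp: mem_fibre_product)
  qed
  have X_connected: "connected_space X"
    using first.connected first.surj connectedin_continuous_map_image[OF first.cont, of "topspace Y"] by (simp add: connectedin_topspace)
  have trans: "\<exists>gh\<in>G \<times> H. d = \<kappa> gh c" if cd: "c \<in> fibre_product" "d \<in> fibre_product" "f (fst c) = f (fst d)" for c d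
  proof -
    obtain g where g: "g \<in> G" "fst d = g (fst c)"
      using first.same_fibre[of "fst c" "fst d"] cd by (auto simp: mem_fibre_product)
    obtain h where h: "h \<in> H" "snd d = h (snd c)"
      using second.same_fibre[of "snd c" "snd d"] cd by (auto simp: mem_fibre_product)
    have "d = \<kappa> (g, h) c"
      using g h by (auto simp: prod_eq_iff \<kappa>_simps)
    then show ?thesis using g h by blast
  qed
  obtain p where p: "p \<in> fibre_product" using fst_FP first.nonempty by blast
  obtain C where C: "openin P C" "closedin P C" "p \<in> C" "connectedin P C"
  proof (rule clopen_connected_piece[of P X "f \<circ> fst" "\<kappa> ` (G \<times> H)" p])
    show "continuous_map P X (f \<circ> fst)" using fst_P first.cont continuous_map_compose by blast
    show "(f \<circ> fst) ` topspace P = topspace X" using fst_FP first.surj topP by (metis image_comp)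
    show "homeomorphic_map P P g" if "g \<in> \<kappa> ` (G \<times> H)" for g using that \<kappa>_P by blast
    show "(f \<circ> fst) (g y) = (f \<circ> fst) y" if "g \<in> \<kappa> ` (G \<times> H)" "y \<in> topspace P" for g y
      using that by (auto simp: topP mem_fibre_product \<kappa>_simps first.cover_act)
    show "\<exists>g\<in>\<kappa> ` (G \<times> H). z = g y"
      if "y \<in> topspace P" "z \<in> topspace P" "(f \<circ> fst) y = (f \<circ> fst) z" for y z
      using trans[of y z] that by (auto simp: topP)
  qed (use P_compact X_connected first.Hausdorff_base first.finite_group second.finite_group p topP in auto)
  have CS: "C \<subseteq> fibre_product" using openin_subset[OF C(1)] topP by simp
  have fst_C: "fst ` C = topspace Y"
  proof (rule clopen_image_of_finite_group_quotient[of P Y fst "(\<lambda>h. \<kappa> (\<lambda>y\<in>topspace Y. y, h)) ` H"])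
    show "homeomorphic_map P P g" if "g \<in> (\<lambda>h. \<kappa> (\<lambda>y\<in>topspace Y. y, h)) ` H" for g
      using that \<kappa>_P first.id_mem by blast
    show "fst (g y) = fst y" if "g \<in> (\<lambda>h. \<kappa> (\<lambda>y\<in>topspace Y. y, h)) ` H" "y \<in> topspace P" for g y
      using that by (auto simp: topP mem_fibre_product \<kappa>_simps)
    show "\<exists>g\<in>(\<lambda>h. \<kappa> (\<lambda>y\<in>topspace Y. y, h)) ` H. z = g y"
      if yz: "y \<in> topspace P" "z \<in> topspace P" "fst y = fst z" for y z
    proof -
      obtain h where h: "h \<in> H" "snd z = h (snd y)"
        using second.same_fibre[of "snd y" "snd z"] yz by (auto simp: topP mem_fibre_product)
      have "z = \<kappa> (\<lambda>y\<in>topspace Y. y, h) y"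
        using h yz by (auto simp: prod_eq_iff \<kappa>_simps topP mem_fibre_product)
      then show ?thesis using h by blast
    qed
  qed (use P_compact first.connected first.Hausdorff fst_P fst_FP topP second.finite_group C in auto)
  have snd_C: "snd ` C = topspace Z"
  proof (rule clopen_image_of_finite_group_quotient[of P Z snd "(\<lambda>g. \<kappa> (g, \<lambda>z\<in>topspace Z. z)) ` G"])
    show "homeomorphic_map P P g" if "g \<in> (\<lambda>g. \<kappa> (g, \<lambda>z\<in>topspace Z. z)) ` G" for g
      using that \<kappa>_P second.id_mem by blast
    show "snd (g y) = snd y" if "g \<in> (\<lambda>g. \<kappa> (g, \<lambda>z\<in>topspace Z. z)) ` G" "y \<in> topspace P" for g y
      using that by (auto simp: topP mem_fibre_product \<kappa>_simps)
    show "\<exists>g\<in>(\<lambda>g. \<kappa> (g, \<lambda>z\<in>topspace Z. z)) ` G. z = g y"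
      if yz: "y \<in> topspace P" "z \<in> topspace P" "snd y = snd z" for y z
    proof -
      obtain g where g: "g \<in> G" "fst z = g (fst y)"
        using first.same_fibre[of "fst y" "fst z"] yz by (auto simp: topP mem_fibre_product)
      have "z = \<kappa> (g, \<lambda>z\<in>topspace Z. z) y"
        using g yz by (auto simp: prod_eq_iff \<kappa>_simps topP mem_fibre_product)
      then show ?thesis using g by blast
    qed
  qed (use P_compact second.connected second.Hausdorff snd_P snd_FP topP first.finite_group C in auto)
  define W where "W = subtopology YZ C"
  have topW: "topspace W = C" using CS fibre_product_subset by (auto simp: W_def)
  have W_P: "W = subtopology P C"
    using CS by (simp add: W_def P_def subtopology_subtopology inf.absorb2)
  have fst_W: "continuous_map W Y fst" and snd_W: "continuous_map W Z snd"
    using continuous_map_fst continuous_map_snd continuous_map_from_subtopology unfolding W_def by blast+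
  have W_connected: "connected_space W"
    using C(4) by (simp add: W_P connectedin_def)
  have "finite_regular_cover X W (deck_group W (f \<circ> fst)) (f \<circ> fst)"
  proof (rule finite_regular_cover_deck_group[OF first.Hausdorff_base])
    show "compact_space W"
      using C(2) P_compact closedin_compact_space compact_space_subtopology W_P by metis
    show "Hausdorff_space W" using Hausdorff_YZ by (simp add: W_def Hausdorff_space_subtopology)
    show "connected_space W" by fact
    show "topspace W \<noteq> {}" using C(3) topW by blast
    show "continuous_map W X (f \<circ> fst)" using fst_W first.cont continuous_map_compose by blast
    show "(f \<circ> fst) ` topspace W = topspace X" using fst_C first.surj topW by (metis image_comp)
    show "finite {z \<in> topspace W. (f \<circ> fst) z = (f \<circ> fst) y}" if "y \<in> topspace W" for y
    proof -
      have y: "y \<in> fibre_product" using that topW CS by blast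
      have "{z \<in> topspace W. (f \<circ> fst) z = (f \<circ> fst) y}
        \<subseteq> {a \<in> topspace Y. f a = f (fst y)} \<times> {b \<in> topspace Z. k b = k (snd y)}"
        using y CS by (auto simp: topW mem_fibre_product subset_iff)
      moreover have "finite ({a \<in> topspace Y. f a = f (fst y)} \<times> {b \<in> topspace Z. k b = k (snd y)})"
        using first.finite_fibre[of "fst y"] second.finite_fibre[of "snd y"] y by (intro finite_cartesian_product) (auto simp: mem_fibre_product)
      ultimately show ?thesis by (rule finite_subset)
    qed
    show "\<forall>z\<in>topspace W. g z = z"
      if g: "g \<in> deck_group W (f \<circ> fst)" and y: "y \<in> topspace W" "g y = y" for g y
    proof
      fix z assume z: "z \<in> topspace W"
      have gW: "f (fst (g w)) = f (fst w)" "g w \<in> topspace W" if "w \<in> topspace W" for w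
        using deck_group_lift(2,3)[OF g that] by auto
      have "fst (g z) = fst z"
        using first.lift_eq[OF W_connected continuous_map_compose[OF deck_group_lift(1)[OF g] fst_W] fst_W _ y(1) _ z]
          gW y by simp
      moreover have "k (snd (g w)) = k (snd w)" if "w \<in> topspace W" for w
        using gW[OF that] that CS mem_fibre_product[of w] mem_fibre_product[of "g w"] by (auto simp: topW)
      then have "snd (g z) = snd z"
        using second.lift_eq[OF W_connected continuous_map_compose[OF deck_group_lift(1)[OF g] snd_W] snd_W _ y(1) _ z]
          y by simp
      ultimately show "g z = z" by (simp add: prod_eq_iff)
    qed
    show "\<exists>g\<in>deck_group W (f \<circ> fst). g y = z"
      if y: "y \<in> topspace W" and z: "z \<in> topspace W" and yz: "(f \<circ> fst) y = (f \<circ> fst) z" for y z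
    proof -
      obtain gh where gh: "gh \<in> G \<times> H" "z = \<kappa> gh y"
        using trans[of y z] y z yz topW CS by auto
      let ?C' = "\<kappa> gh ` C"
      have C': "openin P ?C'" "closedin P ?C'"
        using C \<kappa>_P[OF gh(1)] homeomorphic_imp_open_map homeomorphic_imp_closed_map
        unfolding open_map_def closed_map_def by blast+
      have "connectedin P ?C'"
        using C(4) \<kappa>_P[OF gh(1)] connectedin_continuous_map_image homeomorphic_imp_continuous_map by blast
      moreover have zC: "z \<in> C \<inter> ?C'" using gh y z topW by blast
      ultimately have "C \<subseteq> ?C'" "?C' \<subseteq> C"
        using connectedin_clopen_cases[OF C(4) C'(2,1)] connectedin_clopen_cases[OF _ C(2,1), of ?C']
        unfolding disjnt_def by blast+
      then have eq: "?C' = C" by blast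
      have "homeomorphic_map W W (\<kappa> gh)"
        unfolding W_P using \<kappa>_P[OF gh(1)] eq CS topP
        by (intro homeomorphic_map_subtopologies) (auto simp: inf.absorb2)
      then have hom: "homeomorphic_map W W (restrict (\<kappa> gh) (topspace W))"
        by (rule homeomorphic_map_eq) simp
      then have "restrict (\<kappa> gh) (topspace W) \<in> Bij (topspace W)"
        by (intro homeomorphic_map_imp_Bij) auto
      moreover have "f (fst (\<kappa> gh c)) = f (fst c)" if "c \<in> C" for c
        using that gh CS by (auto simp: mem_fibre_product \<kappa>_simps first.cover_act)
      ultimately have "restrict (\<kappa> gh) (topspace W) \<in> deck_group W (f \<circ> fst)"
        using hom by (simp add: deck_group_def topW)
      then show ?thesis using gh y by (intro bexI) auto
    qed
  qed
  then show ?thesis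
    using that[of C] CS fst_C snd_C unfolding W_def by (auto simp: mem_fibre_product subset_iff)
qed

end

text \<open>
  A fibre product of two spaces with points in \<open>'b\<close> fits into \<open>'b\<close> again: either \<open>'b\<close> is infinite and
  in bijection with its square, or the spaces are finite, connected and discrete, hence singletons.
\<close>

lemma Times_lepoll_of_connected:
  fixes Y Z :: "'b topology"
  assumes Y: "connected_space Y" "t1_space Y" and Z: "connected_space Z" "t1_space Z"
  shows "topspace Y \<times> topspace Z \<lesssim> (UNIV :: 'b set)"
proof (cases "finite (UNIV :: 'b set)")
  case True
  have "\<exists>a. topspace W \<subseteq> {a}" if "connected_space W" "t1_space W" for W :: "'b topology"
  proof -
    have "finite (topspace W)" using True by (meson finite_subset subset_UNIV)
    then have "W = discrete_topology (topspace W)"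
      using finite_t1_space_imp_discrete_topology that by blast
    then show ?thesis
      using that(1) connected_space_discrete_topology by metis
  qed
  then obtain a b where "topspace Y \<subseteq> {a}" "topspace Z \<subseteq> {b}"
    using Y Z by meson
  then have "inj_on fst (topspace Y \<times> topspace Z)"
    by (auto simp: inj_on_def)
  then show ?thesis
    unfolding lepoll_def by blast
next
  case False
  then obtain j :: "'b \<times> 'b \<Rightarrow> 'b" where "bij_betw j (UNIV \<times> UNIV) UNIV"
    using card_of_Times_same_infinite[of "UNIV :: 'b set"] card_of_ordIso by blast
  then have "inj_on j (topspace Y \<times> topspace Z)"
    using inj_on_subset[of j "UNIV \<times> UNIV"] by (simp add: bij_betw_def)
  then show ?thesis
    unfolding lepoll_def by blast
qed

section \<open>Entourages of compact metrizable spaces\<close>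

lemma openin_prod_slices:
  assumes W: "openin (prod_topology X Y) W"
  shows "openin Y {y. (x, y) \<in> W}" "openin X {x. (x, y) \<in> W}"
proof -
  have W': "(x, y) \<in> W \<Longrightarrow> \<exists>U V. openin X U \<and> openin Y V \<and> x \<in> U \<and> y \<in> V \<and> U \<times> V \<subseteq> W" for x y
    using W unfolding openin_prod_topology_alt by blast
  show "openin Y {y. (x, y) \<in> W}"
  proof (subst openin_subopen, intro ballI)
    fix y assume "y \<in> {y. (x, y) \<in> W}"
    then obtain U V where "openin Y V" "x \<in> U" "y \<in> V" "U \<times> V \<subseteq> W" using W'[of x y] by auto
    then show "\<exists>T. openin Y T \<and> y \<in> T \<and> T \<subseteq> {y. (x, y) \<in> W}" by blast
  qed
  show "openin X {x. (x, y) \<in> W}"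
  proof (subst openin_subopen, intro ballI)
    fix x assume "x \<in> {x. (x, y) \<in> W}"
    then obtain U V where "openin X U" "x \<in> U" "y \<in> V" "U \<times> V \<subseteq> W" using W'[of x y] by auto
    then show "\<exists>T. openin X T \<and> x \<in> T \<and> T \<subseteq> {x. (x, y) \<in> W}" by blast
  qed
qed

lemma openin_prod_subset: "openin (prod_topology X Y) W \<Longrightarrow> W \<subseteq> topspace X \<times> topspace Y"
  using openin_subset[of "prod_topology X Y" W] by simp

lemma open_map_prod_image:
  assumes f: "open_map X X' f" and g: "open_map Y Y' g" and W: "openin (prod_topology X Y) W"
  shows "openin (prod_topology X' Y') (map_prod f g ` W)"
  unfolding openin_prod_topology_alt
proof (intro allI impI)
  fix a b assume "(a, b) \<in> map_prod f g ` W"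
  then obtain x y where xy: "(x, y) \<in> W" "a = f x" "b = g y" by auto
  then obtain U V where UV: "openin X U" "openin Y V" "x \<in> U" "y \<in> V" "U \<times> V \<subseteq> W"
    using W unfolding openin_prod_topology_alt by meson
  have "f ` U \<times> g ` V \<subseteq> map_prod f g ` W"
    using image_mono[OF UV(5), of "map_prod f g"] by (simp add: map_prod_surj_on)
  moreover have "openin X' (f ` U)" "openin Y' (g ` V)"
    using UV f g by (auto simp: open_map_def)
  ultimately show "\<exists>U V. openin X' U \<and> openin Y' V \<and> a \<in> U \<and> b \<in> V \<and> U \<times> V \<subseteq> map_prod f g ` W"
    using UV xy by blast
qed

lemma (in Metric_space) openin_metric_entourage:
  "openin (prod_topology mtopology mtopology) {(x, y). x \<in> M \<and> y \<in> M \<and> d x y < \<epsilon>}"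
  unfolding openin_prod_topology_alt
proof (intro allI impI)
  fix x y assume "(x, y) \<in> {(x, y). x \<in> M \<and> y \<in> M \<and> d x y < \<epsilon>}"
  then have xy: "x \<in> M" "y \<in> M" "d x y < \<epsilon>" by auto
  define \<delta> where "\<delta> = (\<epsilon> - d x y) / 2"
  have "d u v < \<epsilon>" if "u \<in> mball x \<delta>" "v \<in> mball y \<delta>" for u v
  proof -
    have "d u v \<le> d u x + d x y + d y v"
      using triangle[of u x v] triangle[of x y v] that xy by simp
    also have "\<dots> < \<epsilon>"
      using that commute[of u x] by (simp add: \<delta>_def)
    finally show ?thesis .
  qed
  then have "mball x \<delta> \<times> mball y \<delta> \<subseteq> {(x, y). x \<in> M \<and> y \<in> M \<and> d x y < \<epsilon>}"
    by auto
  moreover have "\<delta> > 0" using xy by (simp add: \<delta>_def)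
  ultimately show "\<exists>U V. openin mtopology U \<and> openin mtopology V \<and> x \<in> U \<and> y \<in> V \<and>
      U \<times> V \<subseteq> {(x, y). x \<in> M \<and> y \<in> M \<and> d x y < \<epsilon>}"
    using xy by (intro exI[of _ "mball x \<delta>"] exI[of _ "mball y \<delta>"]) auto
qed

text \<open>
  The bound is a Lebesgue number of the cover by open sets whose square lies in \<open>W\<close>.
\<close>

lemma (in Metric_space) metric_entourage_below:
  assumes M: "compact_space mtopology" and W: "openin (prod_topology mtopology mtopology) W"
    and diag: "Id_on M \<subseteq> W"
  obtains \<epsilon> where "\<epsilon> > 0" "\<And>x y. x \<in> M \<Longrightarrow> y \<in> M \<Longrightarrow> d x y < \<epsilon> \<Longrightarrow> (x, y) \<in> W"
proof -
  define \<C> where "\<C> = {U. openin mtopology U \<and> U \<times> U \<subseteq> W}"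
  have "x \<in> \<Union>\<C>" if "x \<in> M" for x
  proof -
    have "(x, x) \<in> W" using that diag by blast
    then obtain U V where "openin mtopology U" "openin mtopology V" "x \<in> U" "x \<in> V" "U \<times> V \<subseteq> W"
      using W unfolding openin_prod_topology_alt by meson
    then have "U \<inter> V \<in> \<C>" "x \<in> U \<inter> V"
      by (auto simp: \<C>_def)
    then show ?thesis by blast
  qed
  then have "M \<subseteq> \<Union>\<C>" by blast
  moreover have "openin mtopology U" if "U \<in> \<C>" for U using that by (simp add: \<C>_def)
  ultimately obtain \<epsilon> where \<epsilon>: "\<epsilon> > 0" "\<forall>x\<in>M. \<exists>U\<in>\<C>. mball x \<epsilon> \<subseteq> U"
    using lebesgue_number[of M \<C>] M by (auto simp: compact_space_def)
  have "(x, y) \<in> W" if xy: "x \<in> M" "y \<in> M" "d x y < \<epsilon>" for x y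
  proof -
    obtain U where "U \<in> \<C>" "mball x \<epsilon> \<subseteq> U" using \<epsilon> xy by blast
    moreover have "x \<in> mball x \<epsilon>" "y \<in> mball x \<epsilon>" using xy \<epsilon> by auto
    ultimately show ?thesis unfolding \<C>_def by blast
  qed
  with \<epsilon>(1) that show ?thesis by blast
qed

lemma (in Metric_space) compact_entourages_metric:
  assumes M: "compact_space mtopology"
  shows "E \<in> compact_entourages mtopology \<longleftrightarrow>
    E \<subseteq> M \<times> M \<and> sym E \<and> (\<exists>\<epsilon>>0. \<forall>x\<in>M. \<forall>y\<in>M. d x y < \<epsilon> \<longrightarrow> (x, y) \<in> E)"
proof
  assume E: "E \<in> compact_entourages mtopology"
  then obtain W where W: "openin (prod_topology mtopology mtopology) W" "Id_on M \<subseteq> W" "W \<subseteq> E"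
    by (auto simp: compact_entourages_def)
  then obtain \<epsilon> where "\<epsilon> > 0" "\<And>x y. x \<in> M \<Longrightarrow> y \<in> M \<Longrightarrow> d x y < \<epsilon> \<Longrightarrow> (x, y) \<in> W"
    using metric_entourage_below[OF M] by blast
  then show "E \<subseteq> M \<times> M \<and> sym E \<and> (\<exists>\<epsilon>>0. \<forall>x\<in>M. \<forall>y\<in>M. d x y < \<epsilon> \<longrightarrow> (x, y) \<in> E)"
    using E W(3) unfolding compact_entourages_def by auto
next
  assume E: "E \<subseteq> M \<times> M \<and> sym E \<and> (\<exists>\<epsilon>>0. \<forall>x\<in>M. \<forall>y\<in>M. d x y < \<epsilon> \<longrightarrow> (x, y) \<in> E)"
  then obtain \<epsilon> where \<epsilon>: "\<epsilon> > 0" "\<forall>x\<in>M. \<forall>y\<in>M. d x y < \<epsilon> \<longrightarrow> (x, y) \<in> E" by blast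
  have "\<exists>W. openin (prod_topology mtopology mtopology) W \<and> Id_on M \<subseteq> W \<and> W \<subseteq> E"
    using openin_metric_entourage[of \<epsilon>] \<epsilon> by (intro exI[of _ "{(x, y). x \<in> M \<and> y \<in> M \<and> d x y < \<epsilon>}"]) auto
  then show "E \<in> compact_entourages mtopology"
    using E by (simp add: compact_entourages_def)
qed

lemma uniform_space_on_compact_entourages:
  assumes X: "compact_space X" "metrizable_space X"
  shows "uniform_space_on X (compact_entourages X)"
proof -
  obtain M d where "Metric_space M d" and Xd: "X = Metric_space.mtopology M d"
    using X(2) unfolding metrizable_space_def by blast
  then interpret Metric_space M d by simp
  have ent: "E \<in> compact_entourages X \<longleftrightarrow>
      E \<subseteq> M \<times> M \<and> sym E \<and> (\<exists>\<epsilon>>0. \<forall>x\<in>M. \<forall>y\<in>M. d x y < \<epsilon> \<longrightarrow> (x, y) \<in> E)" for E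
    using compact_entourages_metric X(1) unfolding Xd by blast
  have XM: "topspace X = M" by (simp add: Xd)
  have ball: "{(x, y). x \<in> M \<and> y \<in> M \<and> d x y < \<epsilon>} \<in> compact_entourages X" if "\<epsilon> > 0" for \<epsilon>
    unfolding ent using that commute by (auto simp: sym_def)
  have unif: "uniformity_on M (compact_entourages X)"
    unfolding uniformity_on_def
  proof (intro conjI ballI allI impI)
    show "compact_entourages X \<noteq> {}" using ball[of 1] by auto
    show "Id_on M \<subseteq> E" "E \<subseteq> M \<times> M" "sym E" if E: "E \<in> compact_entourages X" for E
    proof -
      obtain \<epsilon> where "\<epsilon> > 0" "\<forall>x\<in>M. \<forall>y\<in>M. d x y < \<epsilon> \<longrightarrow> (x, y) \<in> E"
        using E unfolding ent by blast
      then show "Id_on M \<subseteq> E" by auto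
      show "E \<subseteq> M \<times> M" "sym E" using E unfolding ent by blast+
    qed
    show "F \<in> compact_entourages X" if "E \<in> compact_entourages X" "E \<subseteq> F \<and> F \<subseteq> M \<times> M \<and> sym F" for E F
      using that unfolding ent by blast
    show "E \<inter> F \<in> compact_entourages X" if EF: "E \<in> compact_entourages X" "F \<in> compact_entourages X" for E F
    proof -
      obtain \<epsilon> \<delta> where "\<epsilon> > 0" "\<forall>x\<in>M. \<forall>y\<in>M. d x y < \<epsilon> \<longrightarrow> (x, y) \<in> E"
        "\<delta> > 0" "\<forall>x\<in>M. \<forall>y\<in>M. d x y < \<delta> \<longrightarrow> (x, y) \<in> F"
        using EF unfolding ent by blast
      then have "\<exists>\<epsilon>>0. \<forall>x\<in>M. \<forall>y\<in>M. d x y < \<epsilon> \<longrightarrow> (x, y) \<in> E \<inter> F"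
        by (intro exI[of _ "min \<epsilon> \<delta>"]) auto
      then show ?thesis
        using EF unfolding ent by (auto intro: sym_Int)
    qed
    show "\<exists>F\<in>compact_entourages X. F O F \<subseteq> E" if E: "E \<in> compact_entourages X" for E
    proof -
      obtain \<epsilon> where \<epsilon>: "\<epsilon> > 0" "\<forall>x\<in>M. \<forall>y\<in>M. d x y < \<epsilon> \<longrightarrow> (x, y) \<in> E"
        using E unfolding ent by blast
      have "(x, z) \<in> E" if "x \<in> M" "y \<in> M" "z \<in> M" "d x y < \<epsilon> / 2" "d y z < \<epsilon> / 2" for x y z
        using triangle[of x y z] \<epsilon>(2) that by auto
      then show ?thesis
        using ball[of "\<epsilon> / 2"] \<epsilon>(1) by (intro bexI[of _ "{(x, y). x \<in> M \<and> y \<in> M \<and> d x y < \<epsilon> / 2}"]) auto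
    qed
  qed
  moreover have "uniform_topology M (compact_entourages X) = X"
    unfolding topology_eq openin_uniform_topology[OF unif]
  proof (intro allI iffI)
    fix U assume U: "openin X U"
    show "uniformly_open M (compact_entourages X) U"
      unfolding uniformly_open_def
    proof (intro conjI ballI)
      show "U \<subseteq> M" using openin_subset[OF U] XM by simp
      fix x assume "x \<in> U"
      then obtain r where r: "r > 0" "mball x r \<subseteq> U"
        using U unfolding Xd openin_mtopology by blast
      then have "{(x, y). x \<in> M \<and> y \<in> M \<and> d x y < r} `` {x} \<subseteq> U" by auto
      then show "\<exists>E\<in>compact_entourages X. E `` {x} \<subseteq> U" using ball[OF r(1)] by blast
    qed
  next
    fix U assume U: "uniformly_open M (compact_entourages X) U"
    show "openin X U"
      unfolding Xd openin_mtopology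
    proof (intro conjI allI impI)
      show UM: "U \<subseteq> M" using U by (simp add: uniformly_open_def)
      fix x assume x: "x \<in> U"
      then obtain E where E: "E \<in> compact_entourages X" "E `` {x} \<subseteq> U"
        using U unfolding uniformly_open_def by blast
      then obtain \<epsilon> where "\<epsilon> > 0" "\<forall>x\<in>M. \<forall>y\<in>M. d x y < \<epsilon> \<longrightarrow> (x, y) \<in> E"
        unfolding ent by blast
      then show "\<exists>r>0. mball x r \<subseteq> U"
        using E(2) x UM by (intro exI[of _ \<epsilon>]) auto
    qed
  qed
  ultimately show ?thesis
    unfolding uniform_space_on_def XM by blast
qed

context finite_regular_cover
begin

text \<open>
  The invariant entourage is the intersection of the finitely many translates.
\<close>

lemma invariant_entourage:
  assumes W: "openin (prod_topology Y Y) W" and diag: "Id_on (topspace Y) \<subseteq> W"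
  obtains F where "openin (prod_topology Y Y) F" "Id_on (topspace Y) \<subseteq> F" "F \<subseteq> W" "sym F"
    "\<And>g u v. g \<in> G \<Longrightarrow> u \<in> topspace Y \<Longrightarrow> v \<in> topspace Y \<Longrightarrow> (g u, g v) \<in> F \<longleftrightarrow> (u, v) \<in> F"
proof -
  define F where "F = {(u, v) \<in> topspace Y \<times> topspace Y. \<forall>g\<in>G. (g u, g v) \<in> W \<and> (g v, g u) \<in> W}"
  define P where "P = (\<lambda>g. {w \<in> topspace (prod_topology Y Y). (g (fst w), g (snd w)) \<in> W}
      \<inter> {w \<in> topspace (prod_topology Y Y). (g (snd w), g (fst w)) \<in> W})"
  have "openin (prod_topology Y Y) (P g)" if "g \<in> G" for g
  proof -
    have "continuous_map (prod_topology Y Y) Y (\<lambda>w. g (fst w))"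
      "continuous_map (prod_topology Y Y) Y (\<lambda>w. g (snd w))"
      using continuous_map_compose[OF continuous_map_fst continuous_act[OF that]]
        continuous_map_compose[OF continuous_map_snd continuous_act[OF that]] by (auto simp: o_def)
    then show ?thesis
      unfolding P_def using W
      by (intro openin_Int openin_continuous_map_preimage[where Y = "prod_topology Y Y"])
        (auto simp: continuous_map_pairwise o_def)
  qed
  then have "openin (prod_topology Y Y) (\<Inter>g\<in>G. P g)"
    using finite_group id_mem by (intro openin_INT2) auto
  moreover have "(\<Inter>g\<in>G. P g) = F"
    using id_mem by (auto simp: P_def F_def)
  ultimately have "openin (prod_topology Y Y) F" by simp
  moreover have "(g u, g v) \<in> F"
    if g: "g \<in> G" and uv: "u \<in> topspace Y" "v \<in> topspace Y" "(u, v) \<in> F" for g u v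
  proof -
    have "(h (g u), h (g v)) \<in> W \<and> (h (g v), h (g u)) \<in> W" if "h \<in> G" for h
    proof -
      have "compose (topspace Y) h g \<in> G" using compose_mem that g by blast
      then show ?thesis
        using uv unfolding F_def by (fastforce simp: compose_eq)
    qed
    then show ?thesis using act_closed[OF g] uv by (simp add: F_def)
  qed
  moreover have "(u, v) \<in> F"
    if g: "g \<in> G" and uv: "u \<in> topspace Y" "v \<in> topspace Y" "(g u, g v) \<in> F" for g u v
  proof -
    obtain h where "h \<in> G" "\<And>y. y \<in> topspace Y \<Longrightarrow> h (g y) = y" using inverse_mem[OF g] by metis
    then show ?thesis
      using calculation(2)[of h "g u" "g v"] uv act_closed[OF g] by simp
  qed
  moreover have "F \<subseteq> W" using id_mem by (force simp: F_def)
  moreover have "Id_on (topspace Y) \<subseteq> F" using diag act_closed by (auto simp: F_def)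
  moreover have "sym F" by (auto simp: F_def sym_def)
  ultimately show ?thesis using that[of F] by blast
qed

text \<open>
  Halving the set of \<open>openin_off_fibres\<close> twice makes room for chains of three steps, as needed
  for the composition of lifted steps. An invariant
  entourage inside the result inherits this property.
\<close>

lemma separating_entourage:
  assumes "metrizable_space Y"
  obtains F where "openin (prod_topology Y Y) F" "Id_on (topspace Y) \<subseteq> F" "sym F"
    "\<And>g u v. g \<in> G \<Longrightarrow> u \<in> topspace Y \<Longrightarrow> v \<in> topspace Y \<Longrightarrow> (g u, g v) \<in> F \<longleftrightarrow> (u, v) \<in> F"
    "\<And>a b c e. (a, b) \<in> F \<Longrightarrow> (b, c) \<in> F \<Longrightarrow> (c, e) \<in> F \<Longrightarrow> f a = f e \<Longrightarrow> a = e"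
proof -
  define N where "N = {(u, v) \<in> topspace Y \<times> topspace Y. f u = f v \<longrightarrow> u = v}"
  have "\<forall>E\<in>compact_entourages Y. \<exists>D\<in>compact_entourages Y. D O D \<subseteq> E"
    using uniform_space_on_compact_entourages[OF compact assms]
    unfolding uniform_space_on_def uniformity_on_def by (elim conjE)
  then have half: "\<exists>D\<in>compact_entourages Y. D O D \<subseteq> E" if "E \<in> compact_entourages Y" for E
    using that by (rule bspec)
  have "sym N" "Id_on (topspace Y) \<subseteq> N" "N \<subseteq> topspace Y \<times> topspace Y"
    unfolding sym_def N_def by (fastforce, blast, blast)
  moreover have "openin (prod_topology Y Y) N"
    unfolding N_def by (rule openin_off_fibres)
  ultimately have "N \<in> compact_entourages Y"
    by (auto simp: compact_entourages_def)
  then obtain E where E: "E \<in> compact_entourages Y" "E O E \<subseteq> N"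
    using half[of N] by blast
  then obtain D where D: "D \<in> compact_entourages Y" "D O D \<subseteq> E"
    using half[of E] by blast
  then obtain W where W: "openin (prod_topology Y Y) W" "Id_on (topspace Y) \<subseteq> W" "W \<subseteq> D"
    unfolding compact_entourages_def by blast
  obtain F where F: "openin (prod_topology Y Y) F" "Id_on (topspace Y) \<subseteq> F" "F \<subseteq> W" "sym F"
    "\<And>g u v. g \<in> G \<Longrightarrow> u \<in> topspace Y \<Longrightarrow> v \<in> topspace Y \<Longrightarrow> (g u, g v) \<in> F \<longleftrightarrow> (u, v) \<in> F"
    using invariant_entourage[OF W(1,2)] by metis
  have "a = e" if "(a, b) \<in> F" "(b, c) \<in> F" "(c, e) \<in> F" "f a = f e" for a b c e
  proof -
    have "(a, b) \<in> D" "(b, c) \<in> D" "(c, e) \<in> D" using that F(3) W(3) by blast+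
    moreover have "(e, e) \<in> D"
      using \<open>(c, e) \<in> F\<close> openin_prod_subset[OF F(1)] W(2,3) by blast
    ultimately have "(a, e) \<in> N" using D(2) E(2) by blast
    then show ?thesis using that by (simp add: N_def)
  qed
  then show ?thesis using that F by blast
qed

end

section \<open>A continuum has only countably many covers\<close>

text \<open>
  Points of \<open>Y\<close> can be transported along steps of length less than \<open>\<epsilon>\<close> in the base, with \<open>F\<close>
  recording the lifted steps: lifted steps exist and are unique, and two of them compose to a third
  one whenever their end points in the base are close enough.
\<close>

definition lifts_short_steps ::
  "('a \<Rightarrow> 'a \<Rightarrow> real) \<Rightarrow> 'b topology \<Rightarrow> ('b \<Rightarrow> 'a) \<Rightarrow> ('b \<times> 'b) set \<Rightarrow> real \<Rightarrow> bool" where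
  "lifts_short_steps d Y f F \<epsilon> \<longleftrightarrow>
     openin (prod_topology Y Y) F \<and> Id_on (topspace Y) \<subseteq> F \<and> sym F \<and>
     (\<forall>y\<in>topspace Y. \<forall>x\<in>f ` topspace Y. d (f y) x < \<epsilon> \<longrightarrow> (\<exists>z\<in>topspace Y. f z = x \<and> (y, z) \<in> F)) \<and>
     (\<forall>u v w. (u, v) \<in> F \<longrightarrow> (u, w) \<in> F \<longrightarrow> f v = f w \<longrightarrow> v = w) \<and>
     (\<forall>u v w. (u, v) \<in> F \<longrightarrow> (v, w) \<in> F \<longrightarrow> d (f u) (f w) < \<epsilon> \<longrightarrow> (u, w) \<in> F)"

lemma lifts_short_stepsD:
  assumes "lifts_short_steps d Y f F \<epsilon>"
  shows "openin (prod_topology Y Y) F" "Id_on (topspace Y) \<subseteq> F" "(u, v) \<in> F \<Longrightarrow> (v, u) \<in> F"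
    "y \<in> topspace Y \<Longrightarrow> x \<in> f ` topspace Y \<Longrightarrow> d (f y) x < \<epsilon> \<Longrightarrow> \<exists>z\<in>topspace Y. f z = x \<and> (y, z) \<in> F"
    "(u, v) \<in> F \<Longrightarrow> (u, w) \<in> F \<Longrightarrow> f v = f w \<Longrightarrow> v = w"
    "(u, v) \<in> F \<Longrightarrow> (v, w) \<in> F \<Longrightarrow> d (f u) (f w) < \<epsilon> \<Longrightarrow> (u, w) \<in> F"
  using assms unfolding lifts_short_steps_def by (blast dest: symD)+

text \<open>
  A separating entourage lifts short steps: its image in the base contains a metric entourage, and
  its invariance allows a lifted step to be moved to any point of the fibre.
\<close>

lemma (in finite_regular_cover) short_lifts:
  assumes Y: "metrizable_space Y" and M: "Metric_space M d" and X: "X = Metric_space.mtopology M d"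
  shows "\<exists>F \<epsilon>. \<epsilon> > 0 \<and> lifts_short_steps d Y f F \<epsilon>"
proof -
  interpret Metric_space M d by fact
  have XM: "topspace X = M" by (simp add: X)
  obtain F where F: "openin (prod_topology Y Y) F" "Id_on (topspace Y) \<subseteq> F" "sym F"
    "\<And>g u v. g \<in> G \<Longrightarrow> u \<in> topspace Y \<Longrightarrow> v \<in> topspace Y \<Longrightarrow> (g u, g v) \<in> F \<longleftrightarrow> (u, v) \<in> F"
    "\<And>a b c e. (a, b) \<in> F \<Longrightarrow> (b, c) \<in> F \<Longrightarrow> (c, e) \<in> F \<Longrightarrow> f a = f e \<Longrightarrow> a = e"
    using separating_entourage[OF Y] by metis
  have FY: "a \<in> topspace Y" "b \<in> topspace Y" if "(a, b) \<in> F" for a b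
    using openin_prod_subset[OF F(1)] that by blast+
  have Fsym: "(b, a) \<in> F" if "(a, b) \<in> F" for a b
    using F(3) that by (meson symD)
  have "openin (prod_topology X X) (map_prod f f ` F)"
    using open_map_prod_image open_map F(1) by blast
  moreover have "Id_on M \<subseteq> map_prod f f ` F"
  proof -
    have "(x, x) \<in> map_prod f f ` F" if x: "x \<in> M" for x
    proof -
      obtain y where y: "y \<in> topspace Y" "x = f y" using x XM surj by (metis imageE)
      then have "(y, y) \<in> F" using F(2) by blast
      then show ?thesis using y by (metis map_prod_imageI)
    qed
    then show ?thesis by auto
  qed
  moreover have "compact_space X"
    using compact cont surj image_compactin[of Y "topspace Y" X f] by (simp add: compact_space_def)
  ultimately obtain \<epsilon> where \<epsilon>: "\<epsilon> > 0" "\<And>x y. x \<in> M \<Longrightarrow> y \<in> M \<Longrightarrow> d x y < \<epsilon> \<Longrightarrow> (x, y) \<in> map_prod f f ` F"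
    using metric_entourage_below[of "map_prod f f ` F"] unfolding X by blast
  have ex: "\<exists>z\<in>topspace Y. f z = x \<and> (y, z) \<in> F" if y: "y \<in> topspace Y" and x: "x \<in> topspace X" "d (f y) x < \<epsilon>" for y x
  proof -
    have "(f y, x) \<in> map_prod f f ` F"
      using \<epsilon>(2) cover_closed[OF y] x XM by blast
    then obtain a b where ab: "(a, b) \<in> F" "f a = f y" "f b = x" by auto
    obtain g where g: "g \<in> G" "y = g a" using same_fibre[of a y] FY[OF ab(1)] ab(2) y by blast
    have "(y, g b) \<in> F" using F(4)[OF g(1) FY[OF ab(1)]] ab(1) g(2) by simp
    moreover have "f (g b) = x" using cover_act[OF g(1)] FY(2)[OF ab(1)] ab(3) by simp
    ultimately show ?thesis using FY by blast
  qed
  have uniq: "v = w" if "(u, v) \<in> F" "(u, w) \<in> F" "f v = f w" for u v w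
  proof -
    have "(w, w) \<in> F" using FY(2)[OF that(2)] F(2) by blast
    then show ?thesis using F(5)[OF Fsym[OF that(1)] that(2)] that(3) by blast
  qed
  have trans: "(u, w) \<in> F" if uvw: "(u, v) \<in> F" "(v, w) \<in> F" "d (f u) (f w) < \<epsilon>" for u v w
  proof -
    obtain z where z: "f z = f w" "(u, z) \<in> F"
      using ex[of u "f w"] FY[OF uvw(1)] FY[OF uvw(2)] cover_closed uvw(3) by blast
    have "z = w" using F(5)[OF Fsym[OF z(2)] uvw(1,2)] z(1) by blast
    then show ?thesis using z(2) by simp
  qed
  have "lifts_short_steps d Y f F \<epsilon>"
    unfolding lifts_short_steps_def surj using F(1-3) ex uniq trans by blast
  then show ?thesis using \<epsilon>(1) by blast
qed

text \<open>
  Points \<open>y\<close>, \<open>z\<close> over the same point of \<open>X\<close> correspond to each other if short steps lead from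
  them to points over the net \<open>N\<close> that are matched by \<open>\<beta>\<close>.
\<close>

definition net_correspondence ::
  "'b topology \<Rightarrow> ('b \<Rightarrow> 'a) \<Rightarrow> ('b \<times> 'b) set \<Rightarrow> 'c topology \<Rightarrow> ('c \<Rightarrow> 'a) \<Rightarrow> ('c \<times> 'c) set \<Rightarrow>
   ('a \<Rightarrow> 'a \<Rightarrow> real) \<Rightarrow> real \<Rightarrow> 'b set \<Rightarrow> ('b \<Rightarrow> 'c) \<Rightarrow> ('b \<times> 'c) set" where
  "net_correspondence Y f F Z k E d r A \<beta> =
     {(y, z). y \<in> topspace Y \<and> z \<in> topspace Z \<and> f y = k z \<and>
        (\<exists>a\<in>A. d (f a) (f y) < r \<and> (y, a) \<in> F \<and> (z, \<beta> a) \<in> E)}"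

text \<open>
  Existence: step to a nearby point over the net, pass to the other cover by \<open>\<beta>\<close> and step back over
  the starting point. Uniqueness: two such points over the net are joined by a short step, so their
  images under \<open>\<beta>\<close> are joined too. The bound \<open>2 * r\<close> is the distance of two net points near a common
  point.
\<close>

lemma net_correspondence_function:
  assumes "Metric_space M d" and f: "f ` topspace Y = M" and k: "k ` topspace Z = M"
    and r: "2 * r \<le> \<epsilon>" "2 * r \<le> \<delta>" "r > 0"
    and F: "lifts_short_steps d Y f F \<epsilon>" and E: "lifts_short_steps d Z k E \<delta>"
    and N: "N \<subseteq> M" "\<And>x. x \<in> M \<Longrightarrow> \<exists>p\<in>N. d p x < r"
    and A: "A = {a \<in> topspace Y. f a \<in> N}"
    and \<beta>: "\<And>a. a \<in> A \<Longrightarrow> \<beta> a \<in> topspace Z \<and> k (\<beta> a) = f a"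
    and \<beta>F: "\<And>a b. a \<in> A \<Longrightarrow> b \<in> A \<Longrightarrow> (a, b) \<in> F \<Longrightarrow> (\<beta> a, \<beta> b) \<in> E"
    and y: "y \<in> topspace Y"
  shows "\<exists>!z. (y, z) \<in> net_correspondence Y f F Z k E d r A \<beta>"
proof -
  interpret Metric_space M d by fact
  have fy: "f y \<in> M" using f y by blast
  obtain p where p: "p \<in> N" "d p (f y) < r" using N(2)[OF fy] by blast
  have pM: "p \<in> M" using N(1) p(1) by blast
  obtain a where a: "a \<in> topspace Y" "f a = p" "(y, a) \<in> F"
    using lifts_short_stepsD(4)[OF F y, of p] f pM p(2) r commute[of p "f y"] by auto
  have aA: "a \<in> A" using a p A by simp
  obtain z where z: "z \<in> topspace Z" "k z = f y" "(\<beta> a, z) \<in> E"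
    using lifts_short_stepsD(4)[OF E, of "\<beta> a" "f y"] \<beta>[OF aA] k fy p(2) r a(2) by auto
  have "(y, z) \<in> net_correspondence Y f F Z k E d r A \<beta>"
    unfolding net_correspondence_def using y z a aA p(2) lifts_short_stepsD(3)[OF E z(3)] by auto
  moreover have "z' = z" if z': "(y, z') \<in> net_correspondence Y f F Z k E d r A \<beta>" for z'
  proof -
    obtain b where b: "b \<in> A" "d (f b) (f y) < r" "(y, b) \<in> F" "(z', \<beta> b) \<in> E" "k z' = f y"
      using z' unfolding net_correspondence_def mem_Collect_eq case_prod_conv by metis
    have fM: "f a \<in> M" "f b \<in> M" using b(1) aA A f by auto
    have "d (f a) (f b) \<le> d (f a) (f y) + d (f b) (f y)"
      using triangle[of "f a" "f y" "f b"] fM fy commute by simp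
    then have "d (f a) (f b) < \<epsilon>" using b(2) p(2) a(2) r by simp
    then have "(a, b) \<in> F" using lifts_short_stepsD(6)[OF F lifts_short_stepsD(3)[OF F a(3)] b(3)] by blast
    then have "(\<beta> a, \<beta> b) \<in> E" using \<beta>F aA b(1) by blast
    moreover have "d (k (\<beta> a)) (k z') < \<delta>"
      using \<beta>[OF aA] b(5) a(2) p(2) r by simp
    ultimately have "(\<beta> a, z') \<in> E" using lifts_short_stepsD(6)[OF E _ lifts_short_stepsD(3)[OF E b(4)]] by blast
    then show "z' = z" using lifts_short_stepsD(5)[OF E _ z(3)] b(5) z(2) by simp
  qed
  ultimately show ?thesis by blast
qed

text \<open>
  By symmetry the correspondence is the graph of a bijection. Its continuity in both directions
  follows from compactness once the graph is closed, and the graph is even clopen in the fibre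
  product.
\<close>

lemma (in two_covers) homeomorphic_of_equal_nets:
  assumes M: "Metric_space M d" and X: "X = Metric_space.mtopology M d"
    and r: "2 * r \<le> \<epsilon>" "2 * r \<le> \<delta>" "r > 0"
    and F: "lifts_short_steps d Y f F \<epsilon>" and E: "lifts_short_steps d Z k E \<delta>"
    and N: "N \<subseteq> topspace X" "\<And>x. x \<in> topspace X \<Longrightarrow> \<exists>p\<in>N. d p x < r"
    and \<beta>: "bij_betw \<beta> {a \<in> topspace Y. f a \<in> N} {b \<in> topspace Z. k b \<in> N}"
    and \<beta>k: "\<And>a. a \<in> topspace Y \<Longrightarrow> f a \<in> N \<Longrightarrow> k (\<beta> a) = f a"
    and \<beta>F: "\<And>a b. a \<in> topspace Y \<Longrightarrow> f a \<in> N \<Longrightarrow> b \<in> topspace Y \<Longrightarrow> f b \<in> N \<Longrightarrow>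
        (a, b) \<in> F \<longleftrightarrow> (\<beta> a, \<beta> b) \<in> E"
  shows "\<exists>h. homeomorphic_map Y Z h \<and> (\<forall>y\<in>topspace Y. k (h y) = f y)"
proof -
  interpret Metric_space M d by fact
  have XM: "topspace X = M" by (simp add: X)
  have onto: "f ` topspace Y = M" "k ` topspace Z = M" using first.surj second.surj XM by simp_all
  define A where "A = {a \<in> topspace Y. f a \<in> N}"
  define B where "B = {b \<in> topspace Z. k b \<in> N}"
  define \<gamma> where "\<gamma> = inv_into A \<beta>"
  have bij: "bij_betw \<beta> A B" using \<beta> by (simp add: A_def B_def)
  have \<beta>B: "\<beta> a \<in> B" if "a \<in> A" for a using bij that by (auto simp: bij_betw_def)
  have \<gamma>A: "\<gamma> b \<in> A" "\<beta> (\<gamma> b) = b" if "b \<in> B" for b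
    using bij that by (auto simp: \<gamma>_def bij_betw_def inv_into_into f_inv_into_f)
  have \<gamma>\<beta>: "\<gamma> (\<beta> a) = a" if "a \<in> A" for a
    using bij that by (simp add: \<gamma>_def bij_betw_def)
  have \<gamma>f: "f (\<gamma> b) = k b" if "b \<in> B" for b
    using \<gamma>A[OF that] \<beta>k[of "\<gamma> b"] by (simp add: A_def)
  define \<Gamma> where "\<Gamma> = net_correspondence Y f F Z k E d r A \<beta>"
  have "\<exists>!z. (y, z) \<in> \<Gamma>" if "y \<in> topspace Y" for y
    unfolding \<Gamma>_def
  proof (rule net_correspondence_function[OF M onto r F E _ _ A_def _ _ that])
    show "\<beta> a \<in> topspace Z \<and> k (\<beta> a) = f a" if "a \<in> A" for a
      using \<beta>B[OF that] \<beta>k[of a] that by (auto simp: A_def B_def)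
    show "(\<beta> a, \<beta> b) \<in> E" if "a \<in> A" "b \<in> A" "(a, b) \<in> F" for a b
      using \<beta>F[of a b] that by (auto simp: A_def)
  qed (use N XM in auto)
  moreover have swap: "(z, y) \<in> net_correspondence Z k E Y f F d r B \<gamma> \<longleftrightarrow> (y, z) \<in> \<Gamma>" for y z
  proof -
    have "(\<exists>b\<in>B. d (k b) (f y) < r \<and> (z, b) \<in> E \<and> (y, \<gamma> b) \<in> F) \<longleftrightarrow>
        (\<exists>a\<in>A. d (f a) (f y) < r \<and> (y, a) \<in> F \<and> (z, \<beta> a) \<in> E)"
      using \<beta>B \<gamma>A \<gamma>\<beta> \<gamma>f by metis
    then show ?thesis
      unfolding \<Gamma>_def net_correspondence_def by auto
  qed
  have "\<exists>!y. (z, y) \<in> net_correspondence Z k E Y f F d r B \<gamma>" if "z \<in> topspace Z" for z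
  proof (rule net_correspondence_function[OF M onto(2,1) r(2,1,3) E F _ _ B_def _ _ that])
    show "\<gamma> b \<in> topspace Y \<and> f (\<gamma> b) = k b" if "b \<in> B" for b
      using \<gamma>A[OF that] \<gamma>f[OF that] by (auto simp: A_def)
    show "(\<gamma> a, \<gamma> b) \<in> F" if "a \<in> B" "b \<in> B" "(a, b) \<in> E" for a b
      using \<beta>F[of "\<gamma> a" "\<gamma> b"] \<gamma>A[of a] \<gamma>A[of b] that by (auto simp: A_def)
  qed (use N XM in auto)
  ultimately have fun1: "\<And>y. y \<in> topspace Y \<Longrightarrow> \<exists>!z. (y, z) \<in> \<Gamma>"
    and fun2: "\<And>z. z \<in> topspace Z \<Longrightarrow> \<exists>!y. (y, z) \<in> \<Gamma>"
    by (auto simp: swap)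
  have S: "(y, z) \<in> fibre_product \<longleftrightarrow> y \<in> topspace Y \<and> z \<in> topspace Z \<and> f y = k z" for y z
    by (simp add: mem_fibre_product)
  have \<Gamma>S: "\<Gamma> \<subseteq> fibre_product" by (auto simp: S \<Gamma>_def net_correspondence_def)
  have \<Gamma>_open: "openin (subtopology YZ fibre_product) \<Gamma>"
  proof -
    define R where "R = (\<lambda>a. ({y \<in> topspace Y. f y \<in> mball (f a) r} \<inter> {y. (y, a) \<in> F}) \<times> {z. (z, \<beta> a) \<in> E})"
    have "openin YZ (R a)" if "a \<in> A" for a
      unfolding R_def openin_prod_Times_iff
      using openin_continuous_map_preimage[OF first.cont, of "mball (f a) r"]
        openin_prod_slices(2)[OF lifts_short_stepsD(1)[OF F]] openin_prod_slices(2)[OF lifts_short_stepsD(1)[OF E]]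
      by (auto simp: X intro!: openin_Int)
    then have "openin YZ (\<Union>a\<in>A. R a)" by auto
    moreover have "\<Gamma> = fibre_product \<inter> (\<Union>a\<in>A. R a)"
      using first.cover_closed XM by (auto simp: R_def \<Gamma>_def net_correspondence_def S A_def)
    ultimately show ?thesis by (simp add: openin_subtopology_Int2)
  qed
  \<comment> \<open>The translates of \<open>\<Gamma>\<close> under deck transformations of \<open>Z\<close> are open and partition the fibre product.\<close>
  define T where "T = (\<lambda>h. {c \<in> topspace (subtopology YZ fibre_product). (fst c, h (snd c)) \<in> \<Gamma>})"
  have "openin (subtopology YZ fibre_product) (T h)" if h: "h \<in> H" for h
    unfolding T_def
  proof (rule openin_continuous_map_preimage[OF _ \<Gamma>_open])
    have "continuous_map YZ YZ (\<lambda>c. (fst c, h (snd c)))"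
      using continuous_map_fst continuous_map_compose[OF continuous_map_snd[of Y Z] second.continuous_act[OF h]]
      unfolding continuous_map_pairwise by (simp add: o_def)
    then show "continuous_map (subtopology YZ fibre_product) (subtopology YZ fibre_product) (\<lambda>c. (fst c, h (snd c)))"
      using second.act_closed[OF h] second.cover_act[OF h]
      by (intro continuous_map_into_subtopology continuous_map_from_subtopology) (auto simp: S)
  qed
  then have "openin (subtopology YZ fibre_product) (\<Union>h\<in>H - {\<lambda>z\<in>topspace Z. z}. T h)"
    by auto
  moreover have "fibre_product - \<Gamma> = (\<Union>h\<in>H - {\<lambda>z\<in>topspace Z. z}. T h)"
  proof (intro equalityI subsetI)
    fix c assume c: "c \<in> fibre_product - \<Gamma>"
    obtain y z where yz: "c = (y, z)" by (cases c)
    then obtain z' where z': "(y, z') \<in> \<Gamma>" using fun1[of y] c S by blast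
    then obtain h where h: "h \<in> H" "z' = h z"
      using second.same_fibre[of z z'] c yz \<Gamma>S S by (metis DiffD1 subsetD)
    have "h \<noteq> (\<lambda>z\<in>topspace Z. z)"
      using c z' h yz S by auto
    then show "c \<in> (\<Union>h\<in>H - {\<lambda>z\<in>topspace Z. z}. T h)"
      using h z' c yz fibre_product_subset by (auto simp: T_def)
  next
    fix c assume "c \<in> (\<Union>h\<in>H - {\<lambda>z\<in>topspace Z. z}. T h)"
    then obtain h y z where h: "h \<in> H" "h \<noteq> (\<lambda>z\<in>topspace Z. z)" "c = (y, z)" "(y, z) \<in> fibre_product" "(y, h z) \<in> \<Gamma>"
      by (cases c) (auto simp: T_def)
    have "(y, z) \<notin> \<Gamma>"
      using fun1[of y] second.fixed_point[OF h(1), of z] h S by metis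
    then show "c \<in> fibre_product - \<Gamma>" using h by simp
  qed
  ultimately have "openin (subtopology YZ fibre_product) (fibre_product - \<Gamma>)" by simp
  then have "closedin (subtopology YZ fibre_product) \<Gamma>"
    using \<Gamma>S fibre_product_subset by (simp add: closedin_def inf.absorb2)
  then have \<Gamma>_closed: "closedin YZ \<Gamma>"
    using closedin_fibre_product closedin_trans_full by blast
  define W where "W = subtopology YZ \<Gamma>"
  have topW: "topspace W = \<Gamma>" using \<Gamma>S fibre_product_subset by (auto simp: W_def)
  have W_compact: "compact_space W"
    using compact_YZ \<Gamma>_closed closedin_compact_space compact_space_subtopology unfolding W_def by blast
  have \<Gamma>Y: "y \<in> topspace Y" "z \<in> topspace Z" "f y = k z" if "(y, z) \<in> \<Gamma>" for y z
    using \<Gamma>S S that by blast+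
  have "homeomorphic_map W Y fst"
  proof (rule continuous_imp_homeomorphic_map[OF _ W_compact first.Hausdorff])
    show "continuous_map W Y fst" using continuous_map_fst continuous_map_from_subtopology unfolding W_def by blast
    show "fst ` topspace W = topspace Y"
      unfolding topW using fun1 \<Gamma>Y by (auto simp: image_iff) (metis fst_conv)
    show "inj_on fst (topspace W)"
      unfolding topW inj_on_def using fun1 \<Gamma>Y by (metis prod.collapse)
  qed
  then obtain j where j: "homeomorphic_maps W Y fst j"
    using homeomorphic_map_maps by blast
  then have jh: "homeomorphic_map Y W j" using homeomorphic_maps_map by blast
  have "homeomorphic_map W Z snd"
  proof (rule continuous_imp_homeomorphic_map[OF _ W_compact second.Hausdorff])
    show "continuous_map W Z snd" using continuous_map_snd continuous_map_from_subtopology unfolding W_def by blast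
    show "snd ` topspace W = topspace Z"
      unfolding topW using fun2 \<Gamma>Y by (auto simp: image_iff) (metis snd_conv)
    show "inj_on snd (topspace W)"
      unfolding topW inj_on_def using fun2 \<Gamma>Y by (metis prod.collapse)
  qed
  then have "homeomorphic_map Y Z (snd \<circ> j)"
    using jh homeomorphic_map_compose by blast
  moreover have "k ((snd \<circ> j) y) = f y" if "y \<in> topspace Y" for y
  proof -
    have "j y \<in> \<Gamma>" using homeomorphic_imp_surjective_map[OF jh] topW that by blast
    moreover have "fst (j y) = y" using j that by (simp add: homeomorphic_maps_def)
    ultimately show ?thesis using \<Gamma>Y(3)[of y "snd (j y)"] by (metis comp_apply prod.collapse)
  qed
  ultimately show ?thesis by blast
qed


text \<open>
  A cover is determined up to equivalence by a combinatorial code: a net in \<open>X\<close> that is finer than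
  the length of the steps that can be lifted, and the finite relation of being joined by a lifted
  step on the points over the net, labelled by their images and by natural numbers. There are only
  countably many such codes.
\<close>

proposition countable_covers:
  fixes X :: "'a topology" and Xs :: "'i \<Rightarrow> 'b topology"
  assumes X: "compact_space X" "metrizable_space X"
    and cover: "\<And>i. i \<in> I \<Longrightarrow> finite_regular_cover X (Xs i) (Gs i) (fs i)"
    and metrizable: "\<And>i. i \<in> I \<Longrightarrow> metrizable_space (Xs i)"
    and inequivalent: "\<And>i j. i \<in> I \<Longrightarrow> j \<in> I \<Longrightarrow>
      equivalent_covers (Xs i) (Gs i) (fs i) (Xs j) (Gs j) (fs j) \<Longrightarrow> i = j"
  shows "countable I"
proof -
  obtain M d where M: "Metric_space M d" and Xd: "X = Metric_space.mtopology M d"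
    using X(2) unfolding metrizable_space_def by blast
  interpret Metric_space M d by fact
  have XM: "topspace X = M" by (simp add: Xd)
  define r where "r = (\<lambda>m::nat. 1 / real (Suc m))"
  have r_pos: "r m > 0" for m by (simp add: r_def)
  have "\<exists>N. finite N \<and> N \<subseteq> M \<and> M \<subseteq> (\<Union>p\<in>N. mball p (r m))" for m
    using compactin_imp_mtotally_bounded[of M] X(1) r_pos[of m]
    unfolding Xd compact_space_def mtotally_bounded_def by auto
  then obtain N where N: "\<And>m. finite (N m)" "\<And>m. N m \<subseteq> M" "\<And>m. M \<subseteq> (\<Union>p\<in>N m. mball p (r m))"
    by metis
  have N_dense: "\<exists>p\<in>N m. d p x < r m" if x: "x \<in> M" for m x
  proof -
    have "x \<in> (\<Union>p\<in>N m. mball p (r m))" using N(3) x by (rule subsetD)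
    then show ?thesis by (auto simp del: UN_simps)
  qed
  have "\<exists>F m \<epsilon>. lifts_short_steps d (Xs i) (fs i) F \<epsilon> \<and> 2 * r m \<le> \<epsilon>" if i: "i \<in> I" for i
  proof -
    obtain F \<epsilon> where F: "lifts_short_steps d (Xs i) (fs i) F \<epsilon>" and \<epsilon>: "\<epsilon> > 0"
      using finite_regular_cover.short_lifts[OF cover[OF i] metrizable[OF i] M Xd] by blast
    obtain m where "inverse (real (Suc m)) < \<epsilon> / 2"
      using reals_Archimedean[of "\<epsilon> / 2"] \<epsilon> by auto
    then have "2 * r m \<le> \<epsilon>" by (simp add: r_def inverse_eq_divide)
    then show ?thesis using F by blast
  qed
  then obtain F m \<epsilon> where F: "\<And>i. i \<in> I \<Longrightarrow> lifts_short_steps d (Xs i) (fs i) (F i) (\<epsilon> i)"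
    and m: "\<And>i. i \<in> I \<Longrightarrow> 2 * r (m i) \<le> \<epsilon> i"
    by metis
  define A where "A = (\<lambda>i. {a \<in> topspace (Xs i). fs i a \<in> N (m i)})"
  have finA: "finite (A i)" if i: "i \<in> I" for i
  proof -
    interpret finite_regular_cover X "Xs i" "Gs i" "fs i" using cover[OF i] .
    have "finite {a \<in> topspace (Xs i). fs i a = p}" for p
    proof (cases "p \<in> fs i ` topspace (Xs i)")
      case True
      then show ?thesis using finite_fibre by auto
    next
      case False
      then have "{a \<in> topspace (Xs i). fs i a = p} = {}" by blast
      then show ?thesis by (metis finite.emptyI)
    qed
    then have "finite (\<Union>p\<in>N (m i). {a \<in> topspace (Xs i). fs i a = p})"
      using N(1) by blast
    moreover have "A i = (\<Union>p\<in>N (m i). {a \<in> topspace (Xs i). fs i a = p})"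
      by (auto simp: A_def)
    ultimately show ?thesis by simp
  qed
  have "\<exists>l :: 'b \<Rightarrow> nat. inj_on l (A i)" if "i \<in> I" for i
    using finite_imp_inj_to_nat_seg[OF finA[OF that]] by metis
  then obtain l :: "'i \<Rightarrow> 'b \<Rightarrow> nat" where l: "\<And>i. i \<in> I \<Longrightarrow> inj_on (l i) (A i)"
    by metis
  define \<tau> where "\<tau> = (\<lambda>i a. (fs i a, l i a))"
  have \<tau>: "inj_on (\<tau> i) (A i)" if "i \<in> I" for i
    using l[OF that] by (auto simp: \<tau>_def inj_on_def)
  define code where "code = (\<lambda>i. (m i, map_prod (\<tau> i) (\<tau> i) ` (F i \<inter> A i \<times> A i)))"
  have code_iff: "(\<tau> i a, \<tau> i b) \<in> snd (code i) \<longleftrightarrow> (a, b) \<in> F i" if "i \<in> I" "a \<in> A i" "b \<in> A i" for i a b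
    using inj_onD[OF \<tau>[OF that(1)]] that by (auto simp: code_def)
  have code_Domain: "Domain (snd (code i)) = \<tau> i ` A i" if i: "i \<in> I" for i
  proof
    show "Domain (snd (code i)) \<subseteq> \<tau> i ` A i" by (auto simp: code_def)
    have "Id_on (topspace (Xs i)) \<subseteq> F i" using lifts_short_stepsD(2)[OF F[OF i]] .
    then have "(a, a) \<in> F i" if "a \<in> A i" for a using that by (auto simp: A_def)
    then show "\<tau> i ` A i \<subseteq> Domain (snd (code i))"
      using code_iff[OF i] by blast
  qed
  have "i = j" if i: "i \<in> I" and j: "j \<in> I" and eq: "code i = code j" for i j
  proof -
    have mm: "m i = m j" using eq by (simp add: code_def)
    have img: "\<tau> i ` A i = \<tau> j ` A j" using code_Domain i j eq by metis
    define \<beta> where "\<beta> = inv_into (A j) (\<tau> j) \<circ> \<tau> i"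
    have \<tau>\<beta>: "\<beta> a \<in> A j" "\<tau> j (\<beta> a) = \<tau> i a" if "a \<in> A i" for a
    proof -
      have "\<tau> i a \<in> \<tau> j ` A j" using that img by blast
      then show "\<beta> a \<in> A j" "\<tau> j (\<beta> a) = \<tau> i a"
        unfolding \<beta>_def by (simp_all add: inv_into_into f_inv_into_f)
    qed
    have "bij_betw (inv_into (A j) (\<tau> j)) (\<tau> j ` A j) (A j)"
      using \<tau>[OF j] by (simp add: bij_betw_inv_into inj_on_imp_bij_betw)
    moreover have "bij_betw (\<tau> i) (A i) (\<tau> j ` A j)"
      using \<tau>[OF i] img by (simp add: bij_betw_def)
    ultimately have bij: "bij_betw \<beta> (A i) (A j)"
      unfolding \<beta>_def using bij_betw_trans by blast
    have "two_covers X (Xs i) (Gs i) (fs i) (Xs j) (Gs j) (fs j)"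
      using cover i j by (simp add: two_covers_def)
    then
    have "\<exists>h. homeomorphic_map (Xs i) (Xs j) h \<and> (\<forall>y\<in>topspace (Xs i). fs j (h y) = fs i y)"
    proof (rule two_covers.homeomorphic_of_equal_nets[OF _ M Xd m[OF i] _ r_pos F[OF i] F[OF j],
          where N = "N (m i)" and \<beta> = \<beta>])
      show "2 * r (m i) \<le> \<epsilon> j" using m[OF j] mm by simp
      show "bij_betw \<beta> {a \<in> topspace (Xs i). fs i a \<in> N (m i)} {b \<in> topspace (Xs j). fs j b \<in> N (m i)}"
        using bij by (simp add: A_def mm)
      show "fs j (\<beta> a) = fs i a" if "a \<in> topspace (Xs i)" "fs i a \<in> N (m i)" for a
        using \<tau>\<beta>(2)[of a] that by (simp add: \<tau>_def A_def)
      show "(a, b) \<in> F i \<longleftrightarrow> (\<beta> a, \<beta> b) \<in> F j"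
        if "a \<in> topspace (Xs i)" "fs i a \<in> N (m i)" "b \<in> topspace (Xs i)" "fs i b \<in> N (m i)" for a b
      proof -
        have ab: "a \<in> A i" "b \<in> A i" using that by (auto simp: A_def)
        then show ?thesis
          using code_iff[OF i ab] code_iff[OF j \<tau>\<beta>(1)[OF ab(1)] \<tau>\<beta>(1)[OF ab(2)]] \<tau>\<beta>(2) eq by simp
      qed
      show "N (m i) \<subseteq> topspace X" "\<And>x. x \<in> topspace X \<Longrightarrow> \<exists>p\<in>N (m i). d p x < r (m i)"
        using N(2) N_dense XM by auto
    qed
    then show ?thesis
      using equivalent_covers_homeomorphic[OF cover[OF i] cover[OF j]] inequivalent[OF i j] by blast
  qed
  then have "inj_on code I" by (auto simp: inj_on_def)
  moreover have "code ` I \<subseteq> UNIV \<times> {R. finite R \<and> R \<subseteq> ((\<Union>m. N m) \<times> UNIV) \<times> ((\<Union>m. N m) \<times> UNIV)}"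
    using finA by (auto simp: code_def \<tau>_def A_def)
  moreover have "countable (\<Union>m. N m)" using N(1) by (simp add: countable_finite)
  then have "countable ((UNIV :: nat set) \<times> {R. finite R \<and> R \<subseteq> ((\<Union>m. N m) \<times> (UNIV :: nat set)) \<times> ((\<Union>m. N m) \<times> (UNIV :: nat set))})"
    by (intro countable_SIGMA countable_Collect_finite_subset) auto
  ultimately show ?thesis
    by (meson countable_image_inj_on countable_subset)
qed

section \<open>Inverse limits of compact spaces\<close>

lemma directed_on_finite_upper_bound:
  assumes "directed_on I rel" "finite J" "J \<subseteq> I"
  shows "\<exists>k\<in>I. \<forall>j\<in>J. rel j k"
  using assms(2,3)
proof (induction J rule: finite_induct)
  case empty
  then show ?case using assms(1) by (auto simp: directed_on_def)
next
  case (insert i J)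
  then obtain k where k: "k \<in> I" "\<forall>j\<in>J. rel j k" by auto
  obtain l where l: "l \<in> I" "rel i l" "rel k l"
    using assms(1) insert.prems k(1) unfolding directed_on_def by blast
  have "rel j l" if "j \<in> J" for j
    using assms(1) insert.prems k l that unfolding directed_on_def transp_on_def by blast
  then show ?case using l by blast
qed

text \<open>
  The finite intersection property, in the form in which it is used for inverse limits.
\<close>

lemma compact_directed_closed:
  assumes X: "compact_space X" and I: "directed_on I rel"
    and C: "\<And>i. i \<in> I \<Longrightarrow> closedin X (C i)"
    and anti: "\<And>i j. i \<in> I \<Longrightarrow> j \<in> I \<Longrightarrow> rel i j \<Longrightarrow> C j \<subseteq> C i"
    and W: "openin X W" "(\<Inter>i\<in>I. C i) \<subseteq> W"
  shows "\<exists>i\<in>I. C i \<subseteq> W"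
proof (rule ccontr)
  assume not: "\<not> (\<exists>i\<in>I. C i \<subseteq> W)"
  have I_ne: "I \<noteq> {}" using I by (simp add: directed_on_def)
  have "\<Inter>\<F> \<noteq> {}" if \<F>: "finite \<F>" "\<F> \<subseteq> (\<lambda>i. C i - W) ` I" for \<F>
  proof -
    obtain J where J: "J \<subseteq> I" "finite J" "\<F> = (\<lambda>i. C i - W) ` J"
      using finite_subset_image[OF \<F>] by blast
    obtain k where k: "k \<in> I" "\<forall>j\<in>J. rel j k"
      using directed_on_finite_upper_bound[OF I J(2,1)] by blast
    then have "C k - W \<subseteq> \<Inter>\<F>"
      using anti J by blast
    moreover have "C k - W \<noteq> {}" using not k(1) by blast
    ultimately show ?thesis by blast
  qed
  moreover have "\<forall>D\<in>(\<lambda>i. C i - W) ` I. closedin X D"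
    using C W(1) by auto
  ultimately have "\<Inter>((\<lambda>i. C i - W) ` I) \<noteq> {}"
    using X unfolding compact_space_fip by meson
  then show False using W(2) I_ne by blast
qed

locale compact_inverse_system =
  fixes I :: "'i set" and rel :: "'i \<Rightarrow> 'i \<Rightarrow> bool" and Xs :: "'i \<Rightarrow> 'b topology"
    and f :: "'i \<Rightarrow> 'i \<Rightarrow> 'b \<Rightarrow> 'b"
  assumes directed: "directed_on I rel" and system: "inverse_system I rel Xs f"
    and compact: "\<And>i. i \<in> I \<Longrightarrow> compact_space (Xs i)"
    and Hausdorff: "\<And>i. i \<in> I \<Longrightarrow> Hausdorff_space (Xs i)"
begin

abbreviation "product \<equiv> product_topology Xs I"
abbreviation "points \<equiv> inverse_limit_set I rel (\<lambda>i. topspace (Xs i)) f"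
abbreviation "limit \<equiv> inverse_limit I rel Xs f"

lemma nonempty_index: "I \<noteq> {}" and refl: "i \<in> I \<Longrightarrow> rel i i"
  and trans: "i \<in> I \<Longrightarrow> j \<in> I \<Longrightarrow> k \<in> I \<Longrightarrow> rel i j \<Longrightarrow> rel j k \<Longrightarrow> rel i k"
  and upper: "i \<in> I \<Longrightarrow> j \<in> I \<Longrightarrow> \<exists>k\<in>I. rel i k \<and> rel j k"
  using directed unfolding directed_on_def reflp_on_def transp_on_def by blast+

lemma bonding_continuous: "i \<in> I \<Longrightarrow> j \<in> I \<Longrightarrow> rel i j \<Longrightarrow> continuous_map (Xs j) (Xs i) (f i j)"
  using system by (simp add: inverse_system_def)

lemma bonding_closed: "i \<in> I \<Longrightarrow> j \<in> I \<Longrightarrow> rel i j \<Longrightarrow> x \<in> topspace (Xs j) \<Longrightarrow> f i j x \<in> topspace (Xs i)"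
  using bonding_continuous continuous_map_image_subset_topspace by blast

lemma bonding_id: "i \<in> I \<Longrightarrow> x \<in> topspace (Xs i) \<Longrightarrow> f i i x = x"
  using system by (simp add: inverse_system_def functorial_on_def)

lemma bonding_comp:
  "i \<in> I \<Longrightarrow> j \<in> I \<Longrightarrow> k \<in> I \<Longrightarrow> rel i j \<Longrightarrow> rel j k \<Longrightarrow> x \<in> topspace (Xs k) \<Longrightarrow>
    f i j (f j k x) = f i k x"
  using system by (simp add: inverse_system_def functorial_on_def)

lemma points_iff:
  "x \<in> points \<longleftrightarrow> x \<in> extensional I \<and> (\<forall>i\<in>I. x i \<in> topspace (Xs i)) \<and>
    (\<forall>i\<in>I. \<forall>j\<in>I. rel i j \<longrightarrow> f i j (x j) = x i)"
  by (auto simp: inverse_limit_set_def PiE_iff extensional_def)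

lemma points_closed: "x \<in> points \<Longrightarrow> i \<in> I \<Longrightarrow> x i \<in> topspace (Xs i)"
  by (simp add: points_iff)

lemma points_subset: "points \<subseteq> topspace product"
  by (auto simp: points_iff PiE_iff extensional_def)

lemma topspace_limit: "topspace limit = points"
  using points_subset by (auto simp: inverse_limit_def)

lemma continuous_projection: "i \<in> I \<Longrightarrow> continuous_map limit (Xs i) (\<lambda>x. x i)"
  unfolding inverse_limit_def
  by (intro continuous_map_from_subtopology continuous_map_product_projection)

lemma continuous_product_projection: "i \<in> I \<Longrightarrow> continuous_map product (Xs i) (\<lambda>x. x i)"
  by (rule continuous_map_product_projection)

lemma continuous_pair_projection:
  assumes i: "i \<in> I"
  shows "continuous_map (prod_topology limit limit) (prod_topology (Xs i) (Xs i)) (\<lambda>w. (fst w i, snd w i))"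
    "continuous_map (prod_topology limit limit) (Xs i) (\<lambda>w. fst w i)"
    "continuous_map (prod_topology limit limit) (Xs i) (\<lambda>w. snd w i)"
proof -
  show *: "continuous_map (prod_topology limit limit) (Xs i) (\<lambda>w. fst w i)"
    "continuous_map (prod_topology limit limit) (Xs i) (\<lambda>w. snd w i)"
    using continuous_map_compose[OF continuous_map_fst[of limit limit] continuous_projection[OF i]]
      continuous_map_compose[OF continuous_map_snd[of limit limit] continuous_projection[OF i]]
    by (simp_all add: o_def)
  then show "continuous_map (prod_topology limit limit) (prod_topology (Xs i) (Xs i)) (\<lambda>w. (fst w i, snd w i))"
    by (simp add: continuous_map_pairwise o_def)
qed

text \<open>
  The partial limits below impose the compatibility conditions on the indices below \<open>j\<close> only.
  Their intersection is the inverse limit, and each of them is a retract of the whole product.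
\<close>

definition partial_limit :: "'i \<Rightarrow> ('i \<Rightarrow> 'b) set" where
  "partial_limit j = {x \<in> topspace product. \<forall>i\<in>I. rel i j \<longrightarrow> f i j (x j) = x i}"

lemma points_eq_Inter: "points = (\<Inter>j\<in>I. partial_limit j)"
  using nonempty_index by (auto simp: partial_limit_def inverse_limit_set_def)

lemma closedin_partial_limit:
  assumes j: "j \<in> I"
  shows "closedin product (partial_limit j)"
proof -
  have "closedin product {x \<in> topspace product. f i j (x j) = x i}" if i: "i \<in> I" "rel i j" for i
  proof (rule closedin_continuous_maps_eq[OF Hausdorff[OF i(1)]])
    show "continuous_map product (Xs i) (\<lambda>x. f i j (x j))"
      using continuous_map_compose[OF continuous_product_projection[OF j] bonding_continuous[OF i(1) j i(2)]]
      by (simp add: o_def)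
    show "continuous_map product (Xs i) (\<lambda>x. x i)"
      by (rule continuous_map_product_projection[OF i(1)])
  qed
  then have "closedin product (\<Inter>i\<in>{i \<in> I. rel i j}. {x \<in> topspace product. f i j (x j) = x i})"
    using refl[OF j] j by (intro closedin_INT) auto
  moreover have "(\<Inter>i\<in>{i \<in> I. rel i j}. {x \<in> topspace product. f i j (x j) = x i}) = partial_limit j"
    using refl[OF j] j by (auto simp: partial_limit_def)
  ultimately show ?thesis by simp
qed

lemma partial_limit_anti:
  assumes ij: "i \<in> I" "j \<in> I" "rel i j"
  shows "partial_limit j \<subseteq> partial_limit i"
proof
  fix x assume x: "x \<in> partial_limit j"
  then have xj: "x j \<in> topspace (Xs j)" using ij by (auto simp: partial_limit_def)
  have "f k i (x i) = x k" if k: "k \<in> I" "rel k i" for k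
  proof -
    have "x i = f i j (x j)" "x k = f k j (x j)"
      using x ij k trans[OF k(1) ij(1,2) k(2) ij(3)] by (auto simp: partial_limit_def)
    then show ?thesis using bonding_comp[OF k(1) ij(1,2) k(2) ij(3) xj] by simp
  qed
  then show "x \<in> partial_limit i" using x by (simp add: partial_limit_def)
qed

lemma partial_limit_image:
  assumes j: "j \<in> I"
  shows "\<exists>r. continuous_map product product r \<and> partial_limit j = r ` topspace product"
proof (intro exI conjI)
  let ?r = "\<lambda>x. \<lambda>i\<in>I. if rel i j then f i j (x j) else x i"
  show cont: "continuous_map product product ?r"
    unfolding continuous_map_componentwise
  proof (intro conjI ballI)
    fix i assume i: "i \<in> I"
    show "continuous_map product (Xs i) (\<lambda>x. ?r x i)"
    proof (cases "rel i j")
      case True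
      then show ?thesis
        using i continuous_map_compose[OF continuous_product_projection[OF j] bonding_continuous[OF i j True]]
        by (simp add: o_def)
    next
      case False
      then show ?thesis using i continuous_map_product_projection[OF i] by simp
    qed
  qed auto
  show "partial_limit j = ?r ` topspace product"
  proof
    show "partial_limit j \<subseteq> ?r ` topspace product"
    proof
      fix x assume x: "x \<in> partial_limit j"
      then have "?r x i = x i" for i
        by (auto simp: partial_limit_def PiE_iff extensional_def)
      then have "?r x = x" by (rule ext)
      then show "x \<in> ?r ` topspace product"
        using x unfolding partial_limit_def by (metis (no_types, lifting) image_eqI mem_Collect_eq)
    qed
    show "?r ` topspace product \<subseteq> partial_limit j"
    proof clarify
      fix x assume x: "x \<in> topspace product"
      then have "x j \<in> topspace (Xs j)" using j by auto
      then have "?r x j = x j" using j bonding_id by auto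
      moreover have "?r x \<in> topspace product"
        using cont x continuous_map_image_subset_topspace by blast
      ultimately show "?r x \<in> partial_limit j"
        by (simp add: partial_limit_def)
    qed
  qed
qed

lemma compact_product: "compact_space product"
  using compact by (simp add: compact_space_product_topology)

lemma Hausdorff_product: "Hausdorff_space product"
  using Hausdorff by (simp add: Hausdorff_space_product_topology)

lemma closedin_points: "closedin product points"
  unfolding points_eq_Inter using nonempty_index closedin_partial_limit by (intro closedin_INT) auto

lemma compact_limit: "compact_space limit"
  unfolding inverse_limit_def
  using closedin_points compact_product closedin_compact_space compact_space_subtopology by blast

lemma Hausdorff_limit: "Hausdorff_space limit"
  unfolding inverse_limit_def by (intro Hausdorff_space_subtopology Hausdorff_product)

lemma limit_nonempty:
  assumes "\<And>i. i \<in> I \<Longrightarrow> topspace (Xs i) \<noteq> {}"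
  shows "points \<noteq> {}"
proof
  assume "points = {}"
  then have "(\<Inter>j\<in>I. partial_limit j) \<subseteq> {}"
    by (simp add: points_eq_Inter)
  then have "\<exists>j\<in>I. partial_limit j \<subseteq> {}"
    by (intro compact_directed_closed[OF compact_product directed])
      (auto dest: closedin_partial_limit partial_limit_anti)
  then obtain j where j: "j \<in> I" "partial_limit j \<subseteq> {}"
    by blast
  have "topspace product \<noteq> {}" using assms by (auto simp: PiE_eq_empty_iff)
  then show False
    using partial_limit_image[OF j(1)] j(2) by auto
qed

text \<open>
  The partial limits are connected as images of the product. If two disjoint open sets separated the
  limit, they would cover some partial limit and separate it as well.
\<close>

lemma connected_limit:
  assumes conn: "\<And>i. i \<in> I \<Longrightarrow> connected_space (Xs i)"
  shows "connected_space limit"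
proof -
  have partial: "connectedin product (partial_limit j)" if j: "j \<in> I" for j
  proof -
    have "connected_space product"
      using conn by (simp add: connected_space_product_topology)
    then have "connectedin product (topspace product)"
      using connectedin_topspace by blast
    then show ?thesis
      using partial_limit_image[OF j] connectedin_continuous_map_image by metis
  qed
  have normal: "normal_space product"
    using compact_product Hausdorff_product compact_Hausdorff_or_regular_imp_normal_space by blast
  have "connectedin product points"
    unfolding connectedin_closedin
  proof (intro conjI notI)
    show "points \<subseteq> topspace product" by (rule points_subset)
    assume "\<exists>E1 E2. closedin product E1 \<and> closedin product E2 \<and> points \<subseteq> E1 \<union> E2 \<and>
      E1 \<inter> E2 \<inter> points = {} \<and> E1 \<inter> points \<noteq> {} \<and> E2 \<inter> points \<noteq> {}"
    then obtain E1 E2 where E: "closedin product E1" "closedin product E2" "points \<subseteq> E1 \<union> E2"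
      "E1 \<inter> E2 \<inter> points = {}" "E1 \<inter> points \<noteq> {}" "E2 \<inter> points \<noteq> {}" by blast
    have "closedin product (E1 \<inter> points)" "closedin product (E2 \<inter> points)" "disjnt (E1 \<inter> points) (E2 \<inter> points)"
      using E closedin_points by (auto simp: disjnt_def)
    then obtain U V where UV: "openin product U" "openin product V" "E1 \<inter> points \<subseteq> U" "E2 \<inter> points \<subseteq> V" "disjnt U V"
      using normal unfolding normal_space_def by meson
    have "(\<Inter>j\<in>I. partial_limit j) \<subseteq> U \<union> V"
      using UV E(3) unfolding points_eq_Inter[symmetric] by blast
    then have "\<exists>j\<in>I. partial_limit j \<subseteq> U \<union> V"
      using openin_Un[OF UV(1,2)] closedin_partial_limit partial_limit_anti
      by (intro compact_directed_closed[OF compact_product directed]) blast+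
    then obtain j where j: "j \<in> I" "partial_limit j \<subseteq> U \<union> V"
      by blast
    have "points \<subseteq> partial_limit j" using j(1) points_eq_Inter by blast
    then have "U \<inter> partial_limit j \<noteq> {}" "V \<inter> partial_limit j \<noteq> {}" using E UV by blast+
    then show False
      using partial[OF j(1)] UV j(2) unfolding connectedin disjnt_def by blast
  qed
  then show ?thesis
    unfolding inverse_limit_def connectedin_def by simp
qed

text \<open>
  The relations \<open>x i = y i\<close> are closed and decrease to the diagonal, so by compactness one of them
  lies in \<open>W\<close>.
\<close>

lemma stage_of_entourage:
  assumes W: "openin (prod_topology limit limit) W" and diag: "Id_on points \<subseteq> W"
  shows "\<exists>i\<in>I. \<forall>x\<in>points. \<forall>y\<in>points. x i = y i \<longrightarrow> (x, y) \<in> W"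
proof -
  define C where "C = (\<lambda>i. {w \<in> topspace (prod_topology limit limit). fst w i = snd w i})"
  have C: "closedin (prod_topology limit limit) (C i)" if i: "i \<in> I" for i
    unfolding C_def
    by (rule closedin_continuous_maps_eq[OF Hausdorff[OF i] continuous_pair_projection(2,3)[OF i]])
  have anti: "C j \<subseteq> C i" if ij: "i \<in> I" "j \<in> I" "rel i j" for i j
  proof
    fix w assume w: "w \<in> C j"
    have "fst w \<in> points" "snd w \<in> points"
      using w by (auto simp: C_def topspace_limit)
    then have "fst w i = f i j (fst w j)" "snd w i = f i j (snd w j)"
      using ij points_iff by metis+
    then show "w \<in> C i" using w by (simp add: C_def)
  qed
  have "(\<Inter>i\<in>I. C i) \<subseteq> W"
  proof
    fix w assume w: "w \<in> (\<Inter>i\<in>I. C i)"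
    then have "fst w \<in> points" "snd w \<in> points" "\<forall>i\<in>I. fst w i = snd w i"
      using nonempty_index by (auto simp: C_def topspace_limit)
    then have "fst w = snd w"
      by (intro extensionalityI[of "fst w" I "snd w"]) (auto simp: points_iff)
    then show "w \<in> W" using diag \<open>fst w \<in> points\<close> by (metis Id_onI prod.collapse subsetD)
  qed
  then obtain i where "i \<in> I" "C i \<subseteq> W"
    using compact_directed_closed[of "prod_topology limit limit" I rel C W] C anti W compact_limit directed
    by (auto simp: compact_space_prod_topology)
  then show ?thesis
    by (intro bexI[of _ i]) (auto simp: C_def topspace_limit)
qed

text \<open>
  The complement of \<open>W\<close> is compact and contains no pair with equal coordinates at a suitable stage, so
  its image there is a closed set that misses the diagonal.
\<close>

lemma stage_entourage:
  assumes W: "openin (prod_topology limit limit) W" and diag: "Id_on points \<subseteq> W"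
  obtains i F where "i \<in> I" "openin (prod_topology (Xs i) (Xs i)) F" "Id_on (topspace (Xs i)) \<subseteq> F"
    "\<And>x y. x \<in> points \<Longrightarrow> y \<in> points \<Longrightarrow> (x i, y i) \<in> F \<Longrightarrow> (x, y) \<in> W"
proof -
  obtain i where i: "i \<in> I" "\<And>x y. x \<in> points \<Longrightarrow> y \<in> points \<Longrightarrow> x i = y i \<Longrightarrow> (x, y) \<in> W"
    using stage_of_entourage[OF assms] by blast
  define LL where "LL = prod_topology limit limit"
  define XX where "XX = prod_topology (Xs i) (Xs i)"
  define p where "p = (\<lambda>w::('i \<Rightarrow> 'b) \<times> ('i \<Rightarrow> 'b). (fst w i, snd w i))"
  have topLL: "topspace LL = points \<times> points" by (simp add: LL_def topspace_limit)
  have "compact_space LL"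
    using compact_limit by (simp add: LL_def compact_space_prod_topology)
  moreover have "closedin LL (topspace LL - W)"
    unfolding LL_def using W by (rule closedin_diff[OF closedin_topspace])
  ultimately have "compactin LL (topspace LL - W)"
    using closedin_compact_space by blast
  moreover have "continuous_map LL XX p"
    unfolding LL_def XX_def p_def by (rule continuous_pair_projection(1)[OF i(1)])
  moreover have "Hausdorff_space XX"
    using Hausdorff[OF i(1)] by (simp add: XX_def Hausdorff_space_prod_topology)
  ultimately have "closedin XX (p ` (topspace LL - W))"
    using image_compactin compactin_imp_closedin by blast
  then have "openin XX (topspace XX - p ` (topspace LL - W))"
    by (rule openin_diff[OF openin_topspace])
  moreover have "Id_on (topspace (Xs i)) \<subseteq> topspace XX - p ` (topspace LL - W)"
    using i(2) by (auto simp: XX_def topLL p_def)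
  moreover have "(x, y) \<in> W"
    if "x \<in> points" "y \<in> points" "(x i, y i) \<in> topspace XX - p ` (topspace LL - W)" for x y
  proof (rule ccontr)
    assume "(x, y) \<notin> W"
    then have "p (x, y) \<in> p ` (topspace LL - W)"
      using that(1,2) topLL by blast
    then show False using that(3) by (simp add: p_def)
  qed
  ultimately show ?thesis
    using that[OF i(1)] unfolding XX_def by blast
qed

lemma openin_stage_entourage:
  assumes i: "i \<in> I" and F: "openin (prod_topology (Xs i) (Xs i)) F"
  shows "openin (prod_topology limit limit) {(x, y) \<in> points \<times> points. (x i, y i) \<in> F}"
proof -
  let ?LL = "prod_topology limit limit"
  have "continuous_map ?LL (prod_topology (Xs i) (Xs i)) (\<lambda>w. (fst w i, snd w i))"
    by (rule continuous_pair_projection(1)[OF i])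
  then have "openin ?LL {w \<in> topspace ?LL. (fst w i, snd w i) \<in> F}"
    using F by (rule openin_continuous_map_preimage)
  moreover have "{w \<in> topspace ?LL. (fst w i, snd w i) \<in> F} = {(x, y) \<in> points \<times> points. (x i, y i) \<in> F}"
    by (auto simp: topspace_limit)
  ultimately show ?thesis by simp
qed

text \<open>
  The sets \<open>K i\<close> form an inverse system of nonempty compact spaces in their own right.
\<close>

lemma limit_through_closed_sets:
  assumes K: "\<And>i. i \<in> I \<Longrightarrow> closedin (Xs i) (K i)" "\<And>i. i \<in> I \<Longrightarrow> K i \<noteq> {}"
    and f: "\<And>i j. i \<in> I \<Longrightarrow> j \<in> I \<Longrightarrow> rel i j \<Longrightarrow> f i j ` K j \<subseteq> K i"
  shows "\<exists>x\<in>points. \<forall>i\<in>I. x i \<in> K i"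
proof -
  have KX: "topspace (subtopology (Xs i) (K i)) = K i" if "i \<in> I" for i
    using closedin_subset[OF K(1)[OF that]] by (simp add: inf.absorb2)
  interpret K: compact_inverse_system I rel "\<lambda>i. subtopology (Xs i) (K i)" f
  proof
    show "directed_on I rel" by (rule directed)
    show "inverse_system I rel (\<lambda>i. subtopology (Xs i) (K i)) f"
      unfolding inverse_system_def functorial_on_def
    proof (intro conjI ballI impI)
      show "continuous_map (subtopology (Xs j) (K j)) (subtopology (Xs i) (K i)) (f i j)"
        if "i \<in> I" "j \<in> I" "rel i j" for i j
        using bonding_continuous[OF that] f[OF that]
        by (intro continuous_map_into_subtopology continuous_map_from_subtopology) auto
    qed (auto simp: bonding_id bonding_comp)
    show "compact_space (subtopology (Xs i) (K i))" if "i \<in> I" for i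
      using compact[OF that] K(1)[OF that] closedin_compact_space compact_space_subtopology by blast
    show "Hausdorff_space (subtopology (Xs i) (K i))" if "i \<in> I" for i
      using Hausdorff[OF that] by (rule Hausdorff_space_subtopology)
  qed
  obtain x where x: "x \<in> K.points"
    using K.limit_nonempty K(2) KX by auto
  then have "x \<in> points" "\<forall>i\<in>I. x i \<in> K i"
    using K.points_closed[OF x] KX unfolding K.points_iff points_iff by auto
  then show ?thesis by blast
qed

end

section \<open>Inverse limits of finite groups\<close>

locale finite_group_system =
  fixes I :: "'i set" and rel :: "'i \<Rightarrow> 'i \<Rightarrow> bool" and Gm :: "'i \<Rightarrow> 'g monoid"
    and \<theta> :: "'i \<Rightarrow> 'i \<Rightarrow> 'g \<Rightarrow> 'g"
  assumes directed_index: "directed_on I rel" and group_system: "group_inverse_system I rel Gm \<theta>"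
    and finite_carrier: "\<And>i. i \<in> I \<Longrightarrow> finite (carrier (Gm i))"
begin

abbreviation "limit_group \<equiv> inverse_limit_group I rel Gm \<theta>"

lemma group_stage: "i \<in> I \<Longrightarrow> group (Gm i)"
  and hom_bonding: "i \<in> I \<Longrightarrow> j \<in> I \<Longrightarrow> rel i j \<Longrightarrow> \<theta> i j \<in> hom (Gm j) (Gm i)"
  using group_system by (auto simp: group_inverse_system_def)

sublocale discrete: compact_inverse_system I rel "\<lambda>i. discrete_topology (carrier (Gm i))" \<theta>
proof
  show "inverse_system I rel (\<lambda>i. discrete_topology (carrier (Gm i))) \<theta>"
    using group_system hom_bonding
    by (auto simp: inverse_system_def group_inverse_system_def hom_def)
qed (auto simp: directed_index finite_carrier compact_space_discrete_topology)

lemma carrier_limit_group: "carrier limit_group = discrete.points"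
  by (simp add: inverse_limit_group_def)

lemma points_iff:
  "x \<in> inverse_limit_set I rel (\<lambda>i. carrier (Gm i)) \<theta> \<longleftrightarrow>
    x \<in> extensional I \<and> (\<forall>i\<in>I. x i \<in> carrier (Gm i)) \<and> (\<forall>i\<in>I. \<forall>j\<in>I. rel i j \<longrightarrow> \<theta> i j (x j) = x i)"
  using discrete.points_iff[of x] by simp

lemma points_carrier: "x \<in> discrete.points \<Longrightarrow> i \<in> I \<Longrightarrow> x i \<in> carrier (Gm i)"
  using discrete.points_closed by fastforce

lemma mult_limit_group: "x \<otimes>\<^bsub>limit_group\<^esub> y = (\<lambda>i\<in>I. x i \<otimes>\<^bsub>Gm i\<^esub> y i)"
  by (simp add: inverse_limit_group_def product_group_def)

lemma one_limit_group: "\<one>\<^bsub>limit_group\<^esub> = (\<lambda>i\<in>I. \<one>\<^bsub>Gm i\<^esub>)"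
  by (simp add: inverse_limit_group_def product_group_def)

lemma points_subset_product: "discrete.points \<subseteq> carrier (product_group I Gm)"
  using discrete.points_subset by simp

lemma inv_product_points:
  "x \<in> discrete.points \<Longrightarrow> inv\<^bsub>product_group I Gm\<^esub> x = (\<lambda>i\<in>I. inv\<^bsub>Gm i\<^esub> x i)"
  using points_subset_product by (intro inv_product_group) (auto simp: group_stage)

lemma subgroup_points: "subgroup discrete.points (product_group I Gm)"
proof (rule group.subgroupI[OF product_group])
  show "group (Gm i)" if "i \<in> I" for i using that by (rule group_stage)
  show "discrete.points \<subseteq> carrier (product_group I Gm)" by (rule points_subset_product)
  have "(\<lambda>i\<in>I. \<one>\<^bsub>Gm i\<^esub>) \<in> discrete.points"
    using hom_one[OF hom_bonding] group_stage
    by (auto simp: points_iff group.is_monoid)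
  then show "discrete.points \<noteq> {}" by blast
  show "inv\<^bsub>product_group I Gm\<^esub> x \<in> discrete.points" if x: "x \<in> discrete.points" for x
  proof -
    have "\<theta> i j (inv\<^bsub>Gm j\<^esub> x j) = inv\<^bsub>Gm i\<^esub> x i" if ij: "i \<in> I" "j \<in> I" "rel i j" for i j
    proof -
      interpret group_hom "Gm j" "Gm i" "\<theta> i j"
        using hom_bonding[OF ij] group_stage ij by (simp add: group_hom_def group_hom_axioms_def)
      show ?thesis
        using x ij points_carrier[OF x ij(2)] by (simp add: points_iff)
    qed
    moreover have "inv\<^bsub>Gm i\<^esub> x i \<in> carrier (Gm i)" if "i \<in> I" for i
      using that points_carrier[OF x that] group_stage[OF that] by simp
    ultimately show ?thesis
      unfolding inv_product_points[OF x] discrete.points_iff by simp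
  qed
  show "x \<otimes>\<^bsub>product_group I Gm\<^esub> y \<in> discrete.points"
    if x: "x \<in> discrete.points" and y: "y \<in> discrete.points" for x y
  proof -
    have "\<theta> i j (x j \<otimes>\<^bsub>Gm j\<^esub> y j) = x i \<otimes>\<^bsub>Gm i\<^esub> y i" if ij: "i \<in> I" "j \<in> I" "rel i j" for i j
      using hom_mult[OF hom_bonding[OF ij] points_carrier[OF x ij(2)] points_carrier[OF y ij(2)]] x y ij
      by (simp add: points_iff)
    moreover have "x i \<otimes>\<^bsub>Gm i\<^esub> y i \<in> carrier (Gm i)" if "i \<in> I" for i
      using that points_carrier[OF x that] points_carrier[OF y that] group_stage[OF that]
      by (simp add: group.is_monoid monoid.m_closed)
    ultimately show ?thesis
      unfolding mult_product_group discrete.points_iff by simp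
  qed
qed

lemma group_limit: "group limit_group"
  unfolding inverse_limit_group_def
  using subgroup.subgroup_is_group[OF subgroup_points product_group] group_stage by simp

lemma inv_limit_group:
  assumes x: "x \<in> discrete.points"
  shows "inv\<^bsub>limit_group\<^esub> x = (\<lambda>i\<in>I. inv\<^bsub>Gm i\<^esub> x i)"
proof (rule group.inv_equality[OF group_limit])
  have "(\<lambda>i\<in>I. inv\<^bsub>Gm i\<^esub> x i) \<in> discrete.points"
    using subgroup.m_inv_closed[OF subgroup_points x] inv_product_points[OF x] by simp
  then show "(\<lambda>i\<in>I. inv\<^bsub>Gm i\<^esub> x i) \<in> carrier limit_group" "x \<in> carrier limit_group"
    using x by (simp_all add: carrier_limit_group)
  show "(\<lambda>i\<in>I. inv\<^bsub>Gm i\<^esub> x i) \<otimes>\<^bsub>limit_group\<^esub> x = \<one>\<^bsub>limit_group\<^esub>"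
    unfolding mult_limit_group one_limit_group
    using points_carrier[OF x] group_stage by (auto simp: group.l_inv)
qed

text \<open>
  The threads that agree with \<open>x\<close> at a stage \<open>i\<close> form closed sets that decrease to \<open>{x}\<close>, so by
  compactness one of them lies in a given neighbourhood of \<open>x\<close>.
\<close>

lemma openin_discrete_limit:
  assumes U: "U \<subseteq> discrete.points"
  shows "openin discrete.limit U \<longleftrightarrow>
    (\<forall>x\<in>U. \<exists>i\<in>I. \<forall>y\<in>discrete.points. y i = x i \<longrightarrow> y \<in> U)"
proof
  assume op: "openin discrete.limit U"
  show "\<forall>x\<in>U. \<exists>i\<in>I. \<forall>y\<in>discrete.points. y i = x i \<longrightarrow> y \<in> U"
  proof
    fix x assume x: "x \<in> U"
    then have xp: "x \<in> discrete.points" using U by blast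
    let ?C = "\<lambda>i. {y \<in> topspace discrete.limit. y i \<in> {x i}}"
    have "\<exists>i\<in>I. ?C i \<subseteq> U"
    proof (rule compact_directed_closed[OF discrete.compact_limit directed_index _ _ op])
      show "closedin discrete.limit (?C i)" if "i \<in> I" for i
        using closedin_continuous_map_preimage[OF discrete.continuous_projection[OF that], of "{x i}"]
          points_carrier[OF xp that] by (simp add: closedin_discrete_topology)
      show "?C j \<subseteq> ?C i" if ij: "i \<in> I" "j \<in> I" "rel i j" for i j
      proof clarify
        fix y assume y: "y \<in> topspace discrete.limit" "y j = x j"
        have "\<theta> i j (y j) = y i" "\<theta> i j (x j) = x i"
          using y(1) xp ij unfolding discrete.topspace_limit discrete.points_iff by blast+
        then show "y i = x i" using y(2) by simp
      qed
      show "(\<Inter>i\<in>I. ?C i) \<subseteq> U"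
      proof
        fix y assume y: "y \<in> (\<Inter>i\<in>I. ?C i)"
        then have "y \<in> discrete.points" "\<And>i. i \<in> I \<Longrightarrow> y i = x i"
          using discrete.nonempty_index unfolding discrete.topspace_limit by blast+
        then have "y = x" using xp
          by (intro extensionalityI[of y I x]) (auto simp: points_iff)
        then show "y \<in> U" using x by simp
      qed
    qed
    then show "\<exists>i\<in>I. \<forall>y\<in>discrete.points. y i = x i \<longrightarrow> y \<in> U"
      unfolding discrete.topspace_limit by blast
  qed
next
  assume R: "\<forall>x\<in>U. \<exists>i\<in>I. \<forall>y\<in>discrete.points. y i = x i \<longrightarrow> y \<in> U"
  show "openin discrete.limit U"
  proof (subst openin_subopen, intro ballI)
    fix x assume x: "x \<in> U"
    then obtain i where i: "i \<in> I" "\<forall>y\<in>discrete.points. y i = x i \<longrightarrow> y \<in> U" using R by blast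
    let ?T = "{y \<in> topspace discrete.limit. y i \<in> {x i}}"
    have "openin discrete.limit ?T"
      using x U points_carrier[of x i] i(1)
      by (intro openin_continuous_map_preimage[OF discrete.continuous_projection[OF i(1)]]) auto
    moreover have "x \<in> ?T" using x U by (auto simp: discrete.topspace_limit)
    moreover have "?T \<subseteq> U" using i(2) by (auto simp: discrete.topspace_limit)
    ultimately show "\<exists>T. openin discrete.limit T \<and> x \<in> T \<and> T \<subseteq> U" by blast
  qed
qed

lemma continuous_into_limit:
  assumes "\<And>i. i \<in> I \<Longrightarrow> continuous_map Z (discrete_topology (carrier (Gm i))) (\<lambda>z. h z i)"
    and "\<And>z. z \<in> topspace Z \<Longrightarrow> h z \<in> discrete.points"
  shows "continuous_map Z discrete.limit h"
  unfolding inverse_limit_def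
proof (rule continuous_map_into_subtopology)
  show "continuous_map Z discrete.product h"
    unfolding continuous_map_componentwise using assms by (auto simp: points_iff)
  show "h \<in> topspace Z \<rightarrow> discrete.points" using assms(2) by blast
qed

text \<open>
  A connected set has a single point as its image in every discrete stage, which makes the limit
  totally disconnected.
\<close>

lemma profinite_limit: "profinite_group limit_group discrete.limit"
  unfolding profinite_group_def
proof (intro conjI ballI)
  let ?T = "discrete.limit"
  show "group limit_group" by (rule group_limit)
  show "topspace ?T = carrier limit_group"
    by (simp add: discrete.topspace_limit carrier_limit_group)
  show "compact_space ?T" by (rule discrete.compact_limit)
  show "Hausdorff_space ?T" by (rule discrete.Hausdorff_limit)
  show "continuous_map (prod_topology ?T ?T) ?T (\<lambda>(x, y). x \<otimes>\<^bsub>limit_group\<^esub> y)"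
  proof (rule continuous_into_limit)
    fix i assume i: "i \<in> I"
    let ?D = "discrete_topology (carrier (Gm i))"
    have "continuous_map (prod_topology ?D ?D) ?D (\<lambda>(a, b). a \<otimes>\<^bsub>Gm i\<^esub> b)"
      using group_stage[OF i]
      by (auto simp: group.is_monoid monoid.m_closed simp flip: prod_topology_discrete_topology)
    from continuous_map_compose[OF discrete.continuous_pair_projection(1)[OF i] this]
    show "continuous_map (prod_topology ?T ?T) ?D (\<lambda>z. (case z of (x, y) \<Rightarrow> x \<otimes>\<^bsub>limit_group\<^esub> y) i)"
      using i by (simp add: o_def mult_limit_group split_def)
  next
    fix z assume "z \<in> topspace (prod_topology ?T ?T)"
    then have "fst z \<in> carrier limit_group" "snd z \<in> carrier limit_group"
      by (auto simp: discrete.topspace_limit carrier_limit_group)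
    then have "fst z \<otimes>\<^bsub>limit_group\<^esub> snd z \<in> carrier limit_group"
      using group_limit by (simp add: group.is_monoid monoid.m_closed)
    then show "(case z of (x, y) \<Rightarrow> x \<otimes>\<^bsub>limit_group\<^esub> y) \<in> discrete.points"
      by (simp add: carrier_limit_group split_def)
  qed
  show "continuous_map ?T ?T (\<lambda>x. inv\<^bsub>limit_group\<^esub> x)"
  proof (rule continuous_into_limit)
    fix i assume i: "i \<in> I"
    let ?D = "discrete_topology (carrier (Gm i))"
    have "continuous_map ?D ?D (\<lambda>a. inv\<^bsub>Gm i\<^esub> a)"
      using group_stage[OF i] by auto
    from continuous_map_compose[OF discrete.continuous_projection[OF i] this]
    show "continuous_map ?T ?D (\<lambda>x. (inv\<^bsub>limit_group\<^esub> x) i)"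
      by (rule continuous_map_eq) (simp add: i inv_limit_group discrete.topspace_limit)
  next
    fix x assume "x \<in> topspace ?T"
    then have "x \<in> carrier limit_group" by (simp add: discrete.topspace_limit carrier_limit_group)
    then show "inv\<^bsub>limit_group\<^esub> x \<in> discrete.points"
      using group.inv_closed[OF group_limit] carrier_limit_group by blast
  qed
  fix x assume x: "x \<in> topspace ?T"
  have "y = x" if y: "connected_component_of ?T x y" for y
  proof (rule extensionalityI[of _ I])
    obtain C where C: "connectedin ?T C" "x \<in> C" "y \<in> C"
      using y unfolding connected_component_of_def by blast
    then have yT: "y \<in> topspace ?T" using connectedin_subset_topspace by blast
    show "y \<in> extensional I" "x \<in> extensional I"
      using x yT unfolding discrete.topspace_limit discrete.points_iff by blast+
    fix i assume i: "i \<in> I"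
    have "connectedin (discrete_topology (carrier (Gm i))) ((\<lambda>x. x i) ` C)"
      using connectedin_continuous_map_image[OF discrete.continuous_projection[OF i] C(1)] .
    then obtain a where "(\<lambda>x. x i) ` C \<subseteq> {a}"
      by (auto simp: connectedin_discrete_topology)
    then show "y i = x i" using C by blast
  qed
  moreover have "connected_component_of ?T x x"
    using x by (simp add: connected_component_of_refl)
  ultimately show "connected_component_of_set ?T x = {x}" by blast
qed

end

section \<open>The limit of a system of covers\<close>

text \<open>
  Only the spaces and the maps between them are given; the homomorphisms between the deck groups are
  forced by equivariance.
\<close>

locale cover_system =
  fixes X :: "'a topology" and I :: "'i set" and rel :: "'i \<Rightarrow> 'i \<Rightarrow> bool"
    and Xs :: "'i \<Rightarrow> 'b topology" and Gs :: "'i \<Rightarrow> ('b \<Rightarrow> 'b) set" and fs :: "'i \<Rightarrow> 'b \<Rightarrow> 'a"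
    and f :: "'i \<Rightarrow> 'i \<Rightarrow> 'b \<Rightarrow> 'b"
  assumes directed_index: "directed_on I rel"
    and cover: "\<And>i. i \<in> I \<Longrightarrow> finite_regular_cover X (Xs i) (Gs i) (fs i)"
    and metrizable: "\<And>i. i \<in> I \<Longrightarrow> metrizable_space (Xs i)"
    and countable_index: "countable I"
    and compact_base: "compact_space X" and metrizable_base: "metrizable_space X"
    and space_system: "inverse_system I rel Xs f"
    and morphism: "\<And>i j. i \<in> I \<Longrightarrow> j \<in> I \<Longrightarrow> rel i j \<Longrightarrow>
      cover_morphism X (Xs i) (Gs i) (fs i) (Xs j) (Gs j) (fs j) (f i j)"
begin

sublocale spaces: compact_inverse_system I rel Xs f
  using directed_index space_system
    finite_regular_cover.compact[OF cover] finite_regular_cover.Hausdorff[OF cover]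
  by unfold_locales

abbreviation "deck i \<equiv> bij_subgroup (topspace (Xs i)) (Gs i)"

definition \<theta> :: "'i \<Rightarrow> 'i \<Rightarrow> ('b \<Rightarrow> 'b) \<Rightarrow> ('b \<Rightarrow> 'b)" where
  "\<theta> i j g = (THE g'. g' \<in> Gs i \<and> (\<forall>z\<in>topspace (Xs j). g' (f i j z) = f i j (g z)))"

lemma \<theta>:
  assumes "i \<in> I" "j \<in> I" "rel i j" "g \<in> Gs j"
  shows "\<theta> i j g \<in> Gs i" "z \<in> topspace (Xs j) \<Longrightarrow> \<theta> i j g (f i j z) = f i j (g z)"
  using theI'[OF cover_morphism.equivariant[OF morphism[OF assms(1-3)] assms(4)]]
  unfolding \<theta>_def by blast+

text \<open>
  Equivariance at one point suffices, as the deck group of a stage acts freely. All compatibility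
  properties of the homomorphisms are reduced to this.
\<close>

lemma \<theta>_eq:
  assumes ij: "i \<in> I" "j \<in> I" "rel i j" "g \<in> Gs j" and g': "g' \<in> Gs i"
    and z: "z \<in> topspace (Xs j)" "g' (f i j z) = f i j (g z)"
  shows "\<theta> i j g = g'"
proof -
  interpret lower: finite_regular_cover X "Xs i" "Gs i" "fs i" using cover[OF ij(1)] .
  show ?thesis
    using lower.act_eq[OF \<theta>(1)[OF ij] g' spaces.bonding_closed[OF ij(1-3) z(1)]] \<theta>(2)[OF ij z(1)] z(2) by simp
qed

lemma deck_group_system: "group_inverse_system I rel deck \<theta>"
  unfolding group_inverse_system_def functorial_on_def
proof (intro conjI ballI impI)
  show "group (deck i)" if "i \<in> I" for i
    using group_bij_subgroup finite_regular_cover.subgroup[OF cover[OF that]] .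
  show "\<theta> i j \<in> hom (deck j) (deck i)" if ij: "i \<in> I" "j \<in> I" "rel i j" for i j
  proof -
    interpret lower: finite_regular_cover X "Xs i" "Gs i" "fs i" using cover[OF ij(1)] .
    interpret upper: finite_regular_cover X "Xs j" "Gs j" "fs j" using cover[OF ij(2)] .
    obtain z where z: "z \<in> topspace (Xs j)" using upper.nonempty by blast
    have "\<theta> i j (compose (topspace (Xs j)) g h) = compose (topspace (Xs i)) (\<theta> i j g) (\<theta> i j h)"
      if gh: "g \<in> Gs j" "h \<in> Gs j" for g h
    proof (rule \<theta>_eq[OF ij upper.compose_mem[OF gh] lower.compose_mem[OF \<theta>(1)[OF ij gh(1)] \<theta>(1)[OF ij gh(2)]] z])
      show "compose (topspace (Xs i)) (\<theta> i j g) (\<theta> i j h) (f i j z) = f i j (compose (topspace (Xs j)) g h z)"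
        using spaces.bonding_closed[OF ij z] z \<theta>(2)[OF ij gh(2) z] \<theta>(2)[OF ij gh(1) upper.act_closed[OF gh(2) z]]
        by (simp add: compose_eq)
    qed
    then show ?thesis
      using \<theta>(1)[OF ij] by (auto simp: hom_def mult_bij_subgroup[OF lower.sub_Bij] mult_bij_subgroup[OF upper.sub_Bij])
  qed
  show "\<theta> i i g = g" if i: "i \<in> I" and g: "g \<in> carrier (deck i)" for i g
  proof -
    interpret finite_regular_cover X "Xs i" "Gs i" "fs i" using cover[OF i] .
    obtain z where z: "z \<in> topspace (Xs i)" using nonempty by blast
    have g: "g \<in> Gs i" using g by simp
    show ?thesis
      using \<theta>_eq[OF i i spaces.refl[OF i] g g z] spaces.bonding_id[OF i] z act_closed[OF g z] by simp
  qed
  show "\<theta> i j (\<theta> j k g) = \<theta> i k g"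
    if ijk: "i \<in> I" "j \<in> I" "k \<in> I" "rel i j" "rel j k" and g: "g \<in> carrier (deck k)" for i j k g
  proof -
    interpret finite_regular_cover X "Xs k" "Gs k" "fs k" using cover[OF ijk(3)] .
    have g: "g \<in> Gs k" using g by simp
    obtain z where z: "z \<in> topspace (Xs k)" using nonempty by blast
    have ik: "rel i k" using spaces.trans ijk by blast
    note jg = \<theta>(1)[OF ijk(2,3,5) g]
    have "\<theta> i j (\<theta> j k g) (f i k z) = f i k (g z)"
      using \<theta>(2)[OF ijk(1,2,4) jg spaces.bonding_closed[OF ijk(2,3,5) z]] \<theta>(2)[OF ijk(2,3,5) g z]
        spaces.bonding_comp[OF ijk z] spaces.bonding_comp[OF ijk act_closed[OF g z]] by simp
    then show ?thesis
      using \<theta>_eq[OF ijk(1,3) ik g \<theta>(1)[OF ijk(1,2,4) jg] z] by simp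
  qed
qed

sublocale groups: finite_group_system I rel deck \<theta>
  using directed_index deck_group_system finite_regular_cover.finite_group[OF cover]
  by unfold_locales simp_all

abbreviation "points \<equiv> inverse_limit_set I rel (\<lambda>i. topspace (Xs i)) f"
abbreviation "limit \<equiv> inverse_limit I rel Xs f"
abbreviation "threads \<equiv> inverse_limit_set I rel Gs \<theta>"
abbreviation "act \<equiv> coordinatewise I points"
abbreviation "D \<equiv> act ` threads"

lemma threads_iff:
  "g \<in> threads \<longleftrightarrow> g \<in> extensional I \<and> (\<forall>i\<in>I. g i \<in> Gs i) \<and> (\<forall>i\<in>I. \<forall>j\<in>I. rel i j \<longrightarrow> \<theta> i j (g j) = g i)"
  using groups.points_iff[of g] by simp

lemma carrier_limit_group: "carrier groups.limit_group = threads"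
  using groups.carrier_limit_group by simp

lemma threads_closed:
  "g \<in> threads \<Longrightarrow> h \<in> threads \<Longrightarrow> g \<otimes>\<^bsub>groups.limit_group\<^esub> h \<in> threads"
  "g \<in> threads \<Longrightarrow> inv\<^bsub>groups.limit_group\<^esub> g \<in> threads"
  "\<one>\<^bsub>groups.limit_group\<^esub> \<in> threads"
  using monoid.m_closed[OF group.is_monoid[OF groups.group_limit], of g h]
    group.inv_closed[OF groups.group_limit, of g] monoid.one_closed[OF group.is_monoid[OF groups.group_limit]]
  unfolding carrier_limit_group by blast+

lemma act_apply: "x \<in> points \<Longrightarrow> i \<in> I \<Longrightarrow> act g x i = g i (x i)"
  by (simp add: coordinatewise_def)

lemma act_closed:
  assumes g: "g \<in> threads" and x: "x \<in> points"
  shows "act g x \<in> points"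
proof -
  have "g i (x i) \<in> topspace (Xs i)" if i: "i \<in> I" for i
    using finite_regular_cover.act_closed[OF cover[OF i]] g x i by (simp add: threads_iff spaces.points_iff)
  moreover have "f i j (g j (x j)) = g i (x i)" if ij: "i \<in> I" "j \<in> I" "rel i j" for i j
    using \<theta>(2)[OF ij, of "g j" "x j"] g x ij by (simp add: threads_iff spaces.points_iff)
  ultimately show ?thesis
    using x by (simp add: spaces.points_iff coordinatewise_def)
qed

lemma points_eqI:
  assumes "x \<in> points" "y \<in> points" "\<And>i. i \<in> I \<Longrightarrow> x i = y i"
  shows "x = y"
  using assms by (intro extensionalityI[of x I y]) (auto simp: spaces.points_iff)

lemma threads_eqI:
  assumes "g \<in> threads" "h \<in> threads" "\<And>i. i \<in> I \<Longrightarrow> g i = h i"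
  shows "g = h"
  using assms by (intro extensionalityI[of g I h]) (auto simp: threads_iff)

lemma points_nonempty: "points \<noteq> {}"
  using spaces.limit_nonempty finite_regular_cover.nonempty[OF cover] by blast

lemma thread_eq_of_act:
  assumes g: "g \<in> threads" and h: "h \<in> threads" and x: "x \<in> points" and i: "i \<in> I"
    and eq: "act g x i = act h x i"
  shows "g i = h i"
  using finite_regular_cover.act_eq[OF cover[OF i], of "g i" "h i" "x i"] assms
  by (simp add: threads_iff act_apply spaces.points_iff)

lemma inj_act: "inj_on act threads"
proof (rule inj_onI)
  fix g h assume gh: "g \<in> threads" "h \<in> threads" "act g = act h"
  obtain x where x: "x \<in> points" using points_nonempty by blast
  show "g = h"
    using thread_eq_of_act[OF gh(1,2) x] gh(3) by (intro threads_eqI[OF gh(1,2)]) simp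
qed

lemma mult_threads:
  assumes "g \<in> threads" "h \<in> threads"
  shows "g \<otimes>\<^bsub>groups.limit_group\<^esub> h = (\<lambda>i\<in>I. compose (topspace (Xs i)) (g i) (h i))"
proof -
  have "g i \<otimes>\<^bsub>deck i\<^esub> h i = compose (topspace (Xs i)) (g i) (h i)" if i: "i \<in> I" for i
    using mult_bij_subgroup[OF finite_regular_cover.sub_Bij[OF cover[OF i]]] assms i by (simp add: threads_iff)
  then show ?thesis
    unfolding groups.mult_limit_group by (intro restrict_ext) simp
qed

lemma act_mult:
  assumes g: "g \<in> threads" and h: "h \<in> threads"
  shows "act (g \<otimes>\<^bsub>groups.limit_group\<^esub> h) = compose points (act g) (act h)"
proof (rule extensionalityI[of _ points])
  fix x assume x: "x \<in> points"
  have hx: "act h x \<in> points" using act_closed[OF h x] .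
  have gh: "g \<otimes>\<^bsub>groups.limit_group\<^esub> h \<in> threads"
    using threads_closed(1)[OF g h] .
  have "act (g \<otimes>\<^bsub>groups.limit_group\<^esub> h) x = act g (act h x)"
  proof (rule points_eqI[OF act_closed[OF gh x] act_closed[OF g hx]])
    fix i assume i: "i \<in> I"
    show "act (g \<otimes>\<^bsub>groups.limit_group\<^esub> h) x i = act g (act h x) i"
      using i x hx spaces.points_closed[OF x i]
      by (simp add: act_apply mult_threads[OF g h] compose_eq)
  qed
  then show "act (g \<otimes>\<^bsub>groups.limit_group\<^esub> h) x = compose points (act g) (act h) x"
    using x by (simp add: compose_eq)
qed (simp_all add: coordinatewise_def compose_def)

lemma act_one: "act \<one>\<^bsub>groups.limit_group\<^esub> = (\<lambda>x\<in>points. x)"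
proof (rule extensionalityI[of _ points])
  fix x assume x: "x \<in> points"
  have one: "\<one>\<^bsub>groups.limit_group\<^esub> \<in> threads"
    by (rule threads_closed(3))
  have "act \<one>\<^bsub>groups.limit_group\<^esub> x = x"
    using x spaces.points_closed[OF x]
    by (intro points_eqI[OF act_closed[OF one x] x]) (simp add: act_apply groups.one_limit_group)
  then show "act \<one>\<^bsub>groups.limit_group\<^esub> x = (\<lambda>x\<in>points. x) x" using x by simp
qed (simp_all add: coordinatewise_def)

lemma act_inverse:
  assumes g: "g \<in> threads" and x: "x \<in> points"
  shows "act (inv\<^bsub>groups.limit_group\<^esub> g) (act g x) = x" "act g (act (inv\<^bsub>groups.limit_group\<^esub> g) x) = x"
proof -
  let ?h = "inv\<^bsub>groups.limit_group\<^esub> g"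
  have h: "?h \<in> threads" using threads_closed(2)[OF g] .
  have "?h \<otimes>\<^bsub>groups.limit_group\<^esub> g = \<one>\<^bsub>groups.limit_group\<^esub>"
    "g \<otimes>\<^bsub>groups.limit_group\<^esub> ?h = \<one>\<^bsub>groups.limit_group\<^esub>"
    using g groups.group_limit carrier_limit_group by (simp_all add: group.l_inv group.r_inv)
  then have "compose points (act ?h) (act g) = (\<lambda>x\<in>points. x)"
    "compose points (act g) (act ?h) = (\<lambda>x\<in>points. x)"
    using act_mult[OF h g] act_mult[OF g h] act_one by simp_all
  then show "act ?h (act g x) = x" "act g (act ?h x) = x"
    by (simp_all add: compose_eq_idD[OF _ x])
qed

lemma act_Bij:
  assumes g: "g \<in> threads"
  shows "act g \<in> Bij points"
proof -
  have "bij_betw (act g) points points"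
    using act_inverse[OF g] act_closed[OF g] act_closed[OF threads_closed(2)[OF g]]
    by (intro bij_betw_byWitness[where f' = "act (inv\<^bsub>groups.limit_group\<^esub> g)"]) auto
  then show ?thesis by (simp add: Bij_def coordinatewise_def)
qed

text \<open>
  Besides the whole limit group this is applied to the kernels of its projections to the stages.
\<close>

lemma subgroup_act_image:
  assumes H: "subgroup H groups.limit_group"
  shows "subgroup (act ` H) (BijGroup points)"
  unfolding subgroup_BijGroup_iff
proof (intro conjI ballI)
  have HT: "H \<subseteq> threads" using subgroup.subset[OF H] carrier_limit_group by simp
  show "act ` H \<subseteq> Bij points" using HT act_Bij by blast
  show "(\<lambda>x\<in>points. x) \<in> act ` H"
    unfolding act_one[symmetric] using subgroup.one_closed[OF H] by (rule imageI)
  fix a assume "a \<in> act ` H"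
  then obtain g where g: "g \<in> H" "a = act g" by blast
  show "compose points a b \<in> act ` H" if b: "b \<in> act ` H" for b
  proof -
    obtain h where h: "h \<in> H" "b = act h" using b by blast
    have "compose points a b = act (g \<otimes>\<^bsub>groups.limit_group\<^esub> h)"
      using act_mult[of g h] g h HT by (simp add: subset_iff)
    then show ?thesis using subgroup.m_closed[OF H g(1) h(1)] by blast
  qed
  let ?h = "inv\<^bsub>groups.limit_group\<^esub> g"
  have "g \<in> threads" using g(1) HT by blast
  then have "\<forall>x\<in>points. act ?h (a x) = x \<and> a (act ?h x) = x"
    unfolding g(2) using act_inverse by blast
  then show "\<exists>h\<in>act ` H. \<forall>x\<in>points. h (a x) = x \<and> a (h x) = x"
    using subgroup.m_inv_closed[OF H g(1)] by blast
qed

lemma subgroup_D: "subgroup D (BijGroup points)"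
  using subgroup_act_image[OF group.subgroup_self[OF groups.group_limit]] carrier_limit_group by simp

lemma act_iso: "act \<in> iso groups.limit_group (bij_subgroup points D)"
proof -
  have "act (g \<otimes>\<^bsub>groups.limit_group\<^esub> h) = act g \<otimes>\<^bsub>bij_subgroup points D\<^esub> act h"
    if "g \<in> threads" "h \<in> threads" for g h
    using act_mult[OF that] mult_bij_subgroup[of D points "act g" "act h"] act_Bij that
    by (simp add: image_subset_iff)
  then show ?thesis
    using inj_act by (auto simp: iso_def hom_def carrier_limit_group bij_betw_def)
qed

lemma continuous_act:
  assumes g: "g \<in> threads"
  shows "continuous_map limit limit (act g)"
proof -
  have "continuous_map limit spaces.product (act g)"
    unfolding continuous_map_componentwise
  proof (intro conjI ballI)
    show "act g ` topspace limit \<subseteq> extensional I"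
      using act_closed[OF g] by (auto simp: spaces.topspace_limit spaces.points_iff)
    fix i assume i: "i \<in> I"
    have "continuous_map (Xs i) (Xs i) (g i)"
      using finite_regular_cover.continuous_act[OF cover[OF i]] g i by (simp add: threads_iff)
    from continuous_map_compose[OF spaces.continuous_projection[OF i] this]
    show "continuous_map limit (Xs i) (\<lambda>x. act g x i)"
      by (rule continuous_map_eq) (simp add: spaces.topspace_limit act_apply i)
  qed
  then show "continuous_map limit limit (act g)"
    unfolding inverse_limit_def
    using act_closed[OF g] by (intro continuous_map_into_subtopology) (auto simp: spaces.topspace_limit inverse_limit_def[symmetric])
qed

lemma metrizable_limit: "metrizable_space limit"
proof -
  have "countable {i \<in> I. \<nexists>a. topspace (Xs i) \<subseteq> {a}}"
    using countable_index by (rule countable_subset[rotated]) auto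
  then show ?thesis
    unfolding inverse_limit_def
    using metrizable by (intro metrizable_space_subtopology) (simp add: metrizable_space_product_topology)
qed

lemma continuum_limit: "continuum limit"
  unfolding continuum_def spaces.topspace_limit
  using points_nonempty spaces.compact_limit metrizable_limit
    spaces.connected_limit[OF finite_regular_cover.connected[OF cover]] by blast

end

context cover_system
begin

lemma uniform_limit: "uniform_space_on limit (compact_entourages limit)"
  using uniform_space_on_compact_entourages spaces.compact_limit metrizable_limit by blast

lemma limit_entourage_subset: "E \<in> compact_entourages limit \<Longrightarrow> E \<subseteq> points \<times> points"
  by (simp add: compact_entourages_def spaces.topspace_limit)

lemma entourage_stage:
  assumes E: "E \<in> compact_entourages limit"
  shows "\<exists>i\<in>I. \<forall>x\<in>points. \<forall>y\<in>points. x i = y i \<longrightarrow> (x, y) \<in> E"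
proof -
  obtain W where W: "openin (prod_topology limit limit) W" "Id_on points \<subseteq> W" "W \<subseteq> E"
    using E unfolding compact_entourages_def spaces.topspace_limit by blast
  then show ?thesis
    using spaces.stage_of_entourage[OF W(1,2)] W(3) by blast
qed

definition pullback_entourage :: "'i \<Rightarrow> ('b \<times> 'b) set \<Rightarrow> (('i \<Rightarrow> 'b) \<times> ('i \<Rightarrow> 'b)) set" where
  "pullback_entourage i F = {(x, y) \<in> points \<times> points. (x i, y i) \<in> F}"

lemma pullback_entourage:
  assumes i: "i \<in> I" and F: "openin (prod_topology (Xs i) (Xs i)) F" "Id_on (topspace (Xs i)) \<subseteq> F" "sym F"
  shows "pullback_entourage i F \<in> compact_entourages limit"
proof -
  have "openin (prod_topology limit limit) (pullback_entourage i F)"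
    unfolding pullback_entourage_def using spaces.openin_stage_entourage[OF i F(1)] .
  moreover have "Id_on points \<subseteq> pullback_entourage i F"
    using F(2) spaces.points_closed[OF _ i] by (auto simp: pullback_entourage_def)
  moreover have "sym (pullback_entourage i F)"
    using F(3) by (auto simp: pullback_entourage_def sym_def)
  moreover have "pullback_entourage i F \<subseteq> points \<times> points"
    by (auto simp: pullback_entourage_def)
  ultimately show ?thesis
    unfolding compact_entourages_def spaces.topspace_limit by blast
qed

lemma separating_stage_entourage:
  assumes i: "i \<in> I"
  obtains F where "pullback_entourage i F \<in> compact_entourages limit"
    "\<And>a b. (a, b) \<in> F \<Longrightarrow> fs i a = fs i b \<Longrightarrow> a = b"
proof -
  interpret finite_regular_cover X "Xs i" "Gs i" "fs i" using cover[OF i] .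
  obtain F where F: "openin (prod_topology (Xs i) (Xs i)) F" "Id_on (topspace (Xs i)) \<subseteq> F" "sym F"
    "\<And>a b c e. (a, b) \<in> F \<Longrightarrow> (b, c) \<in> F \<Longrightarrow> (c, e) \<in> F \<Longrightarrow> fs i a = fs i e \<Longrightarrow> a = e"
    using separating_entourage[OF metrizable[OF i]] by metis
  have "a = b" if ab: "(a, b) \<in> F" "fs i a = fs i b" for a b
  proof -
    have "b \<in> topspace (Xs i)" using openin_prod_subset[OF F(1)] ab(1) by blast
    then have "(b, b) \<in> F" using F(2) by blast
    then show ?thesis using F(4) ab by blast
  qed
  then show ?thesis
    using that pullback_entourage[OF i F(1-3)] by blast
qed

lemma D_cover:
  assumes "g \<in> threads" "x \<in> points" "i \<in> I"
  shows "fs i (act g x i) = fs i (x i)"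
  using finite_regular_cover.cover_act[OF cover[OF assms(3)]] assms
  by (simp add: act_apply threads_iff spaces.points_iff)

section \<open>Uniform convergence of deck transformations\<close>

abbreviation "UC \<equiv> uniform_convergence points (compact_entourages limit) D"

text \<open>
  Small entourages of a stage separate the points of every fibre, so uniformly close transformations
  agree at that stage; conversely every entourage of the limit contains all pairs of points with the
  same coordinate at some stage.
\<close>

lemma uniform_convergence_stage:
  "V \<in> UC \<longleftrightarrow> V \<subseteq> D \<times> D \<and> sym V \<and>
     (\<exists>i\<in>I. \<forall>g\<in>threads. \<forall>h\<in>threads. g i = h i \<longrightarrow> (act g, act h) \<in> V)"
proof
  assume V: "V \<in> UC"
  then obtain E where E: "E \<in> compact_entourages limit"
    "{(g, h). g \<in> D \<and> h \<in> D \<and> (\<forall>y\<in>points. (g y, h y) \<in> E)} \<subseteq> V"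
    unfolding uniform_convergence_def by blast
  obtain i where i: "i \<in> I" "\<forall>x\<in>points. \<forall>y\<in>points. x i = y i \<longrightarrow> (x, y) \<in> E"
    using entourage_stage[OF E(1)] by blast
  have "(act g, act h) \<in> V" if gh: "g \<in> threads" "h \<in> threads" "g i = h i" for g h
  proof -
    have "(act g x, act h x) \<in> E" if x: "x \<in> points" for x
      using i act_closed[OF gh(1) x] act_closed[OF gh(2) x] gh(3) act_apply[OF x i(1)] by simp
    then show ?thesis using E(2) gh(1,2) by blast
  qed
  then show "V \<subseteq> D \<times> D \<and> sym V \<and>
     (\<exists>i\<in>I. \<forall>g\<in>threads. \<forall>h\<in>threads. g i = h i \<longrightarrow> (act g, act h) \<in> V)"
    using V i(1) unfolding uniform_convergence_def by blast
next
  assume V: "V \<subseteq> D \<times> D \<and> sym V \<and>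
     (\<exists>i\<in>I. \<forall>g\<in>threads. \<forall>h\<in>threads. g i = h i \<longrightarrow> (act g, act h) \<in> V)"
  then obtain i where i: "i \<in> I" "\<And>g h. g \<in> threads \<Longrightarrow> h \<in> threads \<Longrightarrow> g i = h i \<Longrightarrow> (act g, act h) \<in> V"
    by blast
  obtain F where F: "pullback_entourage i F \<in> compact_entourages limit"
    "\<And>a b. (a, b) \<in> F \<Longrightarrow> fs i a = fs i b \<Longrightarrow> a = b"
    using separating_stage_entourage[OF i(1)] by blast
  have "(act g, act h) \<in> V"
    if gh: "g \<in> threads" "h \<in> threads" "\<forall>y\<in>points. (act g y, act h y) \<in> pullback_entourage i F" for g h
  proof -
    obtain x where x: "x \<in> points" using points_nonempty by blast
    then have "(act g x i, act h x i) \<in> F" using gh(3) by (simp add: pullback_entourage_def)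
    then have "act g x i = act h x i"
      using F(2) D_cover[OF gh(1) x i(1)] D_cover[OF gh(2) x i(1)] by simp
    then show ?thesis
      using i(2)[OF gh(1,2)] thread_eq_of_act[OF gh(1,2) x i(1)] by blast
  qed
  then have "{(g, h). g \<in> D \<and> h \<in> D \<and> (\<forall>y\<in>points. (g y, h y) \<in> pullback_entourage i F)} \<subseteq> V"
    by blast
  then show "V \<in> UC"
    unfolding uniform_convergence_def using V F(1) by blast
qed

text \<open>
  These relations are a base of the uniformity of uniform convergence, which replaces quantification
  over points of the limit by equality of one coordinate.
\<close>

definition agreement :: "'i \<Rightarrow> ((('i \<Rightarrow> 'b) \<Rightarrow> 'i \<Rightarrow> 'b) \<times> (('i \<Rightarrow> 'b) \<Rightarrow> 'i \<Rightarrow> 'b)) set" where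
  "agreement i = {(act g, act h) |g h. g \<in> threads \<and> h \<in> threads \<and> g i = h i}"

lemma agreement_iff:
  assumes "g \<in> threads" "h \<in> threads"
  shows "(act g, act h) \<in> agreement i \<longleftrightarrow> g i = h i"
  using assms inj_onD[OF inj_act] unfolding agreement_def by blast

lemma agreement_subset: "agreement i \<subseteq> D \<times> D"
  by (auto simp: agreement_def)

lemma agreement_entourage: "i \<in> I \<Longrightarrow> agreement i \<in> UC"
  unfolding uniform_convergence_stage
proof (intro conjI bexI ballI impI)
  show "sym (agreement i)"
    unfolding agreement_def by (rule symI) (smt (verit) mem_Collect_eq prod.inject)
qed (auto simp: agreement_def)

lemma agreement_below:
  assumes "V \<in> UC"
  shows "\<exists>i\<in>I. agreement i \<subseteq> V"
proof -
  obtain i where "i \<in> I" "\<forall>g\<in>threads. \<forall>h\<in>threads. g i = h i \<longrightarrow> (act g, act h) \<in> V"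
    using assms uniform_convergence_stage by blast
  then show ?thesis by (intro bexI[of _ i]) (auto simp: agreement_def)
qed

lemma agreement_mono:
  assumes ij: "i \<in> I" "j \<in> I" "rel i j"
  shows "agreement j \<subseteq> agreement i"
proof -
  have "g i = h i" if "g \<in> threads" "h \<in> threads" "g j = h j" for g h
  proof -
    have "g i = \<theta> i j (g j)" "h i = \<theta> i j (h j)" using that(1,2) ij unfolding threads_iff by metis+
    then show ?thesis using that(3) by simp
  qed
  then show ?thesis unfolding agreement_def by blast
qed

lemma uniformity_UC: "uniformity_on D UC"
  unfolding uniformity_on_def
proof (intro conjI ballI allI impI)
  show "UC \<noteq> {}" using agreement_entourage spaces.nonempty_index by blast
  show "Id_on D \<subseteq> E" "E \<subseteq> D \<times> D" "sym E" if E: "E \<in> UC" for E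
    using E unfolding uniform_convergence_stage by blast+
  show "F \<in> UC" if "E \<in> UC" "E \<subseteq> F \<and> F \<subseteq> D \<times> D \<and> sym F" for E F
    using that unfolding uniform_convergence_stage by blast
  show "E \<inter> F \<in> UC" if EF: "E \<in> UC" "F \<in> UC" for E F
  proof -
    obtain i j where ij: "i \<in> I" "j \<in> I" "agreement i \<subseteq> E" "agreement j \<subseteq> F"
      using agreement_below EF by blast
    obtain k where k: "k \<in> I" "rel i k" "rel j k" using spaces.upper[OF ij(1,2)] by blast
    have "agreement k \<subseteq> E \<inter> F"
      using agreement_mono[OF ij(1) k(1,2)] agreement_mono[OF ij(2) k(1,3)] ij(3,4) by blast
    moreover have "sym (E \<inter> F)" "E \<inter> F \<subseteq> D \<times> D"
      using EF unfolding uniform_convergence_stage by (auto intro: sym_Int)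
    ultimately show ?thesis
      unfolding uniform_convergence_stage using k(1) agreement_iff by blast
  qed
  show "\<exists>F\<in>UC. F O F \<subseteq> E" if E: "E \<in> UC" for E
  proof -
    obtain i where i: "i \<in> I" "agreement i \<subseteq> E" using agreement_below[OF E] by blast
    have "agreement i O agreement i \<subseteq> agreement i"
    proof
      fix w assume "w \<in> agreement i O agreement i"
      then obtain a b c where w: "w = (a, c)" "(a, b) \<in> agreement i" "(b, c) \<in> agreement i" by blast
      have "a \<in> D" "b \<in> D" "c \<in> D" using w(2,3) agreement_subset[of i] by blast+
      then obtain g h k where ghk: "g \<in> threads" "h \<in> threads" "k \<in> threads" "a = act g" "b = act h" "c = act k"
        by (elim imageE) blast
      then have "g i = h i" "h i = k i" using w agreement_iff by blast+
      then show "w \<in> agreement i" using w(1) ghk agreement_iff[OF ghk(1,3)] by simp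
    qed
    then show ?thesis using i agreement_entourage by blast
  qed
qed

text \<open>
  Both topologies have the same description by agreement at a stage.
\<close>

lemma homeomorphic_map_act:
  "homeomorphic_map groups.discrete.limit (uniform_topology D UC) act"
proof -
  let ?U = "uniform_topology D UC"
  have op: "openin ?U V \<longleftrightarrow> uniformly_open D UC V" for V
    using openin_uniform_topology[OF uniformity_UC] .
  obtain i where i: "i \<in> I" using spaces.nonempty_index by blast
  have "agreement i `` {a} \<subseteq> D" for a using agreement_subset[of i] by blast
  then have "uniformly_open D UC D"
    unfolding uniformly_open_def using agreement_entourage[OF i] by blast
  then have "D \<subseteq> topspace ?U" using op openin_subset by blast
  moreover have "uniformly_open D UC (topspace ?U)" using op openin_topspace by blast
  then have "topspace ?U \<subseteq> D" unfolding uniformly_open_def by (rule conjunct1)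
  ultimately have top: "topspace ?U = D" by (rule equalityI[rotated])
  have topP: "topspace groups.discrete.limit = threads"
    using groups.discrete.topspace_limit by simp
  have "openin groups.discrete.limit {g \<in> threads. act g \<in> V} \<longleftrightarrow> uniformly_open D UC V" if V: "V \<subseteq> D" for V
  proof -
    define S where "S = {g \<in> threads. act g \<in> V}"
    have "openin groups.discrete.limit S \<longleftrightarrow>
        (\<forall>g\<in>S. \<exists>i\<in>I. \<forall>h\<in>threads. h i = g i \<longrightarrow> h \<in> S)"
      using groups.openin_discrete_limit[of S] by (simp add: S_def)
    also have "\<dots> \<longleftrightarrow> (\<forall>g\<in>S. \<exists>i\<in>I. agreement i `` {act g} \<subseteq> V)"
    proof (intro ball_cong bex_cong HOL.refl)
      fix g i assume "g \<in> S"
      then have g: "g \<in> threads" by (simp add: S_def)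
      show "(\<forall>h\<in>threads. h i = g i \<longrightarrow> h \<in> S) \<longleftrightarrow> agreement i `` {act g} \<subseteq> V"
      proof
        assume L: "\<forall>h\<in>threads. h i = g i \<longrightarrow> h \<in> S"
        show "agreement i `` {act g} \<subseteq> V"
        proof
          fix a assume a: "a \<in> agreement i `` {act g}"
          then obtain h where h: "h \<in> threads" "a = act h" using agreement_subset[of i] by blast
          then have "h i = g i" using a agreement_iff[OF g h(1)] by simp
          then show "a \<in> V" using L h by (simp add: S_def)
        qed
      next
        assume R: "agreement i `` {act g} \<subseteq> V"
        show "\<forall>h\<in>threads. h i = g i \<longrightarrow> h \<in> S"
        proof (intro ballI impI)
          fix h assume h: "h \<in> threads" "h i = g i"
          then have "(act g, act h) \<in> agreement i" using agreement_iff[OF g h(1)] by simp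
          then show "h \<in> S" using R h(1) unfolding S_def by blast
        qed
      qed
    qed
    also have "\<dots> \<longleftrightarrow> (\<forall>a\<in>V. \<exists>i\<in>I. agreement i `` {a} \<subseteq> V)"
    proof -
      have "act ` S = V" using V by (auto simp: S_def)
      moreover have "(\<forall>g\<in>S. Q (act g)) \<longleftrightarrow> (\<forall>a\<in>act ` S. Q a)" for Q by blast
      ultimately show ?thesis by (simp only:)
    qed
    also have "\<dots> \<longleftrightarrow> (\<forall>a\<in>V. \<exists>E\<in>UC. E `` {a} \<subseteq> V)"
    proof -
      have "(\<exists>i\<in>I. agreement i `` {a} \<subseteq> V) \<longleftrightarrow> (\<exists>E\<in>UC. E `` {a} \<subseteq> V)" for a
        using agreement_entourage agreement_below by (meson Image_mono order_refl order_trans)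
      then show ?thesis by simp
    qed
    also have "\<dots> \<longleftrightarrow> uniformly_open D UC V"
      using V by (simp add: uniformly_open_def)
    finally show ?thesis by (simp only: S_def)
  qed
  then show ?thesis
    unfolding homeomorphic_map_def quotient_map_def topP top op using inj_act by blast
qed

text \<open>
  The elements of a Cauchy filter eventually have a constant coordinate at each stage, and these
  coordinates form a thread.
\<close>

lemma complete_D: "complete_uniformity D UC"
  unfolding complete_uniformity_def
proof (intro allI impI)
  fix F :: "(('i \<Rightarrow> 'b) \<Rightarrow> 'i \<Rightarrow> 'b) filter"
  assume F: "F \<noteq> bot" and FD: "\<forall>\<^sub>F x in F. x \<in> D"
    and cauchy: "\<forall>E\<in>UC. \<exists>A. (\<forall>\<^sub>F x in F. x \<in> A) \<and> A \<times> A \<subseteq> E"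
  have "\<exists>c. \<forall>\<^sub>F x in F. \<exists>g\<in>threads. x = act g \<and> g i = c" if i: "i \<in> I" for i
  proof -
    obtain A where A: "\<forall>\<^sub>F x in F. x \<in> A" "A \<times> A \<subseteq> agreement i"
      using cauchy agreement_entourage[OF i] by blast
    have "\<exists>x. x \<in> A" using eventually_happens'[OF F A(1)] .
    then obtain a where a: "a \<in> A" by blast
    have AD: "A \<subseteq> D" using A(2) agreement_subset[of i] by blast
    then obtain h where h: "h \<in> threads" "a = act h" using a by blast
    have "\<exists>g\<in>threads. x = act g \<and> g i = h i" if x: "x \<in> A" for x
    proof -
      obtain g where g: "g \<in> threads" "x = act g" using AD x by blast
      have "(act g, act h) \<in> agreement i" using A(2) x a g h by blast
      then show ?thesis using agreement_iff[OF g(1) h(1)] g by blast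
    qed
    then have "\<forall>\<^sub>F x in F. \<exists>g\<in>threads. x = act g \<and> g i = h i"
      using A(1) by (rule eventually_mono[rotated])
    then show ?thesis by blast
  qed
  then have "\<forall>i\<in>I. \<exists>c. \<forall>\<^sub>F x in F. \<exists>g\<in>threads. x = act g \<and> g i = c" by blast
  from bchoice[OF this] obtain c
    where c: "\<And>i. i \<in> I \<Longrightarrow> \<forall>\<^sub>F x in F. \<exists>g\<in>threads. x = act g \<and> g i = c i" by blast
  define l where "l = restrict c I"
  have l_thread: "l \<in> threads"
    unfolding threads_iff
  proof (intro conjI ballI impI)
    show "l \<in> extensional I" by (simp add: l_def)
    show "l i \<in> Gs i" if i: "i \<in> I" for i
    proof -
      obtain g where "g \<in> threads" "g i = c i" using eventually_happens'[OF F c[OF i]] by blast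
      then show ?thesis using i by (auto simp: l_def threads_iff)
    qed
    show "\<theta> i j (l j) = l i" if ij: "i \<in> I" "j \<in> I" "rel i j" for i j
    proof -
      obtain x where "\<exists>g\<in>threads. x = act g \<and> g i = c i" "\<exists>g\<in>threads. x = act g \<and> g j = c j"
        using eventually_happens'[OF F eventually_conj[OF c[OF ij(1)] c[OF ij(2)]]] by blast
      then obtain g where "g \<in> threads" "g i = c i" "g j = c j"
        using inj_onD[OF inj_act] by metis
      then have "\<theta> i j (g j) = g i" using ij unfolding threads_iff by blast
      then show ?thesis using ij \<open>g i = c i\<close> \<open>g j = c j\<close> by (simp add: l_def)
    qed
  qed
  have "\<forall>\<^sub>F x in F. (act l, x) \<in> E" if E: "E \<in> UC" for E
  proof -
    obtain i where i: "i \<in> I" "agreement i \<subseteq> E" using agreement_below[OF E] by blast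
    have "(act l, x) \<in> E" if x: "\<exists>g\<in>threads. x = act g \<and> g i = c i" for x
    proof -
      obtain g where g: "g \<in> threads" "x = act g" "g i = c i" using x by blast
      then have "(act l, act g) \<in> agreement i"
        using agreement_iff[OF l_thread g(1)] i(1) by (simp add: l_def)
      then show ?thesis using i(2) g(2) by blast
    qed
    then show ?thesis using c[OF i(1)] by (rule eventually_mono[rotated])
  qed
  then show "\<exists>l\<in>D. \<forall>E\<in>UC. \<forall>\<^sub>F x in F. (l, x) \<in> E"
    using l_thread by blast
qed

section \<open>The limit as a generalized regular cover\<close>

text \<open>
  An invariant entourage of a stage pulls back to an invariant one of the limit.
\<close>

lemma acts_isomorphically_D: "acts_isomorphically (compact_entourages limit) D"
  unfolding acts_isomorphically_def
proof
  fix E assume E: "E \<in> compact_entourages limit"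
  then obtain W where W: "openin (prod_topology limit limit) W" "Id_on points \<subseteq> W" "W \<subseteq> E"
    unfolding compact_entourages_def spaces.topspace_limit by blast
  obtain i F where iF: "i \<in> I" "openin (prod_topology (Xs i) (Xs i)) F" "Id_on (topspace (Xs i)) \<subseteq> F"
    "\<And>x y. x \<in> points \<Longrightarrow> y \<in> points \<Longrightarrow> (x i, y i) \<in> F \<Longrightarrow> (x, y) \<in> W"
    using spaces.stage_entourage[OF W(1,2)] by blast
  interpret c: finite_regular_cover X "Xs i" "Gs i" "fs i" using cover[OF iF(1)] .
  obtain F' where F': "openin (prod_topology (Xs i) (Xs i)) F'" "Id_on (topspace (Xs i)) \<subseteq> F'" "F' \<subseteq> F" "sym F'"
    "\<And>g u v. g \<in> Gs i \<Longrightarrow> u \<in> topspace (Xs i) \<Longrightarrow> v \<in> topspace (Xs i) \<Longrightarrow> (g u, g v) \<in> F' \<longleftrightarrow> (u, v) \<in> F'"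
    using c.invariant_entourage[OF iF(2,3)] by metis
  let ?E = "pullback_entourage i F'"
  have inv: "(act g x, act g y) \<in> ?E" if g: "g \<in> threads" and xy: "(x, y) \<in> ?E" for g x y
  proof -
    have p: "x \<in> points" "y \<in> points" "(x i, y i) \<in> F'" using xy by (auto simp: pullback_entourage_def)
    have "g i \<in> Gs i" using g iF(1) by (simp add: threads_iff)
    then have "(g i (x i), g i (y i)) \<in> F'"
      using F'(5) p spaces.points_closed iF(1) by blast
    then show ?thesis
      using p act_closed[OF g] by (simp add: pullback_entourage_def act_apply iF(1))
  qed
  have "map_prod a a ` ?E = ?E" if a: "a \<in> D" for a
  proof
    obtain g where g: "g \<in> threads" "a = act g" using a by blast
    show "map_prod a a ` ?E \<subseteq> ?E" using inv[OF g(1)] g(2) by auto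
    show "?E \<subseteq> map_prod a a ` ?E"
    proof
      fix w assume w: "w \<in> ?E"
      obtain x y where xy: "w = (x, y)" by (cases w)
      have p: "x \<in> points" "y \<in> points" using w xy by (auto simp: pullback_entourage_def)
      let ?h = "act (inv\<^bsub>groups.limit_group\<^esub> g)"
      have "w = map_prod a a (?h x, ?h y)"
        using act_inverse(2)[OF g(1)] p xy g(2) by simp
      moreover have "(?h x, ?h y) \<in> ?E"
        using inv[OF threads_closed(2)[OF g(1)]] w xy by blast
      ultimately show "w \<in> map_prod a a ` ?E" by blast
    qed
  qed
  moreover have "?E \<subseteq> E"
    using iF(4) F'(3) W(3) by (auto simp: pullback_entourage_def)
  ultimately show "\<exists>F\<in>compact_entourages limit. F \<subseteq> E \<and> (\<forall>g\<in>D. map_prod g g ` F = F)"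
    using pullback_entourage[OF iF(1) F'(1,2,4)] by blast
qed

text \<open>
  A deck transformation of the limit that moves one point by a small amount fixes the corresponding
  point of a stage, hence lies in the kernel of the projection to the deck group of that stage, and
  so does the group generated by all of these.
\<close>

lemma acts_prodiscretely_D: "acts_prodiscretely points (compact_entourages limit) D"
  unfolding acts_prodiscretely_def
proof
  fix E assume E: "E \<in> compact_entourages limit"
  obtain i where i: "i \<in> I" "\<forall>x\<in>points. \<forall>y\<in>points. x i = y i \<longrightarrow> (x, y) \<in> E"
    using entourage_stage[OF E] by blast
  interpret c: finite_regular_cover X "Xs i" "Gs i" "fs i" using cover[OF i(1)] .
  obtain F where F: "pullback_entourage i F \<in> compact_entourages limit"
    "\<And>a b. (a, b) \<in> F \<Longrightarrow> fs i a = fs i b \<Longrightarrow> a = b"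
    using separating_stage_entourage[OF i(1)] by blast
  let ?P = "groups.limit_group"
  define K where "K = {g \<in> threads. g i = \<one>\<^bsub>deck i\<^esub>}"
  interpret P: group ?P by (rule groups.group_limit)
  interpret Gi: group "deck i" using groups.group_stage[OF i(1)] .
  have "subgroup K ?P"
  proof (rule P.subgroupI)
    show "K \<subseteq> carrier ?P" by (auto simp: K_def carrier_limit_group)
    show "K \<noteq> {}" using threads_closed(3) i(1) by (auto simp: K_def groups.one_limit_group)
    show "inv\<^bsub>?P\<^esub> g \<in> K" if g: "g \<in> K" for g
    proof -
      have "(inv\<^bsub>?P\<^esub> g) i = inv\<^bsub>deck i\<^esub> (g i)"
        using groups.inv_limit_group[of g] g i(1) by (simp add: K_def)
      then show ?thesis using g threads_closed(2) Gi.inv_one by (simp add: K_def)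
    qed
    show "g \<otimes>\<^bsub>?P\<^esub> h \<in> K" if g: "g \<in> K" and h: "h \<in> K" for g h
    proof -
      have "(g \<otimes>\<^bsub>?P\<^esub> h) i = g i \<otimes>\<^bsub>deck i\<^esub> h i"
        using i(1) by (simp add: groups.mult_limit_group)
      also have "\<dots> = \<one>\<^bsub>deck i\<^esub>"
        using g h Gi.l_one[OF Gi.one_closed] unfolding K_def by simp
      finally show ?thesis using g h threads_closed(1) by (simp add: K_def)
    qed
  qed
  then have sub: "subgroup (act ` K) (BijGroup points)" by (rule subgroup_act_image)
  have "S_ent points D (pullback_entourage i F) \<subseteq> act ` K"
  proof
    fix a assume "a \<in> S_ent points D (pullback_entourage i F)"
    then obtain g y where g: "g \<in> threads" "a = act g" and y: "y \<in> points" "(y, act g y) \<in> pullback_entourage i F"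
      unfolding S_ent_def by blast
    have yi: "y i \<in> topspace (Xs i)" using spaces.points_closed[OF y(1) i(1)] .
    have "(y i, act g y i) \<in> F" using y(2) by (simp add: pullback_entourage_def)
    then have "y i = act g y i" using F(2) D_cover[OF g(1) y(1) i(1)] by simp
    then have "g i (y i) = y i" using act_apply[OF y(1) i(1)] by simp
    then have "g i = \<one>\<^bsub>deck i\<^esub>"
      using c.fixed_point[OF _ yi, of "g i"] g(1) i(1) by (simp add: threads_iff)
    then show "a \<in> act ` K" using g by (auto simp: K_def)
  qed
  then have "N_ent points D (pullback_entourage i F) \<subseteq> act ` K"
    unfolding N_ent_def using group.generate_subgroup_incl[OF group_BijGroup _ sub] by blast
  moreover have "act ` K \<subseteq> U_ent points D E"
  proof clarify
    fix g assume g: "g \<in> K"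
    have "(y, act g y) \<in> E" if y: "y \<in> points" for y
    proof -
      have "act g y i = y i"
        using act_apply[OF y i(1)] g spaces.points_closed[OF y i(1)] by (simp add: K_def)
      then show ?thesis using i(2) y act_closed[of g y] g by (simp add: K_def)
    qed
    then show "act g \<in> U_ent points D E" using g by (auto simp: U_ent_def K_def)
  qed
  ultimately show "\<exists>F\<in>compact_entourages limit. N_ent points D F \<subseteq> U_ent points D E"
    using F(1) by blast
qed

text \<open>
  The choice of the index is immaterial, as the next lemma shows.
\<close>

definition \<phi> :: "('i \<Rightarrow> 'b) \<Rightarrow> 'a" where
  "\<phi> x = (let i = (SOME i. i \<in> I) in fs i (x i))"

lemma \<phi>:
  assumes x: "x \<in> points" and i: "i \<in> I"
  shows "\<phi> x = fs i (x i)"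
proof -
  have up: "fs i (x i) = fs k (x k)" if ik: "i \<in> I" "k \<in> I" "rel i k" for i k
    using cover_morphism.h_lift[OF morphism[OF ik], of "x k"] x ik by (simp add: spaces.points_iff)
  define i0 where "i0 = (SOME i. i \<in> I)"
  have i0: "i0 \<in> I" unfolding i0_def using i by (rule someI)
  obtain k where k: "k \<in> I" "rel i k" "rel i0 k" using spaces.upper[OF i i0] by blast
  have "fs i0 (x i0) = fs i (x i)"
    using up[OF i k(1,2)] up[OF i0 k(1,3)] by simp
  then show ?thesis by (simp add: \<phi>_def i0_def)
qed

lemma \<phi>_continuous: "continuous_map limit X \<phi>"
proof -
  obtain i where i: "i \<in> I" using spaces.nonempty_index by blast
  have "continuous_map limit X (fs i \<circ> (\<lambda>x. x i))"
    using continuous_map_compose[OF spaces.continuous_projection[OF i] finite_regular_cover.cont[OF cover[OF i]]] .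
  then show ?thesis
    by (rule continuous_map_eq) (simp add: spaces.topspace_limit \<phi>[OF _ i])
qed

text \<open>
  The fibres of a point of \<open>X\<close> in the stages are nonempty closed sets, so a thread runs through them.
\<close>

lemma \<phi>_surj: "\<phi> ` points = topspace X"
proof
  show "\<phi> ` points \<subseteq> topspace X"
    using continuous_map_image_subset_topspace[OF \<phi>_continuous] spaces.topspace_limit by auto
  show "topspace X \<subseteq> \<phi> ` points"
  proof
    fix a assume a: "a \<in> topspace X"
    have "\<exists>x\<in>points. \<forall>i\<in>I. x i \<in> {z \<in> topspace (Xs i). fs i z \<in> {a}}"
    proof (rule spaces.limit_through_closed_sets)
      fix i assume i: "i \<in> I"
      interpret finite_regular_cover X "Xs i" "Gs i" "fs i" using cover[OF i] .
      show "closedin (Xs i) {z \<in> topspace (Xs i). fs i z \<in> {a}}"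
        using Hausdorff_base a by (intro closedin_continuous_map_preimage[OF cont]) (simp add: closedin_Hausdorff_singleton)
      obtain z where "z \<in> topspace (Xs i)" "fs i z = a"
        using a unfolding surj[symmetric] by blast
      then show "{z \<in> topspace (Xs i). fs i z \<in> {a}} \<noteq> {}" by blast
    next
      fix i j assume ij: "i \<in> I" "j \<in> I" "rel i j"
      show "f i j ` {z \<in> topspace (Xs j). fs j z \<in> {a}} \<subseteq> {z \<in> topspace (Xs i). fs i z \<in> {a}}"
        using cover_morphism.h_lift[OF morphism[OF ij]] spaces.bonding_closed[OF ij] by auto
    qed
    then obtain x where x: "x \<in> points" "\<forall>i\<in>I. x i \<in> {z \<in> topspace (Xs i). fs i z \<in> {a}}" by blast
    obtain i where i: "i \<in> I" using spaces.nonempty_index by blast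
    have "\<phi> x = a" using \<phi>[OF x(1) i] x(2) i by simp
    then show "a \<in> \<phi> ` points" using x(1) by blast
  qed
qed

lemma \<phi>_orbits: "fibres_are_orbits points D \<phi>"
  unfolding fibres_are_orbits_def
proof (intro ballI iffI)
  fix x y assume x: "x \<in> points" and y: "y \<in> points"
  show "\<phi> x = \<phi> y" if yx: "\<exists>a\<in>D. y = a x"
  proof -
    obtain g where g: "g \<in> threads" "y = act g x" using yx by blast
    obtain i where i: "i \<in> I" using spaces.nonempty_index by blast
    show ?thesis using \<phi>[OF x i] \<phi>[OF y i] D_cover[OF g(1) x i] g(2) by simp
  qed
  assume eq: "\<phi> x = \<phi> y"
  \<comment> \<open>At each stage exactly one deck transformation moves \<open>x i\<close> to \<open>y i\<close>; by uniqueness these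
    are compatible.\<close>
  have "\<exists>g. g \<in> Gs i \<and> y i = g (x i)" if i: "i \<in> I" for i
  proof -
    interpret finite_regular_cover X "Xs i" "Gs i" "fs i" using cover[OF i] .
    show ?thesis
      using same_fibre[OF spaces.points_closed[OF x i] spaces.points_closed[OF y i]] \<phi>[OF x i] \<phi>[OF y i] eq
      by metis
  qed
  then obtain c where c: "\<And>i. i \<in> I \<Longrightarrow> c i \<in> Gs i \<and> y i = c i (x i)" by metis
  define g where "g = restrict c I"
  have g: "g \<in> threads"
    unfolding threads_iff
  proof (intro conjI ballI impI)
    show "g \<in> extensional I" by (simp add: g_def)
    show "g i \<in> Gs i" if "i \<in> I" for i using c that by (simp add: g_def)
    show "\<theta> i j (g j) = g i" if ij: "i \<in> I" "j \<in> I" "rel i j" for i j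
    proof (rule \<theta>_eq[OF ij])
      show "g j \<in> Gs j" "g i \<in> Gs i" using c ij by (simp_all add: g_def)
      show "x j \<in> topspace (Xs j)" using spaces.points_closed[OF x ij(2)] .
      have "f i j (x j) = x i" "f i j (y j) = y i" using x y ij by (simp_all add: spaces.points_iff)
      then show "g i (f i j (x j)) = f i j (g j (x j))" using c ij by (simp add: g_def)
    qed
  qed
  have "y = act g x"
    using c by (intro points_eqI[OF y act_closed[OF g x]]) (simp add: act_apply[OF x] g_def)
  then show "\<exists>a\<in>D. y = a x" using g by blast
qed

lemma \<phi>_quotient: "quotient_map limit X \<phi>"
  using continuous_imp_quotient_map[OF \<phi>_continuous spaces.compact_limit]
    metrizable_imp_Hausdorff_space[OF metrizable_base] \<phi>_surj by (simp add: spaces.topspace_limit)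

lemma \<phi>_open: "open_map limit X \<phi>"
  unfolding open_map_def
proof (intro allI impI)
  fix U assume U: "openin limit U"
  have Up: "U \<subseteq> points" using openin_subset[OF U] by (simp add: spaces.topspace_limit)
  have "{x \<in> topspace limit. \<phi> x \<in> \<phi> ` U} = (\<Union>g\<in>threads. {x \<in> topspace limit. act g x \<in> U})"
  proof (intro equalityI subsetI)
    fix x assume "x \<in> {x \<in> topspace limit. \<phi> x \<in> \<phi> ` U}"
    then obtain u where u: "x \<in> points" "u \<in> U" "\<phi> x = \<phi> u" by (auto simp: spaces.topspace_limit)
    then obtain g where "g \<in> threads" "u = act g x"
      using \<phi>_orbits Up unfolding fibres_are_orbits_def by blast
    then show "x \<in> (\<Union>g\<in>threads. {x \<in> topspace limit. act g x \<in> U})"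
      using u by (auto simp: spaces.topspace_limit)
  next
    fix x assume "x \<in> (\<Union>g\<in>threads. {x \<in> topspace limit. act g x \<in> U})"
    then obtain g where g: "g \<in> threads" "x \<in> points" "act g x \<in> U" by (auto simp: spaces.topspace_limit)
    then have "\<phi> x = \<phi> (act g x)"
      using \<phi>_orbits act_closed[OF g(1,2)] unfolding fibres_are_orbits_def by blast
    then show "x \<in> {x \<in> topspace limit. \<phi> x \<in> \<phi> ` U}" using g by (simp add: spaces.topspace_limit)
  qed
  moreover have "openin limit {x \<in> topspace limit. act g x \<in> U}" if "g \<in> threads" for g
    using openin_continuous_map_preimage[OF continuous_act[OF that] U] .
  ultimately have "openin limit {x \<in> topspace limit. \<phi> x \<in> \<phi> ` U}"
    by auto
  moreover have "\<phi> ` U \<subseteq> topspace X" using Up \<phi>_surj by blast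
  ultimately show "openin X (\<phi> ` U)"
    using \<phi>_quotient unfolding quotient_map_def by blast
qed

text \<open>
  Images of entourages are entourages because \<open>\<phi>\<close> is open, and every entourage of \<open>X\<close> is the image
  of its preimage.
\<close>

lemma quotient_uniformity:
  "compact_entourages X = (\<lambda>E. map_prod \<phi> \<phi> ` E) ` compact_entourages limit"
proof
  show "(\<lambda>E. map_prod \<phi> \<phi> ` E) ` compact_entourages limit \<subseteq> compact_entourages X"
  proof clarify
    fix E assume E: "E \<in> compact_entourages limit"
    then obtain W where W: "openin (prod_topology limit limit) W" "Id_on points \<subseteq> W" "W \<subseteq> E"
      unfolding compact_entourages_def spaces.topspace_limit by blast
    have "openin (prod_topology X X) (map_prod \<phi> \<phi> ` W)"
      using open_map_prod_image[OF \<phi>_open \<phi>_open W(1)] .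
    moreover have "Id_on (topspace X) \<subseteq> map_prod \<phi> \<phi> ` W"
    proof -
      have "(\<phi> x, \<phi> x) \<in> map_prod \<phi> \<phi> ` W" if "x \<in> points" for x
        using that W(2) by (intro map_prod_imageI) blast
      then show ?thesis unfolding \<phi>_surj[symmetric] by auto
    qed
    moreover have "map_prod \<phi> \<phi> ` W \<subseteq> map_prod \<phi> \<phi> ` E" using W(3) by blast
    moreover have "sym (map_prod \<phi> \<phi> ` E)"
    proof (rule symI)
      fix a b assume "(a, b) \<in> map_prod \<phi> \<phi> ` E"
      then obtain x y where "(x, y) \<in> E" "a = \<phi> x" "b = \<phi> y" by auto
      moreover have "sym E" using E by (simp add: compact_entourages_def)
      ultimately show "(b, a) \<in> map_prod \<phi> \<phi> ` E" by (metis map_prod_imageI symD)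
    qed
    moreover have "map_prod \<phi> \<phi> ` E \<subseteq> topspace X \<times> topspace X"
      using limit_entourage_subset[OF E] \<phi>_surj by auto
    ultimately show "map_prod \<phi> \<phi> ` E \<in> compact_entourages X"
      unfolding compact_entourages_def by blast
  qed
  show "compact_entourages X \<subseteq> (\<lambda>E. map_prod \<phi> \<phi> ` E) ` compact_entourages limit"
  proof
    fix E assume E: "E \<in> compact_entourages X"
    then obtain W where W: "openin (prod_topology X X) W" "Id_on (topspace X) \<subseteq> W" "W \<subseteq> E"
      and EX: "E \<subseteq> topspace X \<times> topspace X" "sym E"
      unfolding compact_entourages_def by blast
    let ?LL = "prod_topology limit limit"
    define E' where "E' = {w \<in> points \<times> points. map_prod \<phi> \<phi> w \<in> E}"
    have "continuous_map ?LL (prod_topology X X) (\<lambda>w. (\<phi> (fst w), \<phi> (snd w)))"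
      using continuous_map_compose[OF continuous_map_fst[of limit limit] \<phi>_continuous]
        continuous_map_compose[OF continuous_map_snd[of limit limit] \<phi>_continuous]
      by (simp add: continuous_map_pairwise o_def)
    then have "openin ?LL {w \<in> topspace ?LL. (\<phi> (fst w), \<phi> (snd w)) \<in> W}"
      using W(1) by (rule openin_continuous_map_preimage)
    moreover have "Id_on points \<subseteq> {w \<in> topspace ?LL. (\<phi> (fst w), \<phi> (snd w)) \<in> W}"
    proof -
      have "(\<phi> x, \<phi> x) \<in> W" if "x \<in> points" for x
        using W(2) that unfolding \<phi>_surj[symmetric] by blast
      then show ?thesis by (auto simp: spaces.topspace_limit)
    qed
    moreover have "{w \<in> topspace ?LL. (\<phi> (fst w), \<phi> (snd w)) \<in> W} \<subseteq> E'"
      using W(3) by (auto simp: E'_def spaces.topspace_limit)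
    moreover have "sym E'" using EX(2) by (auto simp: E'_def sym_def)
    moreover have "E' \<subseteq> points \<times> points" by (auto simp: E'_def)
    ultimately have "E' \<in> compact_entourages limit"
      unfolding compact_entourages_def spaces.topspace_limit by blast
    moreover have "map_prod \<phi> \<phi> ` E' = E"
    proof
      show "map_prod \<phi> \<phi> ` E' \<subseteq> E" by (auto simp: E'_def)
      show "E \<subseteq> map_prod \<phi> \<phi> ` E'"
      proof
        fix w assume w: "w \<in> E"
        obtain a b where ab: "w = (a, b)" "a \<in> topspace X" "b \<in> topspace X" using w EX(1) by blast
        then obtain x y where xy: "x \<in> points" "y \<in> points" "a = \<phi> x" "b = \<phi> y"
          unfolding \<phi>_surj[symmetric] by (elim imageE) blast
        then have "(x, y) \<in> E'" using w ab by (simp add: E'_def)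
        then show "w \<in> map_prod \<phi> \<phi> ` E'" using xy ab(1) by (metis map_prod_imageI)
      qed
    qed
    ultimately show "E \<in> (\<lambda>E. map_prod \<phi> \<phi> ` E) ` compact_entourages limit" by blast
  qed
qed

lemma generalized_regular_covering:
  "generalized_regular_covering_map limit (compact_entourages limit) D X (compact_entourages X) \<phi>"
  unfolding generalized_regular_covering_map_def spaces.topspace_limit
  using uniform_limit uniform_space_on_compact_entourages[OF compact_base metrizable_base] subgroup_D
    acts_isomorphically_D acts_prodiscretely_D complete_D \<phi>_quotient \<phi>_orbits quotient_uniformity
  by simp

end

section \<open>The system of all covers\<close>

lemma trivial_cover:
  assumes "continuum X"
  shows "finite_regular_cover X X {\<lambda>x\<in>topspace X. x} id"
proof
  let ?e = "\<lambda>x\<in>topspace X. x"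
  have "compose (topspace X) ?e ?e = ?e" by (auto simp: compose_def)
  moreover have "homeomorphic_map X X ?e"
    by (rule homeomorphic_map_eq[of X X id]) auto
  ultimately show "homeo_group X {?e}"
    unfolding homeo_group_def subgroup_BijGroup_iff by (simp add: id_Bij)
  show "fibres_are_orbits (topspace X) {?e} id"
    by (auto simp: fibres_are_orbits_def)
qed (use assms in \<open>auto simp: continuum_def metrizable_imp_Hausdorff_space free_action_def\<close>)

text \<open>
  Transport along an injection turns a cover whose space lives in another type into one to which the
  completeness of the family applies.
\<close>

lemma represented_cover:
  fixes Xs :: "'i \<Rightarrow> 'b topology" and W :: "'c topology"
  assumes complete: "\<And>(Y :: 'b topology) G f. continuum_cover X Y G f
      \<Longrightarrow> \<exists>i\<in>I. equivalent_covers Y G f (Xs i) (Gs i) (fs i)"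
    and W: "finite_regular_cover X W H k" "metrizable_space W"
    and small: "topspace W \<lesssim> (UNIV :: 'b set)"
  obtains i h where "i \<in> I" "homeomorphic_map (Xs i) W h" "\<And>x. x \<in> topspace (Xs i) \<Longrightarrow> k (h x) = fs i x"
proof -
  interpret W: finite_regular_cover X W H k by fact
  obtain j :: "'c \<Rightarrow> 'b" where "inj_on j (topspace W)"
    using small unfolding lepoll_def by blast
  then obtain Z where "homeomorphic_map W Z j"
    using homeomorphic_copy_along_injection by blast
  then obtain m where m: "homeomorphic_map Z W m"
    by (meson homeomorphic_map_maps homeomorphic_maps_sym)
  interpret Z: finite_regular_cover X Z "deck_group Z (k \<circ> m)" "k \<circ> m"
    using W.homeomorphic_copy[OF m] .
  have "metrizable_space Z"
    using homeomorphic_metrizable_space[OF homeomorphic_map_imp_homeomorphic_space[OF m]] W(2) by simp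
  then have "continuum_cover X Z (deck_group Z (k \<circ> m)) (k \<circ> m)"
    unfolding continuum_cover_def continuum_def
    using Z.nonempty Z.compact Z.connected Z.regular_covering by blast
  then obtain i where i: "i \<in> I" "equivalent_covers Z (deck_group Z (k \<circ> m)) (k \<circ> m) (Xs i) (Gs i) (fs i)"
    using complete by blast
  then obtain h where h: "homeomorphic_map Z (Xs i) h" "\<And>z. z \<in> topspace Z \<Longrightarrow> fs i (h z) = k (m z)"
    unfolding equivalent_covers_def by auto
  obtain l where l: "homeomorphic_maps Z (Xs i) h l"
    using h(1) homeomorphic_map_maps by blast
  have lh: "homeomorphic_map (Xs i) Z l" using l homeomorphic_maps_map by blast
  have "k ((m \<circ> l) x) = fs i x" if x: "x \<in> topspace (Xs i)" for x
  proof -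
    have "l x \<in> topspace Z" using homeomorphic_imp_surjective_map[OF lh] x by blast
    moreover have "h (l x) = x" using l x by (simp add: homeomorphic_maps_def)
    ultimately show ?thesis using h(2)[of "l x"] by simp
  qed
  moreover have "homeomorphic_map (Xs i) W (m \<circ> l)"
    using lh m by (rule homeomorphic_map_compose)
  ultimately show ?thesis using that i(1) by blast
qed

lemma cover_le_of_homeomorphic_map:
  assumes h: "homeomorphic_map (Xs k) W h" and p: "continuous_map W (Xs i) p" "p ` topspace W = topspace (Xs i)"
    and eq: "\<And>x. x \<in> topspace (Xs k) \<Longrightarrow> fs k x = fs i (p (h x))"
  shows "cover_le Xs fs i k"
  unfolding cover_le_def
proof (intro exI conjI)
  show "continuous_map (Xs k) (Xs i) (p \<circ> h)"
    using homeomorphic_imp_continuous_map[OF h] p(1) by (rule continuous_map_compose)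
  show "(p \<circ> h) ` topspace (Xs k) = topspace (Xs i)"
    using homeomorphic_imp_surjective_map[OF h] p(2) by (metis image_comp)
qed (simp add: eq)

text \<open>
  The common refinement is represented in the family because its space fits into the type \<open>'b\<close>.
\<close>

proposition directed_covers:
  fixes X :: "'a topology" and Xs :: "'i \<Rightarrow> 'b topology"
  assumes X: "continuum X" "topspace X \<lesssim> (UNIV :: 'b set)"
    and cover: "\<And>i. i \<in> I \<Longrightarrow> continuum_cover X (Xs i) (Gs i) (fs i)"
    and complete: "\<And>(Y :: 'b topology) G f. continuum_cover X Y G f
      \<Longrightarrow> \<exists>i\<in>I. equivalent_covers Y G f (Xs i) (Gs i) (fs i)"
  shows "directed_on I (cover_le Xs fs)"
  unfolding directed_on_def
proof (intro conjI ballI)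
  have frc: "finite_regular_cover X (Xs i) (Gs i) (fs i)" if "i \<in> I" for i
    using continuum_cover_imp_finite_regular_cover[OF X(1) cover[OF that]] .
  have metr: "metrizable_space (Xs i)" if "i \<in> I" for i
    using cover[OF that] by (simp add: continuum_cover_def continuum_def)
  obtain i where "i \<in> I"
    using represented_cover[OF complete trivial_cover[OF X(1)] _ X(2)] X(1) unfolding continuum_def by metis
  then show "I \<noteq> {}" by blast
  show "reflp_on I (cover_le Xs fs)"
    by (auto simp: reflp_on_def cover_le_def intro!: exI[of _ id])
  show "transp_on I (cover_le Xs fs)"
  proof (rule transp_onI)
    fix i j k assume ij: "cover_le Xs fs i j" and jk: "cover_le Xs fs j k"
    obtain g where g: "continuous_map (Xs j) (Xs i) g" "g ` topspace (Xs j) = topspace (Xs i)"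
      "\<forall>x\<in>topspace (Xs j). fs j x = fs i (g x)" using ij unfolding cover_le_def by blast
    obtain h where h: "continuous_map (Xs k) (Xs j) h" "h ` topspace (Xs k) = topspace (Xs j)"
      "\<forall>x\<in>topspace (Xs k). fs k x = fs j (h x)" using jk unfolding cover_le_def by blast
    show "cover_le Xs fs i k"
      unfolding cover_le_def
    proof (intro exI conjI ballI)
      show "continuous_map (Xs k) (Xs i) (g \<circ> h)" using h(1) g(1) by (rule continuous_map_compose)
      show "(g \<circ> h) ` topspace (Xs k) = topspace (Xs i)" using g(2) h(2) by (metis image_comp)
      show "fs k x = fs i ((g \<circ> h) x)" if "x \<in> topspace (Xs k)" for x
      proof -
        have "h x \<in> topspace (Xs j)" using that h(2) by blast
        then show ?thesis using g(3) h(3) that by simp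
      qed
    qed
  qed
  fix i j assume i: "i \<in> I" and j: "j \<in> I"
  interpret i: finite_regular_cover X "Xs i" "Gs i" "fs i" using frc[OF i] .
  interpret j: finite_regular_cover X "Xs j" "Gs j" "fs j" using frc[OF j] .
  obtain C where C: "finite_regular_cover X (subtopology (prod_topology (Xs i) (Xs j)) C)
       (deck_group (subtopology (prod_topology (Xs i) (Xs j)) C) (fs i \<circ> fst)) (fs i \<circ> fst)"
    "C \<subseteq> topspace (Xs i) \<times> topspace (Xs j)" "fst ` C = topspace (Xs i)" "snd ` C = topspace (Xs j)"
    "\<And>c. c \<in> C \<Longrightarrow> fs i (fst c) = fs j (snd c)"
    using two_covers.common_refinement[OF two_covers.intro[OF frc[OF i] frc[OF j]]] by blast
  define W where "W = subtopology (prod_topology (Xs i) (Xs j)) C"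
  have topW: "topspace W = C" using C(2) by (auto simp: W_def)
  have "metrizable_space W"
    unfolding W_def using metr i j
    by (intro metrizable_space_subtopology) (simp add: metrizable_space_prod_topology)
  moreover have "topspace W \<lesssim> (UNIV :: 'b set)"
    using Times_lepoll_of_connected[of "Xs i" "Xs j"] i.connected j.connected i.Hausdorff j.Hausdorff
      Hausdorff_imp_t1_space subset_imp_lepoll[OF C(2)] lepoll_trans unfolding topW by blast
  ultimately obtain k h where k: "k \<in> I" "homeomorphic_map (Xs k) W h"
    "\<And>x. x \<in> topspace (Xs k) \<Longrightarrow> (fs i \<circ> fst) (h x) = fs k x"
    using represented_cover[OF complete C(1)] unfolding W_def by metis
  have hC: "h x \<in> C" if "x \<in> topspace (Xs k)" for x
    using homeomorphic_imp_surjective_map[OF k(2)] topW that by blast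
  have "cover_le Xs fs i k"
  proof (rule cover_le_of_homeomorphic_map[of Xs k W h])
    show "homeomorphic_map (Xs k) W h" by (rule k(2))
    show "continuous_map W (Xs i) fst"
      unfolding W_def by (intro continuous_map_from_subtopology continuous_map_fst)
    show "fst ` topspace W = topspace (Xs i)" using C(3) topW by simp
    show "fs k x = fs i (fst (h x))" if "x \<in> topspace (Xs k)" for x using k(3)[OF that] by simp
  qed
  moreover have "cover_le Xs fs j k"
  proof (rule cover_le_of_homeomorphic_map[of Xs k W h])
    show "homeomorphic_map (Xs k) W h" by (rule k(2))
    show "continuous_map W (Xs j) snd"
      unfolding W_def by (intro continuous_map_from_subtopology continuous_map_snd)
    show "snd ` topspace W = topspace (Xs j)" using C(4) topW by simp
    show "fs k x = fs j (snd (h x))" if "x \<in> topspace (Xs k)" for x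
      using k(3)[OF that] C(5)[OF hC[OF that]] by simp
  qed
  ultimately show "\<exists>k\<in>I. cover_le Xs fs i k \<and> cover_le Xs fs j k" using k(1) by blast
qed

text \<open>
  Any map between two covers can be corrected by a deck transformation of the lower one so as to
  respect the base points.
\<close>

lemma pointed_cover_morphism:
  assumes Y: "finite_regular_cover X Y G f" and Z: "finite_regular_cover X Z H k"
    and h: "continuous_map Z Y h" "h ` topspace Z = topspace Y" "\<And>z. z \<in> topspace Z \<Longrightarrow> k z = f (h z)"
    and y: "y \<in> topspace Y" and z: "z \<in> topspace Z" "k z = f y"
  shows "\<exists>h. cover_morphism X Y G f Z H k h \<and> h z = y \<and> h \<in> extensional (topspace Z)"
proof -
  interpret Y: finite_regular_cover X Y G f by fact
  have hm: "cover_morphism X Y G f Z H k h"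
    using Y Z h by (simp add: cover_morphism_def cover_morphism_axioms_def)
  have "h z \<in> topspace Y" using h(2) z(1) by blast
  then obtain g where g: "g \<in> G" "y = g (h z)"
    using Y.same_fibre[of "h z" y] y z h(3) by auto
  have "compose (topspace Z) g h z = y" using g z(1) by (simp add: compose_eq)
  then show ?thesis
    using cover_morphism_act[OF hm g(1)] by (auto simp: compose_extensional)
qed

theorem theorem2:
  fixes X :: "'a topology"
    and I :: "'i set"
    and Xs :: "'i \<Rightarrow> 'b topology"
    and Gs :: "'i \<Rightarrow> ('b \<Rightarrow> 'b) set"
    and fs :: "'i \<Rightarrow> 'b \<Rightarrow> 'a"
    and base :: 'a
    and bases :: "'i \<Rightarrow> 'b"
  assumes "continuum X"
    \<comment> \<open>The type \<open>'b\<close> is large enough to carry all covers: fibres of covers by continua are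
       finite, and \<open>X\<close> is a single point or infinite. With \<open>'b = 'a\<close> this is no restriction.\<close>
    and "topspace X \<lesssim> (UNIV :: 'b set)"
    and "\<And>i. i \<in> I \<Longrightarrow> continuum_cover X (Xs i) (Gs i) (fs i)"
    and "\<And>i j. \<lbrakk>i \<in> I; j \<in> I; equivalent_covers (Xs i) (Gs i) (fs i) (Xs j) (Gs j) (fs j)\<rbrakk>
           \<Longrightarrow> i = j"
    and "\<And>(Y :: 'b topology) G f. continuum_cover X Y G f
           \<Longrightarrow> \<exists>i\<in>I. equivalent_covers Y G f (Xs i) (Gs i) (fs i)"
    and "base \<in> topspace X"
    and "\<And>i. i \<in> I \<Longrightarrow> bases i \<in> topspace (Xs i) \<and> fs i (bases i) = base"
  shows "directed_on I (cover_le Xs fs) \<and>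
    (\<exists>f \<theta>.
       (\<forall>i\<in>I. \<forall>j\<in>I. cover_le Xs fs i j \<longrightarrow>
          f i j \<in> regular_covering_factors (Xs i) (fs i) (Xs j) (fs j) \<and>
          f i j (bases j) = bases i \<and>
          regular_covering_factors (Xs i) (fs i) (Xs j) (fs j)
            = (\<lambda>g. compose (topspace (Xs j)) g (f i j)) ` Gs i \<and>
          (\<forall>g\<in>Gs j. \<forall>x\<in>topspace (Xs j). \<theta> i j g (f i j x) = f i j (g x))) \<and>
       inverse_system I (cover_le Xs fs) Xs f \<and>
       group_inverse_system I (cover_le Xs fs) (\<lambda>i. bij_subgroup (topspace (Xs i)) (Gs i)) \<theta> \<and>
       (let Xhat = inverse_limit I (cover_le Xs fs) Xs f;
            \<pi>P = inverse_limit_group I (cover_le Xs fs)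
                   (\<lambda>i. bij_subgroup (topspace (Xs i)) (Gs i)) \<theta>;
            \<pi>P_top = inverse_limit I (cover_le Xs fs) (\<lambda>i. discrete_topology (Gs i)) \<theta>;
            act = coordinatewise I (topspace Xhat);
            D = act ` carrier \<pi>P
        in continuum Xhat \<and>
           (\<forall>i\<in>I. finite (Gs i)) \<and>
           profinite_group \<pi>P \<pi>P_top \<and>
           act \<in> iso \<pi>P (bij_subgroup (topspace Xhat) D) \<and>
           homeomorphic_map \<pi>P_top
             (uniform_topology D
                (uniform_convergence (topspace Xhat) (compact_entourages Xhat) D)) act \<and>
           (\<exists>\<phi>. (\<forall>i\<in>I. \<forall>x\<in>topspace Xhat. \<phi> x = fs i (x i)) \<and>
                generalized_regular_covering_map
                  Xhat (compact_entourages Xhat) D X (compact_entourages X) \<phi>)))"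
proof -
  note X = assms(1) and cover = assms(3) and base = assms(7)
  let ?rel = "cover_le Xs fs"
  have frc: "finite_regular_cover X (Xs i) (Gs i) (fs i)" if "i \<in> I" for i
    using continuum_cover_imp_finite_regular_cover[OF X cover[OF that]] .
  have metr: "metrizable_space (Xs i)" if "i \<in> I" for i
    using cover[OF that] by (simp add: continuum_cover_def continuum_def)
  have X_compact: "compact_space X" and X_metr: "metrizable_space X"
    using X by (simp_all add: continuum_def)
  have countable: "countable I"
    using countable_covers[OF X_compact X_metr, of I Xs Gs fs] frc metr assms(4) by blast
  have directed: "directed_on I ?rel"
    using directed_covers[OF X assms(2) cover assms(5)] .
  define f where "f = (\<lambda>i j. SOME h. cover_morphism X (Xs i) (Gs i) (fs i) (Xs j) (Gs j) (fs j) h \<and>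
      h (bases j) = bases i \<and> h \<in> extensional (topspace (Xs j)))"
  have f: "cover_morphism X (Xs i) (Gs i) (fs i) (Xs j) (Gs j) (fs j) (f i j)"
    "f i j (bases j) = bases i" "f i j \<in> extensional (topspace (Xs j))"
    if ij: "i \<in> I" "j \<in> I" "?rel i j" for i j
  proof -
    obtain h where h: "continuous_map (Xs j) (Xs i) h" "h ` topspace (Xs j) = topspace (Xs i)"
      "\<forall>x\<in>topspace (Xs j). fs j x = fs i (h x)"
      using ij(3) unfolding cover_le_def by blast
    have "\<exists>h. cover_morphism X (Xs i) (Gs i) (fs i) (Xs j) (Gs j) (fs j) h \<and>
        h (bases j) = bases i \<and> h \<in> extensional (topspace (Xs j))"
      by (rule pointed_cover_morphism[OF frc[OF ij(1)] frc[OF ij(2)] h(1,2)])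
        (use h(3) base[OF ij(1)] base[OF ij(2)] in auto)
    from someI_ex[OF this]
    show "cover_morphism X (Xs i) (Gs i) (fs i) (Xs j) (Gs j) (fs j) (f i j)"
      "f i j (bases j) = bases i" "f i j \<in> extensional (topspace (Xs j))"
      unfolding f_def by blast+
  qed
  note f_cont = cover_morphism.h_cont[OF f(1)] and f_lift = cover_morphism.h_lift[OF f(1)]
  have refl: "?rel i i" if "i \<in> I" for i
    using directed that unfolding directed_on_def reflp_on_def by blast
  have trans: "?rel i k" if "i \<in> I" "j \<in> I" "k \<in> I" "?rel i j" "?rel j k" for i j k
    using directed that unfolding directed_on_def transp_on_def by blast
  have system: "inverse_system I ?rel Xs f"
    unfolding inverse_system_def functorial_on_def
  proof (intro conjI ballI impI)
    show "continuous_map (Xs j) (Xs i) (f i j)" if "i \<in> I" "j \<in> I" "?rel i j" for i j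
      using f_cont[OF that] .
    \<comment> \<open>Two lifts of the same map that agree at the base point are equal.\<close>
    show "f i i x = x" if i: "i \<in> I" and x: "x \<in> topspace (Xs i)" for i x
    proof -
      interpret finite_regular_cover X "Xs i" "Gs i" "fs i" using frc[OF i] .
      show ?thesis
        using lift_eq[OF connected f_cont[OF i i refl[OF i]] continuous_map_id _ _ _ x, of "bases i"]
          f_lift[OF i i refl[OF i]] f(2)[OF i i refl[OF i]] base[OF i] by simp
    qed
    show "f i j (f j k x) = f i k x"
      if ijk: "i \<in> I" "j \<in> I" "k \<in> I" "?rel i j" "?rel j k" and x: "x \<in> topspace (Xs k)" for i j k x
    proof -
      interpret i: finite_regular_cover X "Xs i" "Gs i" "fs i" using frc[OF ijk(1)] .
      interpret k: finite_regular_cover X "Xs k" "Gs k" "fs k" using frc[OF ijk(3)] .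
      have ik: "?rel i k" using trans ijk by blast
      have jk: "f j k z \<in> topspace (Xs j)" if "z \<in> topspace (Xs k)" for z
        using cover_morphism.h_closed[OF f(1)[OF ijk(2,3,5)] that] .
      have "(f i j \<circ> f j k) x = f i k x"
      proof (rule i.lift_eq[OF k.connected _ f_cont[OF ijk(1,3) ik] _ _ _ x, of _ "bases k"])
        show "continuous_map (Xs k) (Xs i) (f i j \<circ> f j k)"
          using f_cont[OF ijk(2,3,5)] f_cont[OF ijk(1,2,4)] by (rule continuous_map_compose)
        show "fs i ((f i j \<circ> f j k) c) = fs i (f i k c)" if c: "c \<in> topspace (Xs k)" for c
          using f_lift[OF ijk(1,3) ik c] f_lift[OF ijk(2,3,5) c] f_lift[OF ijk(1,2,4) jk[OF c]] by simp
        show "bases k \<in> topspace (Xs k)" using base[OF ijk(3)] by simp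
        show "(f i j \<circ> f j k) (bases k) = f i k (bases k)"
          using f(2)[OF ijk(1,3) ik] f(2)[OF ijk(2,3,5)] f(2)[OF ijk(1,2,4)] by simp
      qed
      then show ?thesis by simp
    qed
  qed
  interpret S: cover_system X I ?rel Xs Gs fs f
    by (rule cover_system.intro[OF directed frc metr countable X_compact X_metr system f(1)])
  have bonding: "f i j \<in> regular_covering_factors (Xs i) (fs i) (Xs j) (fs j) \<and>
      f i j (bases j) = bases i \<and>
      regular_covering_factors (Xs i) (fs i) (Xs j) (fs j)
        = (\<lambda>g. compose (topspace (Xs j)) g (f i j)) ` Gs i \<and>
      (\<forall>g\<in>Gs j. \<forall>x\<in>topspace (Xs j). S.\<theta> i j g (f i j x) = f i j (g x))"
    if ij: "i \<in> I" "j \<in> I" "?rel i j" for i j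
  proof -
    interpret m: cover_morphism X "Xs i" "Gs i" "fs i" "Xs j" "Gs j" "fs j" "f i j"
      using f(1)[OF ij] .
    have "compose (topspace (Xs j)) (\<lambda>y\<in>topspace (Xs i). y) (f i j) = f i j"
      using f(3)[OF ij] m.h_closed by (intro extensionalityI[of _ "topspace (Xs j)"]) (auto simp: compose_def)
    then have "f i j \<in> (\<lambda>g. compose (topspace (Xs j)) g (f i j)) ` Gs i"
      using m.lower.id_mem by (metis imageI)
    then show ?thesis
      using m.regular_covering_factors_eq f(2)[OF ij] S.\<theta>(2)[OF ij] by blast
  qed
  have group_top: "S.groups.discrete.limit = inverse_limit I ?rel (\<lambda>i. discrete_topology (Gs i)) S.\<theta>"
    by simp
  have phi: "\<exists>\<phi>. (\<forall>i\<in>I. \<forall>x\<in>S.points. \<phi> x = fs i (x i)) \<and>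
      generalized_regular_covering_map S.limit (compact_entourages S.limit) S.D X (compact_entourages X) \<phi>"
    using S.\<phi> S.generalized_regular_covering by blast
  have finite: "\<forall>i\<in>I. finite (Gs i)"
    using finite_regular_cover.finite_group[OF frc] by blast
  show ?thesis
    unfolding Let_def S.spaces.topspace_limit S.carrier_limit_group
  proof (intro conjI exI[of _ f] exI[of _ S.\<theta>])
    show "directed_on I ?rel" by (rule directed)
    show "\<forall>i\<in>I. \<forall>j\<in>I. ?rel i j \<longrightarrow>
          f i j \<in> regular_covering_factors (Xs i) (fs i) (Xs j) (fs j) \<and>
          f i j (bases j) = bases i \<and>
          regular_covering_factors (Xs i) (fs i) (Xs j) (fs j)
            = (\<lambda>g. compose (topspace (Xs j)) g (f i j)) ` Gs i \<and>
          (\<forall>g\<in>Gs j. \<forall>x\<in>topspace (Xs j). S.\<theta> i j g (f i j x) = f i j (g x))"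
      using bonding by blast
    show "inverse_system I ?rel Xs f" by (rule system)
    show "group_inverse_system I ?rel (\<lambda>i. bij_subgroup (topspace (Xs i)) (Gs i)) S.\<theta>"
      by (rule S.deck_group_system)
  qed (use S.continuum_limit finite S.groups.profinite_limit S.act_iso S.homeomorphic_map_act phi
      in \<open>simp_all only: group_top S.spaces.topspace_limit S.carrier_limit_group\<close>)
qed

end
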